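(* Let $L$ be a Lorentz-Finsler metric on $A$ with vanishing mean Cartan tensor ($\mathrm{C}_i=0$) and let $n\ge 3$. Then $\mathrm{N}^L$ is the unique symmetric proper solution of the affine equation of $L$.
   Context: $M$ is a connected smooth manifold of dimension $n$, $\pi:TM\to M$ the projection. Charts $(x^i)$ of $M$ induce charts $(x^i,y^i)$ of $TM$; $\partial_i=\partial/\partial x^i$, $\dot\partial_i=\partial/\partial y^i$; repeated indices are summed. $A\subseteq TM\setminus\mathbf{0}$ is open and conic ($\lambda v\in A$ for $v\in A$, $\lambda>0$) with $\pi(A)=M$; $A_p=A\cap T_pM$; $\overline A$ is the closure of $A$ in $TM\setminus\mathbf 0$, $\partial A=\overline A\setminus A$. An anisotropic tensor of type $(r,s)$ is a smooth section of the pullback to $A$ of $\bigotimes^rTM\otimes\bigotimes^sT^*M$, with components $T^{i_1\dots i_r}_{j_1\dots j_s}(x,y)$; the space of those with components positively $\alpha$-homogeneous in $y$ is $\mathrm{h}^\alpha\mathcal{T}^r_s(M_A)$. A subscript $\cdot i$ denotes $\dot\partial_i$. A homogeneous nonlinear connection $\mathrm{N}$ on $A$ is given in each chart by smooth functions $\mathrm{N}_i^k(x,y)$, positively $1$-homogeneous in $y$, transforming by $\bar{\mathrm{N}}_i^k=\frac{\partial\bar x^k}{\partial x^c}\frac{\partial^2x^c}{\partial\bar x^i\partial\bar x^b}\bar y^b+\frac{\partial\bar x^k}{\partial x^c}\frac{\partial x^a}{\partial\bar x^i}\mathrm{N}_a^c$. Differences of two such lie in $\mathrm{h}^1\mathcal{T}^1_1(M_A)$.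 $\mathrm{N}$ is symmetric if $\mathrm{N}^k_{i\cdot j}=\mathrm{N}^k_{j\cdot i}$. A pseudo-Finsler metric on $A$ is a smooth positively $2$-homogeneous $L:A\to\mathbb{R}$ with $g_{ij}=\frac12L_{\cdot i\cdot j}$ non-degenerate everywhere. It is proper if (i) each $A_p$ is connected and $L>0$ on $A$, and (ii) $L$ extends smoothly to $\overline A$ with $L=0$ and $g$ non-degenerate on $\partial A$. It is Lorentz-Finsler if it is proper and $g$ has signature $(+,-,\dots,-)$. Indices are moved with $g$; $y_i=g_{ia}y^a$. $(\mathrm{G}^L)^i=\frac14g^{ia}(2\partial_cg_{ab}-\partial_ag_{bc})y^by^c$; $(\mathrm{N}^L)_i^k=\dot\partial_i(\mathrm{G}^L)^k$. $\mathrm{C}_{ijk}=\frac12g_{ij\cdot k}$, $\mathrm{C}_i=g^{ab}\mathrm{C}_{abi}$. $\mathrm{Lan}_{ijk}=\frac12\nabla^L_kg_{ij}$ with $\nabla^L_kg_{ij}=(\partial_k-(\mathrm{N}^L)_k^a\dot\partial_a)g_{ij}-(\mathrm{N}^L)^a_{k\cdot i}g_{aj}-(\mathrm{N}^L)^a_{k\cdot j}g_{ia}$, $\mathrm{Lan}_i=g^{ab}\mathrm{Lan}_{abi}$. $\mathrm{N}=\mathrm{N}^L+\mathcal{J}$, $\mathcal{J}\in\mathrm{h}^1\mathcal{T}^1_1(M_A)$, is a solution of the affine equation of $L$ if on $A$ $$\Big\{2\mathrm{Lan}_b+(n+2)\tfrac{y_a}{L}\mathcal{J}^a_b-2\mathrm{C}_a\mathcal{J}^a_b-(\mathcal{J}^a_{b\cdot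 a}+\mathcal{J}^a_{a\cdot b})\Big\}(\delta^b_iy^j-y^b\delta^j_i)-(\mathcal{J}^j_{i\cdot a}-\mathcal{J}^j_{a\cdot i})y^a=0 ;$$ it is a proper solution if moreover $\mathrm{N}$ extends smoothly to $\overline A$. *)

theory Defs
  imports "HOL-Analysis.Analysis"
begin

section \<open>Smooth maps between Euclidean spaces\<close>

text \<open>Intended for open \<open>S\<close>: the derivatives are two-sided derivatives at the points of \<open>S\<close>.\<close>

primrec times_differentiable_on ::
  "nat \<Rightarrow> 'a::euclidean_space set \<Rightarrow> ('a \<Rightarrow> 'b::real_normed_vector) \<Rightarrow> bool" where
  "times_differentiable_on 0 S f \<longleftrightarrow> continuous_on S f"
| "times_differentiable_on (Suc k) S f \<longleftrightarrow>
     (\<forall>x\<in>S. f differentiable (at x)) \<and>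
     (\<forall>v. times_differentiable_on k S (\<lambda>x. frechet_derivative f (at x) v))"

definition smooth_on :: "'a::euclidean_space set \<Rightarrow> ('a \<Rightarrow> 'b::real_normed_vector) \<Rightarrow> bool" where
  "smooth_on S f \<longleftrightarrow> (\<forall>k. times_differentiable_on k S f)"

definition pd :: "'n::finite \<Rightarrow> (real^'n \<Rightarrow> 'b::real_normed_vector) \<Rightarrow> real^'n \<Rightarrow> 'b" where
  "pd i f x = frechet_derivative f (at x) (axis i 1)"


section \<open>Smooth manifolds and their tangent bundles\<close>

text \<open>A chart is a domain together with a coordinate map; the values of the coordinate map
  outside the domain are irrelevant.\<close>

type_synonym ('a, 'n) chart = "'a set \<times> ('a \<Rightarrow> real^'n)"

definition transition :: "('a, 'n::finite) chart \<Rightarrow> ('a, 'n) chart \<Rightarrow> real^'n \<Rightarrow> real^'n" where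
  "transition c d = snd d \<circ> inv_into (fst c) (snd c)"

text \<open>The atlas is not required to be maximal. Everything below that is said to hold ``in each
  chart'' refers to the charts of the given atlas, which may be taken to be the maximal one.\<close>

definition smooth_manifold :: "'a topology \<Rightarrow> ('a, 'n::finite) chart set \<Rightarrow> bool" where
  "smooth_manifold X \<A> \<longleftrightarrow>
     Hausdorff_space X \<and> second_countable X \<and>
     (\<Union>c\<in>\<A>. fst c) = topspace X \<and>
     (\<forall>c\<in>\<A>. openin X (fst c) \<and> open (snd c ` fst c) \<and>
        homeomorphic_map (subtopology X (fst c)) (top_of_set (snd c ` fst c)) (snd c)) \<and>
     (\<forall>c\<in>\<A>. \<forall>d\<in>\<A>. smooth_on (snd c ` (fst c \<inter> fst d)) (transition c d))"

text \<open>A tangent vector at \<open>p\<close> is the family of its coordinate vectors, one for each chart around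
  \<open>p\<close>, related by the Jacobians of the transition maps. The value \<open>0\<close> at all other indices
  is a normalisation that makes tangent vectors unique as functions.\<close>

type_synonym ('a, 'n) tvec = "('a, 'n) chart \<Rightarrow> real^'n"

definition tangent_space :: "('a, 'n::finite) chart set \<Rightarrow> 'a \<Rightarrow> ('a, 'n) tvec set" where
  "tangent_space \<A> p =
     {v. (\<forall>c\<in>\<A>. \<forall>d\<in>\<A>. p \<in> fst c \<inter> fst d \<longrightarrow>
            v d = frechet_derivative (transition c d) (at (snd c p)) (v c)) \<and>
         (\<forall>c. c \<notin> \<A> \<or> p \<notin> fst c \<longrightarrow> v c = 0)}"

definition tangent_bundle ::
  "'a topology \<Rightarrow> ('a, 'n::finite) chart set \<Rightarrow> ('a \<times> ('a, 'n) tvec) set" where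
  "tangent_bundle X \<A> = Sigma (topspace X) (tangent_space \<A>)"

definition tchart :: "('a, 'n::finite) chart \<Rightarrow> 'a \<times> ('a, 'n) tvec \<Rightarrow> (real^'n) \<times> (real^'n)" where
  "tchart c w = (snd c (fst w), snd w c)"

definition tangent_topology ::
  "'a topology \<Rightarrow> ('a, 'n::finite) chart set \<Rightarrow> ('a \<times> ('a, 'n) tvec) topology" where
  "tangent_topology X \<A> = topology_generated_by
     {{w \<in> tangent_bundle X \<A>. fst w \<in> fst c \<and> tchart c w \<in> W} | c W. c \<in> \<A> \<and> open W}"

definition slit_topology ::
  "'a topology \<Rightarrow> ('a, 'n::finite) chart set \<Rightarrow> ('a \<times> ('a, 'n) tvec) topology" where
  "slit_topology X \<A> =
     subtopology (tangent_topology X \<A>) (tangent_bundle X \<A> - {w. snd w = (\<lambda>_. 0)})"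

text \<open>The part of a subset of \<open>TM\<close> over the domain of \<open>c\<close>, in the induced coordinates \<open>(x, y)\<close>,
  and the expression of a function on \<open>TM\<close> in these coordinates.\<close>

definition coords ::
  "('a, 'n::finite) chart \<Rightarrow> ('a \<times> ('a, 'n) tvec) set \<Rightarrow> ((real^'n) \<times> (real^'n)) set" where
  "coords c S = tchart c ` {w \<in> S. fst w \<in> fst c}"

definition local_rep ::
  "'a topology \<Rightarrow> ('a, 'n::finite) chart set \<Rightarrow> ('a, 'n) chart \<Rightarrow>
   ('a \<times> ('a, 'n) tvec \<Rightarrow> real) \<Rightarrow> (real^'n) \<times> (real^'n) \<Rightarrow> real" where
  "local_rep X \<A> c f = f \<circ> inv_into {w \<in> tangent_bundle X \<A>. fst w \<in> fst c} (tchart c)"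

definition conic_domain ::
  "'a topology \<Rightarrow> ('a, 'n::finite) chart set \<Rightarrow> ('a \<times> ('a, 'n) tvec) set \<Rightarrow> bool" where
  "conic_domain X \<A> A \<longleftrightarrow>
     openin (slit_topology X \<A>) A \<and>
     (\<forall>p v. \<forall>t>0. (p, v) \<in> A \<longrightarrow> (p, \<lambda>c. t *\<^sub>R v c) \<in> A) \<and>
     fst ` A = topspace X"


section \<open>Anisotropic tensors and nonlinear connections\<close>

definition dx :: "'n::finite \<Rightarrow> ((real^'n) \<times> (real^'n) \<Rightarrow> real) \<Rightarrow> (real^'n) \<times> (real^'n) \<Rightarrow> real" where
  "dx i f z = frechet_derivative f (at z) (axis i 1, 0)"

definition dy :: "'n::finite \<Rightarrow> ((real^'n) \<times> (real^'n) \<Rightarrow> real) \<Rightarrow> (real^'n) \<times> (real^'n) \<Rightarrow> real" where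
  "dy i f z = frechet_derivative f (at z) (0, axis i 1)"

text \<open>Objects with one upper index \<open>k\<close> and one lower index \<open>i\<close>, given by components in every
  chart \<open>c\<close>: \<open>T c k i (x, y)\<close>.\<close>

type_synonym ('a, 'n) components =
  "('a, 'n) chart \<Rightarrow> 'n \<Rightarrow> 'n \<Rightarrow> (real^'n) \<times> (real^'n) \<Rightarrow> real"

definition smooth_homogeneous_components ::
  "real \<Rightarrow> ('a, 'n::finite) chart set \<Rightarrow> ('a \<times> ('a, 'n) tvec) set \<Rightarrow> ('a, 'n) components \<Rightarrow> bool"
  where
  "smooth_homogeneous_components \<alpha> \<A> A T \<longleftrightarrow>
     (\<forall>c\<in>\<A>. \<forall>k i. smooth_on (coords c A) (T c k i) \<and>
        (\<forall>x y. \<forall>t>0. (x, y) \<in> coords c A \<longrightarrow> T c k i (x, t *\<^sub>R y) = t powr \<alpha> * T c k i (x, y)))"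

definition homogeneous_tensor_1_1 ::
  "real \<Rightarrow> ('a, 'n::finite) chart set \<Rightarrow> ('a \<times> ('a, 'n) tvec) set \<Rightarrow> ('a, 'n) components \<Rightarrow> bool"
  where
  "homogeneous_tensor_1_1 \<alpha> \<A> A T \<longleftrightarrow>
     smooth_homogeneous_components \<alpha> \<A> A T \<and>
     (\<forall>c\<in>\<A>. \<forall>d\<in>\<A>. \<forall>w\<in>A. fst w \<in> fst c \<inter> fst d \<longrightarrow> (\<forall>k i.
        T d k i (tchart d w) =
          (\<Sum>e\<in>UNIV. \<Sum>a\<in>UNIV.
             pd e (transition c d) (snd c (fst w)) $ k *
             pd i (transition d c) (snd d (fst w)) $ a * T c e a (tchart c w))))"

text \<open>The chart \<open>c\<close> carries the coordinates \<open>x\<close> and the chart \<open>d\<close> the coordinates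
  written with a bar in the transformation law of a nonlinear connection.\<close>

definition homogeneous_nonlinear_connection ::
  "('a, 'n::finite) chart set \<Rightarrow> ('a \<times> ('a, 'n) tvec) set \<Rightarrow> ('a, 'n) components \<Rightarrow> bool" where
  "homogeneous_nonlinear_connection \<A> A N \<longleftrightarrow>
     smooth_homogeneous_components 1 \<A> A N \<and>
     (\<forall>c\<in>\<A>. \<forall>d\<in>\<A>. \<forall>w\<in>A. fst w \<in> fst c \<inter> fst d \<longrightarrow> (\<forall>k i.
        N d k i (tchart d w) =
          (\<Sum>e\<in>UNIV. \<Sum>b\<in>UNIV.
             pd e (transition c d) (snd c (fst w)) $ k *
             pd i (pd b (transition d c)) (snd d (fst w)) $ e * snd w d $ b) +
          (\<Sum>e\<in>UNIV. \<Sum>a\<in>UNIV.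
             pd e (transition c d) (snd c (fst w)) $ k *
             pd i (transition d c) (snd d (fst w)) $ a * N c e a (tchart c w))))"

definition symmetric_connection ::
  "('a, 'n::finite) chart set \<Rightarrow> ('a \<times> ('a, 'n) tvec) set \<Rightarrow> ('a, 'n) components \<Rightarrow> bool" where
  "symmetric_connection \<A> A N \<longleftrightarrow>
     (\<forall>c\<in>\<A>. \<forall>z\<in>coords c A. \<forall>k i j. dy j (N c k i) z = dy i (N c k j) z)"

text \<open>Smooth extension to the closure means extension to an open neighbourhood of the closure in
  the slit tangent bundle.\<close>

definition extends_smoothly_to_closure ::
  "'a topology \<Rightarrow> ('a, 'n::finite) chart set \<Rightarrow> ('a \<times> ('a, 'n) tvec) set \<Rightarrow> ('a, 'n) components \<Rightarrow> bool"
  where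
  "extends_smoothly_to_closure X \<A> A N \<longleftrightarrow>
     (\<exists>B N'. openin (slit_topology X \<A>) B \<and> slit_topology X \<A> closure_of A \<subseteq> B \<and>
        (\<forall>c\<in>\<A>. \<forall>k i. smooth_on (coords c B) (N' c k i) \<and>
           (\<forall>z\<in>coords c A. N' c k i z = N c k i z)))"


section \<open>Objects derived from a function \<open>L\<close> in induced coordinates\<close>

context
  fixes L :: "(real^'n::finite) \<times> (real^'n) \<Rightarrow> real"
begin

definition fundamental_tensor :: "'n \<Rightarrow> 'n \<Rightarrow> (real^'n) \<times> (real^'n) \<Rightarrow> real" where
  "fundamental_tensor i j z = 1/2 * dy j (dy i L) z"

definition g_matrix :: "(real^'n) \<times> (real^'n) \<Rightarrow> real^'n^'n" where
  "g_matrix z = (\<chi> i j. fundamental_tensor i j z)"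

definition g_inv :: "'n \<Rightarrow> 'n \<Rightarrow> (real^'n) \<times> (real^'n) \<Rightarrow> real" where
  "g_inv i j z = matrix_inv (g_matrix z) $ i $ j"

definition y_low :: "'n \<Rightarrow> (real^'n) \<times> (real^'n) \<Rightarrow> real" where
  "y_low i z = (\<Sum>a\<in>UNIV. fundamental_tensor i a z * snd z $ a)"

definition spray :: "'n \<Rightarrow> (real^'n) \<times> (real^'n) \<Rightarrow> real" where
  "spray i z = 1/4 * (\<Sum>a\<in>UNIV. \<Sum>b\<in>UNIV. \<Sum>c\<in>UNIV.
     g_inv i a z * (2 * dx c (fundamental_tensor a b) z - dx a (fundamental_tensor b c) z)
       * snd z $ b * snd z $ c)"

definition NL :: "'n \<Rightarrow> 'n \<Rightarrow> (real^'n) \<times> (real^'n) \<Rightarrow> real" where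
  "NL k i z = dy i (spray k) z"

definition cartan :: "'n \<Rightarrow> 'n \<Rightarrow> 'n \<Rightarrow> (real^'n) \<times> (real^'n) \<Rightarrow> real" where
  "cartan i j k z = 1/2 * dy k (fundamental_tensor i j) z"

definition mean_cartan :: "'n \<Rightarrow> (real^'n) \<times> (real^'n) \<Rightarrow> real" where
  "mean_cartan i z = (\<Sum>a\<in>UNIV. \<Sum>b\<in>UNIV. g_inv a b z * cartan a b i z)"

definition nabla_g :: "'n \<Rightarrow> 'n \<Rightarrow> 'n \<Rightarrow> (real^'n) \<times> (real^'n) \<Rightarrow> real" where
  "nabla_g k i j z =
     dx k (fundamental_tensor i j) z - (\<Sum>a\<in>UNIV. NL a k z * dy a (fundamental_tensor i j) z)
     - (\<Sum>a\<in>UNIV. dy i (NL a k) z * fundamental_tensor a j z)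
     - (\<Sum>a\<in>UNIV. dy j (NL a k) z * fundamental_tensor i a z)"

definition landsberg :: "'n \<Rightarrow> 'n \<Rightarrow> 'n \<Rightarrow> (real^'n) \<times> (real^'n) \<Rightarrow> real" where
  "landsberg i j k z = 1/2 * nabla_g k i j z"

definition mean_landsberg :: "'n \<Rightarrow> (real^'n) \<times> (real^'n) \<Rightarrow> real" where
  "mean_landsberg i z = (\<Sum>a\<in>UNIV. \<Sum>b\<in>UNIV. g_inv a b z * landsberg a b i z)"

definition affine_equation ::
  "('n \<Rightarrow> 'n \<Rightarrow> (real^'n) \<times> (real^'n) \<Rightarrow> real) \<Rightarrow> (real^'n) \<times> (real^'n) \<Rightarrow> bool" where
  "affine_equation J z \<longleftrightarrow>
     (\<forall>i j.
       (\<Sum>b\<in>UNIV.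
          (2 * mean_landsberg b z
           + (real CARD('n) + 2) * (\<Sum>a\<in>UNIV. y_low a z / L z * J a b z)
           - 2 * (\<Sum>a\<in>UNIV. mean_cartan a z * J a b z)
           - (\<Sum>a\<in>UNIV. dy a (J a b) z + dy b (J a a) z))
          * ((if b = i then 1 else 0) * snd z $ j - snd z $ b * (if j = i then 1 else 0)))
       - (\<Sum>a\<in>UNIV. (dy a (J j i) z - dy i (J j a) z) * snd z $ a) = 0)"

end


section \<open>Lorentz--Finsler metrics and the affine equation\<close>

definition pseudo_finsler ::
  "'a topology \<Rightarrow> ('a, 'n::finite) chart set \<Rightarrow> ('a \<times> ('a, 'n) tvec) set \<Rightarrow>
   ('a \<times> ('a, 'n) tvec \<Rightarrow> real) \<Rightarrow> bool" where
  "pseudo_finsler X \<A> A L \<longleftrightarrow>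
     (\<forall>c\<in>\<A>. smooth_on (coords c A) (local_rep X \<A> c L)) \<and>
     (\<forall>p v. \<forall>t>0. (p, v) \<in> A \<longrightarrow> L (p, \<lambda>c. t *\<^sub>R v c) = t\<^sup>2 * L (p, v)) \<and>
     (\<forall>c\<in>\<A>. \<forall>z\<in>coords c A. invertible (g_matrix (local_rep X \<A> c L) z))"

text \<open>On the boundary of \<open>A\<close>, the derivatives entering \<open>g\<close> are those of the extension \<open>L'\<close>; by
  continuity they do not depend on the choice of the extension.\<close>

definition proper_metric ::
  "'a topology \<Rightarrow> ('a, 'n::finite) chart set \<Rightarrow> ('a \<times> ('a, 'n) tvec) set \<Rightarrow>
   ('a \<times> ('a, 'n) tvec \<Rightarrow> real) \<Rightarrow> bool" where
  "proper_metric X \<A> A L \<longleftrightarrow>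
     pseudo_finsler X \<A> A L \<and>
     (\<forall>p\<in>topspace X. connectedin (tangent_topology X \<A>) {w \<in> A. fst w = p}) \<and>
     (\<forall>w\<in>A. L w > 0) \<and>
     (\<exists>B L'. openin (slit_topology X \<A>) B \<and> slit_topology X \<A> closure_of A \<subseteq> B \<and>
        (\<forall>c\<in>\<A>. smooth_on (coords c B) (local_rep X \<A> c L')) \<and>
        (\<forall>w\<in>A. L' w = L w) \<and>
        (\<forall>w \<in> slit_topology X \<A> closure_of A - A. L' w = 0 \<and>
           (\<forall>c\<in>\<A>. fst w \<in> fst c \<longrightarrow> invertible (g_matrix (local_rep X \<A> c L') (tchart c w)))))"

text \<open>Signature \<open>(+,-,\<dots>,-)\<close>: in some basis (the columns of \<open>P\<close>) the form is diagonal with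
  one entry \<open>1\<close> and all others \<open>-1\<close>.\<close>

definition lorentzian_signature :: "real^'n::finite^'n \<Rightarrow> bool" where
  "lorentzian_signature G \<longleftrightarrow>
     (\<exists>(P :: real^'n^'n) (k :: 'n). invertible P \<and>
        transpose P ** G ** P = (\<chi> i j. if i = j then (if i = k then 1 else -1) else 0))"

definition lorentz_finsler ::
  "'a topology \<Rightarrow> ('a, 'n::finite) chart set \<Rightarrow> ('a \<times> ('a, 'n) tvec) set \<Rightarrow>
   ('a \<times> ('a, 'n) tvec \<Rightarrow> real) \<Rightarrow> bool" where
  "lorentz_finsler X \<A> A L \<longleftrightarrow>
     proper_metric X \<A> A L \<and>
     (\<forall>c\<in>\<A>. \<forall>z\<in>coords c A. lorentzian_signature (g_matrix (local_rep X \<A> c L) z))"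

definition vanishing_mean_cartan ::
  "'a topology \<Rightarrow> ('a, 'n::finite) chart set \<Rightarrow> ('a \<times> ('a, 'n) tvec) set \<Rightarrow>
   ('a \<times> ('a, 'n) tvec \<Rightarrow> real) \<Rightarrow> bool" where
  "vanishing_mean_cartan X \<A> A L \<longleftrightarrow>
     (\<forall>c\<in>\<A>. \<forall>z\<in>coords c A. \<forall>i. mean_cartan (local_rep X \<A> c L) i z = 0)"

definition canonical_connection ::
  "'a topology \<Rightarrow> ('a, 'n::finite) chart set \<Rightarrow> ('a \<times> ('a, 'n) tvec \<Rightarrow> real) \<Rightarrow>
   ('a, 'n) components" where
  "canonical_connection X \<A> L = (\<lambda>c. NL (local_rep X \<A> c L))"

definition affine_solution ::
  "'a topology \<Rightarrow> ('a, 'n::finite) chart set \<Rightarrow> ('a \<times> ('a, 'n) tvec) set \<Rightarrow>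
   ('a \<times> ('a, 'n) tvec \<Rightarrow> real) \<Rightarrow> ('a, 'n) components \<Rightarrow> bool" where
  "affine_solution X \<A> A L N \<longleftrightarrow>
     homogeneous_nonlinear_connection \<A> A N \<and>
     (\<exists>J. homogeneous_tensor_1_1 1 \<A> A J \<and>
        (\<forall>c\<in>\<A>. \<forall>z\<in>coords c A.
           (\<forall>k i. N c k i z = canonical_connection X \<A> L c k i z + J c k i z) \<and>
           affine_equation (local_rep X \<A> c L) (J c) z))"

definition proper_affine_solution ::
  "'a topology \<Rightarrow> ('a, 'n::finite) chart set \<Rightarrow> ('a \<times> ('a, 'n) tvec) set \<Rightarrow>
   ('a \<times> ('a, 'n) tvec \<Rightarrow> real) \<Rightarrow> ('a, 'n) components \<Rightarrow> bool" where
  "proper_affine_solution X \<A> A L N \<longleftrightarrow>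
     affine_solution X \<A> A L N \<and> extends_smoothly_to_closure X \<A> A N"

end

theory Submission
  imports Defs
begin

text \<open>Apart from the choice of a neighbourhood of the closure of \<open>A\<close>, every argument takes place in an induced chart \<open>(x, y)\<close>. Write \<open>g\<close>
for the fundamental tensor and \<open>n\<close> for the dimension, and let a lower index after a dot denote a derivative in \<open>y\<close>.

Existence. If the mean Cartan tensor vanishes, the volume density of \<open>g\<close> depends on \<open>x\<close> alone. The trace of the
\<open>y\<close>-derivative of the lowered spray then shows that \<open>N\<^sup>a\<^sub>a = y\<^sup>c \<partial>\<^sub>c log (sqrt \<bar>det g\<bar>)\<close> (lemma \<open>trace_N\<close>),
so the mean Landsberg tensor vanishes as well (\<open>mean_landsberg_0\<close>), and \<open>J = 0\<close> solves the affine equation. The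
transformation law of the canonical connection (\<open>N_change\<close>) is the fibre derivative of that of the spray. The same
formula applied to the extension of \<open>L\<close> extends the connection to the closure of \<open>A\<close>.

Uniqueness. For symmetric \<open>J\<close> with trace \<open>D = J\<^sup>a\<^sub>a\<close> the affine equation reduces to
\<open>(n + 2) y\<^sub>a J\<^sup>a\<^sub>b = 2 L D\<^sub>.\<^sub>b\<close>. Moreover \<open>J\<^sup>k\<^sub>i = Q\<^sup>k\<^sub>.\<^sub>i\<close> for \<open>Q\<^sup>k = J\<^sup>k\<^sub>i y\<^sup>i / 2\<close>. Contracting
with \<open>y\<close> and differentiating gives \<open>(n + 2) Q\<^sub>b = L\<^sub>.\<^sub>b D - L D\<^sub>.\<^sub>b\<close> (\<open>lowered_Q\<close>), so \<open>J\<close> is determined by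
\<open>D\<close>. The divergence of this identity is the eigenvalue equation
\<open>L g\<^sup>a\<^sup>b D\<^sub>.\<^sub>a\<^sub>.\<^sub>b = (n - 2) D\<close> (\<open>eigenvalue_equation\<close>).

It remains to see that \<open>D = 0\<close>. For \<open>u = D / sqrt L\<close>, which is constant along rays, the equation says that \<open>u\<close> equals its
own Laplacian on the indicatrix with the Riemannian metric \<open>-g\<close>, and the maximum principle forbids a positive
interior maximum. Boundary values come from properness: where \<open>L = 0\<close> the eigenvalue equation forces \<open>D = 0\<close>, because
\<open>n \<ge> 3\<close>; since the differential of \<open>L\<close> does not vanish there, \<open>D = O(L)\<close>, and \<open>u\<close> tends to \<open>0\<close>
(\<open>boundary_linear_bound\<close>). The directions in the closed fibre form a compact set, so \<open>u\<^sup>2\<close> attains its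
maximum, and this maximum is \<open>0\<close> (\<open>eigenfunction_vanishes\<close>).\<close>

section \<open>Calculus of smooth maps\<close>

text \<open>Read as an operator on functions, \<open>dd v\<close> can be iterated; the operators \<open>pd\<close>, \<open>dx\<close> and \<open>dy\<close>
are its values at basis vectors.\<close>

definition dd :: "'a::euclidean_space \<Rightarrow> ('a \<Rightarrow> 'b::real_normed_vector) \<Rightarrow> 'a \<Rightarrow> 'b" where
  "dd v f z = frechet_derivative f (at z) v"

lemma dd_eqI: "(f has_derivative f') (at z) \<Longrightarrow> dd v f z = f' v"
  unfolding dd_def by (metis frechet_derivative_at)

lemma has_derivative_dd: "f differentiable (at z) \<Longrightarrow> (f has_derivative (\<lambda>v. dd v f z)) (at z)"
  unfolding dd_def using frechet_derivative_works by force

text \<open>Where differentiability fails, the two functions have the same empty set of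
derivatives, so the same arbitrary value is chosen for both.\<close>

lemma dd_cong:
  assumes "open S" "z \<in> S" "\<And>w. w \<in> S \<Longrightarrow> f w = g w"
  shows "dd v f z = dd v g z"
proof (cases "f differentiable (at z)")
  case True
  then show ?thesis unfolding dd_def
    by (metis assms frechet_derivative_transform_within_open)
next
  case False
  have "\<And>f'. (f has_derivative f') (at z) = (g has_derivative f') (at z)"
    using has_derivative_transform_within_open[OF _ assms(1,2)] assms(3) by metis
  then show ?thesis unfolding dd_def frechet_derivative_def by simp
qed

lemma differentiable_cong:
  assumes "open S" "z \<in> S" "\<And>w. w \<in> S \<Longrightarrow> f w = g w"
  shows "f differentiable (at z) \<longleftrightarrow> g differentiable (at z)"
  using has_derivative_transform_within_open[OF _ assms(1,2)] assms(3)
  unfolding differentiable_def by metis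

lemma dd_sum_direction:
  assumes "f differentiable (at z)"
  shows "dd (\<Sum>i\<in>I. r i *\<^sub>R v i) f z = (\<Sum>i\<in>I. r i *\<^sub>R dd (v i) f z)"
proof -
  interpret linear "\<lambda>v. dd v f z"
    using has_derivative_dd[OF assms] has_derivative_linear by blast
  show ?thesis by (simp add: sum scale)
qed

lemma td_Suc_dd:
  "times_differentiable_on (Suc k) S f \<longleftrightarrow>
     (\<forall>x\<in>S. f differentiable (at x)) \<and> (\<forall>v. times_differentiable_on k S (dd v f))"
  by (simp add: dd_def[abs_def])

declare times_differentiable_on.simps(2)[simp del]

lemma td_cong:
  assumes "open S" "\<And>z. z \<in> S \<Longrightarrow> f z = g z"
  shows "times_differentiable_on k S f \<longleftrightarrow> times_differentiable_on k S g"
  using assms(2)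
proof (induction k arbitrary: f g)
  case 0
  then show ?case by (simp cong: continuous_on_cong)
next
  case (Suc k)
  have "times_differentiable_on k S (dd v f) = times_differentiable_on k S (dd v g)" for v
    by (rule Suc.IH) (use dd_cong[OF assms(1)] Suc.prems in blast)
  moreover have "f differentiable (at z) \<longleftrightarrow> g differentiable (at z)" if "z \<in> S" for z
    using differentiable_cong[OF assms(1) that Suc.prems] by auto
  ultimately show ?case unfolding td_Suc_dd by blast
qed

lemma td_Suc_imp: "times_differentiable_on (Suc k) S f \<Longrightarrow> times_differentiable_on k S f"
proof (induction k arbitrary: f)
  case 0
  then show ?case unfolding td_Suc_dd
    by (auto intro!: continuous_at_imp_continuous_on differentiable_imp_continuous_within)
next
  case (Suc k)
  then show ?case unfolding td_Suc_dd by blast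
qed

lemma td_subset: "times_differentiable_on k S f \<Longrightarrow> T \<subseteq> S \<Longrightarrow> times_differentiable_on k T f"
  by (induction k arbitrary: f) (auto intro: continuous_on_subset simp: td_Suc_dd)

lemma td_linear_comp:
  assumes "bounded_linear h" "open S"
  shows "times_differentiable_on k S f \<Longrightarrow> times_differentiable_on k S (\<lambda>x. h (f x))"
proof (induction k arbitrary: f)
  case 0
  then show ?case
    by (simp add: bounded_linear.continuous_on[OF assms(1)])
next
  case (Suc k)
  have *: "((\<lambda>x. h (f x)) has_derivative (\<lambda>v. h (dd v f x))) (at x)" if "x \<in> S" for x
    using bounded_linear.has_derivative[OF assms(1) has_derivative_dd] Suc.prems that
    unfolding td_Suc_dd by blast
  have "times_differentiable_on k S (dd v (\<lambda>x. h (f x)))" for v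
    by (subst td_cong[OF assms(2), of _ "\<lambda>x. h (dd v f x)"])
       (use Suc dd_eqI[OF *] in \<open>auto simp: td_Suc_dd\<close>)
  then show ?case using * unfolding td_Suc_dd by (auto simp: differentiable_def)
qed

lemma td_const: "times_differentiable_on k S (\<lambda>x. c)"
proof (induction k arbitrary: c)
  case (Suc k)
  have "dd v (\<lambda>x. c) = (\<lambda>x. 0)" for v :: 'a by (auto simp: dd_def)
  then show ?case using Suc unfolding td_Suc_dd by simp
qed simp

lemma td_id: "times_differentiable_on k S (\<lambda>x. x)"
proof (cases k)
  case (Suc k)
  have "dd v (\<lambda>x. x) = (\<lambda>x. v)" for v :: 'a by (auto simp: dd_def)
  then show ?thesis unfolding Suc td_Suc_dd by (simp add: td_const)
qed simp

lemma td_add: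
  assumes "open S"
  shows "times_differentiable_on k S f \<Longrightarrow> times_differentiable_on k S g
    \<Longrightarrow> times_differentiable_on k S (\<lambda>x. f x + g x)"
proof (induction k arbitrary: f g)
  case 0
  then show ?case by (simp add: continuous_on_add)
next
  case (Suc k)
  have *: "((\<lambda>x. f x + g x) has_derivative (\<lambda>v. dd v f x + dd v g x)) (at x)" if "x \<in> S" for x
    using Suc.prems that unfolding td_Suc_dd
    by (auto intro!: has_derivative_add has_derivative_dd)
  have "times_differentiable_on k S (dd v (\<lambda>x. f x + g x))" for v
    by (subst td_cong[OF assms, of _ "\<lambda>x. dd v f x + dd v g x"])
       (use Suc dd_eqI[OF *] in \<open>auto simp: td_Suc_dd\<close>)
  then show ?case using * unfolding td_Suc_dd by (auto simp: differentiable_def)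
qed

lemma td_bilinear:
  assumes "bounded_bilinear h" "open S"
  shows "times_differentiable_on k S f \<Longrightarrow> times_differentiable_on k S g
    \<Longrightarrow> times_differentiable_on k S (\<lambda>x. h (f x) (g x))"
proof (induction k arbitrary: f g)
  case 0
  then show ?case by (simp add: bounded_bilinear.continuous_on[OF assms(1)])
next
  case (Suc k)
  have *: "((\<lambda>x. h (f x) (g x)) has_derivative (\<lambda>v. h (f x) (dd v g x) + h (dd v f x) (g x))) (at x)"
    if "x \<in> S" for x
    using Suc.prems that unfolding td_Suc_dd
    by (auto intro!: bounded_bilinear.FDERIV[OF assms(1)] has_derivative_dd)
  have "times_differentiable_on k S (dd v (\<lambda>x. h (f x) (g x)))" for v
    by (subst td_cong[OF assms(2), of _ "\<lambda>x. h (f x) (dd v g x) + h (dd v f x) (g x)"])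
       (use Suc.prems[THEN td_Suc_imp] Suc dd_eqI[OF *] in \<open>auto intro!: td_add assms(2) simp: td_Suc_dd\<close>)
  then show ?case using * unfolding td_Suc_dd by (auto simp: differentiable_def)
qed

text \<open>The derivative of \<open>1/f\<close> is built from \<open>f'\<close> and \<open>1/f\<close> by multiplication, so the induction closes on
itself.\<close>

lemma td_inverse:
  fixes f :: "'a::euclidean_space \<Rightarrow> real"
  assumes "open S" "\<And>x. x \<in> S \<Longrightarrow> f x \<noteq> 0"
  shows "times_differentiable_on k S f \<Longrightarrow> times_differentiable_on k S (\<lambda>x. inverse (f x))"
proof (induction k)
  case 0
  then show ?case using assms by (auto intro: continuous_on_inverse)
next
  case (Suc k)
  have *: "((\<lambda>x. inverse (f x)) has_derivative
      (\<lambda>v. -1 * (inverse (f x) * dd v f x * inverse (f x)))) (at x)"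
    if "x \<in> S" for x
    using Suc.prems that assms(2)[OF that] unfolding td_Suc_dd
    by (auto intro!: derivative_eq_intros has_derivative_dd)
  have "times_differentiable_on k S (\<lambda>x. inverse (f x))" using Suc td_Suc_imp by blast
  then have "times_differentiable_on k S (\<lambda>x. -1 * (inverse (f x) * dd v f x * inverse (f x)))" for v
    using Suc.prems unfolding td_Suc_dd
    by (intro td_bilinear[OF bounded_bilinear_mult] td_const assms(1)) auto
  then have "times_differentiable_on k S (dd v (\<lambda>x. inverse (f x)))" for v
    by (rule iffD2[OF td_cong[OF assms(1) dd_eqI[OF *]], rotated])
  then show ?case using * unfolding td_Suc_dd by (auto simp: differentiable_def)
qed

lemma smooth_on_differentiable: "smooth_on S f \<Longrightarrow> x \<in> S \<Longrightarrow> f differentiable (at x)"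
  unfolding smooth_on_def using td_Suc_dd by blast

lemma smooth_on_continuous: "smooth_on S f \<Longrightarrow> continuous_on S f"
  unfolding smooth_on_def using times_differentiable_on.simps(1) by blast

lemma smooth_on_dd: "smooth_on S f \<Longrightarrow> smooth_on S (dd v f)"
  unfolding smooth_on_def using td_Suc_dd by blast

lemma smooth_on_subset: "smooth_on S f \<Longrightarrow> T \<subseteq> S \<Longrightarrow> smooth_on T f"
  unfolding smooth_on_def using td_subset by blast

lemma smooth_on_cong:
  "open S \<Longrightarrow> (\<And>z. z \<in> S \<Longrightarrow> f z = g z) \<Longrightarrow> smooth_on S f \<longleftrightarrow> smooth_on S g"
  unfolding smooth_on_def using td_cong by blast

lemma smooth_on_const: "smooth_on S (\<lambda>x. c)"
  unfolding smooth_on_def using td_const by blast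

lemma smooth_on_linear: "bounded_linear h \<Longrightarrow> open S \<Longrightarrow> smooth_on S h"
  unfolding smooth_on_def using td_linear_comp[OF _ _ td_id] by blast

lemma smooth_on_linear_comp:
  "bounded_linear h \<Longrightarrow> open S \<Longrightarrow> smooth_on S f \<Longrightarrow> smooth_on S (\<lambda>x. h (f x))"
  unfolding smooth_on_def using td_linear_comp by blast

lemma smooth_on_add:
  "open S \<Longrightarrow> smooth_on S f \<Longrightarrow> smooth_on S g \<Longrightarrow> smooth_on S (\<lambda>x. f x + g x)"
  unfolding smooth_on_def using td_add by blast

lemma smooth_on_mult:
  fixes f g :: "'a::euclidean_space \<Rightarrow> real"
  shows "open S \<Longrightarrow> smooth_on S f \<Longrightarrow> smooth_on S g \<Longrightarrow> smooth_on S (\<lambda>x. f x * g x)"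
  unfolding smooth_on_def using td_bilinear[OF bounded_bilinear_mult] by blast

lemma smooth_on_scaleR:
  "open S \<Longrightarrow> smooth_on S f \<Longrightarrow> smooth_on S g \<Longrightarrow> smooth_on S (\<lambda>x. f x *\<^sub>R g x)"
  unfolding smooth_on_def using td_bilinear[OF bounded_bilinear_scaleR] by blast

lemma smooth_on_diff:
  fixes f g :: "'a::euclidean_space \<Rightarrow> real"
  shows "open S \<Longrightarrow> smooth_on S f \<Longrightarrow> smooth_on S g \<Longrightarrow> smooth_on S (\<lambda>x. f x - g x)"
  using smooth_on_add[of S f "\<lambda>x. -1 * g x"] smooth_on_mult[of S "\<lambda>x. -1" g, OF _ smooth_on_const]
  by simp

lemma smooth_on_sum:
  "open S \<Longrightarrow> (\<And>i. i \<in> I \<Longrightarrow> smooth_on S (f i)) \<Longrightarrow> smooth_on S (\<lambda>x. \<Sum>i\<in>I. f i x)"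
  by (induction I rule: infinite_finite_induct) (auto intro: smooth_on_add smooth_on_const)

lemma smooth_on_prod:
  fixes f :: "'i \<Rightarrow> 'a::euclidean_space \<Rightarrow> real"
  shows "open S \<Longrightarrow> (\<And>i. i \<in> I \<Longrightarrow> smooth_on S (f i)) \<Longrightarrow> smooth_on S (\<lambda>x. \<Prod>i\<in>I. f i x)"
  by (induction I rule: infinite_finite_induct) (auto intro: smooth_on_mult smooth_on_const)

lemma smooth_on_inverse:
  fixes f :: "'a::euclidean_space \<Rightarrow> real"
  shows "open S \<Longrightarrow> smooth_on S f \<Longrightarrow> (\<And>x. x \<in> S \<Longrightarrow> f x \<noteq> 0) \<Longrightarrow> smooth_on S (\<lambda>x. inverse (f x))"
  unfolding smooth_on_def using td_inverse by blast

lemma smooth_on_divide: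
  fixes f g :: "'a::euclidean_space \<Rightarrow> real"
  shows "open S \<Longrightarrow> smooth_on S f \<Longrightarrow> smooth_on S g \<Longrightarrow> (\<And>x. x \<in> S \<Longrightarrow> g x \<noteq> 0) \<Longrightarrow>
    smooth_on S (\<lambda>x. f x / g x)"
  by (simp add: divide_inverse smooth_on_mult smooth_on_inverse)

lemma smooth_on_Pair:
  fixes f :: "'a::euclidean_space \<Rightarrow> 'b::euclidean_space" and g :: "'a \<Rightarrow> 'c::euclidean_space"
  assumes "open S" "smooth_on S f" "smooth_on S g"
  shows "smooth_on S (\<lambda>x. (f x, g x))"
proof -
  have "bounded_linear (\<lambda>u::'b. (u, 0::'c))" "bounded_linear (\<lambda>u::'c. (0::'b, u))"
    by (intro bounded_linear_Pair bounded_linear_ident bounded_linear_zero)+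
  then have "smooth_on S (\<lambda>x. (f x, 0::'c) + (0::'b, g x))"
    using smooth_on_add[OF assms(1) smooth_on_linear_comp[OF _ assms(1,2)]
      smooth_on_linear_comp[OF _ assms(1,3)]] by blast
  then show ?thesis by simp
qed

lemma dd_compose:
  fixes g :: "'b::euclidean_space \<Rightarrow> 'c::real_normed_vector"
  assumes "f differentiable (at z)" "g differentiable (at (f z))"
  shows "dd v (\<lambda>x. g (f x)) z = dd (dd v f z) g (f z)"
  using has_derivative_compose[OF has_derivative_dd[OF assms(1)] has_derivative_dd[OF assms(2)]]
  by (rule dd_eqI)

text \<open>A derivative of \<open>g \<circ> f\<close> is a combination of the functions \<open>(dd b g) \<circ> f\<close> with smooth coefficients. The
induction therefore runs over all \<open>g\<close> with \<open>f\<close> fixed.\<close>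

lemma smooth_on_compose:
  fixes f :: "'a::euclidean_space \<Rightarrow> 'b::euclidean_space" and g :: "'b \<Rightarrow> 'c::real_normed_vector"
  assumes S: "open S" and f: "smooth_on S f" and g: "smooth_on T g" and fST: "\<And>x. x \<in> S \<Longrightarrow> f x \<in> T"
  shows "smooth_on S (\<lambda>x. g (f x))"
proof -
  have "times_differentiable_on k S (\<lambda>x. g (f x))" for k using g
  proof (induction k arbitrary: g)
    case 0
    then show ?case
      using continuous_on_compose2[OF smooth_on_continuous[OF 0] smooth_on_continuous[OF f]] fST by auto
  next
    case (Suc k)
    have diff: "f differentiable (at x)" "g differentiable (at (f x))" if "x \<in> S" for x
      using smooth_on_differentiable f Suc.prems fST that by blast+
    have dd_eq: "dd v (\<lambda>x. g (f x)) x = (\<Sum>b\<in>Basis. (dd v f x \<bullet> b) *\<^sub>R dd b g (f x))" if "x \<in> S" for v x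
      unfolding dd_compose[OF diff[OF that]]
      by (subst euclidean_representation[symmetric]) (simp only: dd_sum_direction[OF diff(2)[OF that]])
    have summand: "times_differentiable_on k S (\<lambda>x. (dd v f x \<bullet> b) *\<^sub>R dd b g (f x))" for v b
      using smooth_on_linear_comp[OF bounded_linear_inner_left S smooth_on_dd[OF f]]
        Suc.IH[OF smooth_on_dd[OF Suc.prems]]
      by (auto intro!: td_bilinear[OF bounded_bilinear_scaleR S] simp: smooth_on_def)
    have "times_differentiable_on k S (\<lambda>x. \<Sum>b\<in>B. (dd v f x \<bullet> b) *\<^sub>R dd b g (f x))"
      if "finite B" for v and B :: "'b set"
      using that by (induction B rule: finite_induct) (auto intro!: td_add td_const S summand)
    from this[OF finite_Basis] have "times_differentiable_on k S (dd v (\<lambda>x. g (f x)))" for v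
      by (rule iffD2[OF td_cong[OF S dd_eq], rotated])
    moreover have "(\<lambda>x. g (f x)) differentiable (at x)" if "x \<in> S" for x
      using differentiable_chain_at[OF diff[OF that]] by (simp add: o_def)
    ultimately show ?case unfolding td_Suc_dd by blast
  qed
  then show ?thesis by (simp add: smooth_on_def)
qed

lemma has_real_derivative_along_line:
  fixes f :: "'a::euclidean_space \<Rightarrow> real"
  assumes "f differentiable (at (z + s *\<^sub>R v))"
  shows "((\<lambda>s. f (z + s *\<^sub>R v)) has_real_derivative dd v f (z + s *\<^sub>R v)) (at s)"
proof -
  have "((\<lambda>s. z + s *\<^sub>R v) has_derivative (\<lambda>r. r *\<^sub>R v)) (at s)"
    by (auto intro!: derivative_eq_intros)
  from has_derivative_compose[OF this has_derivative_dd[OF assms]]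
  have "((\<lambda>s. f (z + s *\<^sub>R v)) has_derivative (\<lambda>r. dd (r *\<^sub>R v) f (z + s *\<^sub>R v))) (at s)" .
  moreover have "dd (r *\<^sub>R v) f (z + s *\<^sub>R v) = dd v f (z + s *\<^sub>R v) * r" for r
    using dd_sum_direction[OF assms, of "\<lambda>_. r" "\<lambda>_. v" "{()}"] by (simp add: mult.commute)
  ultimately show ?thesis by (simp add: has_field_derivative_def)
qed

text \<open>The mean value theorem, applied in direction \<open>u\<close> to a difference in direction \<open>v\<close> and then in direction
\<open>v\<close>.\<close>

lemma second_difference:
  fixes f :: "'a::euclidean_space \<Rightarrow> real"
  assumes f: "smooth_on S f" and h: "0 < h"
    and S: "\<And>s t. \<lbrakk>0 \<le> s; s \<le> h; 0 \<le> t; t \<le> h\<rbrakk> \<Longrightarrow> z + s *\<^sub>R u + t *\<^sub>R v \<in> S"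
  shows "\<exists>s t. 0 \<le> s \<and> s \<le> h \<and> 0 \<le> t \<and> t \<le> h \<and>
    f (z + h *\<^sub>R u + h *\<^sub>R v) - f (z + h *\<^sub>R u) - f (z + h *\<^sub>R v) + f z =
      h * (h * dd v (dd u f) (z + s *\<^sub>R u + t *\<^sub>R v))"
proof -
  have d1: "((\<lambda>s. f (z + h *\<^sub>R v + s *\<^sub>R u) - f (z + s *\<^sub>R u)) has_real_derivative
      dd u f (z + h *\<^sub>R v + s *\<^sub>R u) - dd u f (z + s *\<^sub>R u)) (at s)" if "0 \<le> s" "s \<le> h" for s
    using S[of s h] S[of s 0] that h
    by (intro derivative_intros has_real_derivative_along_line smooth_on_differentiable[OF f])
       (auto simp: algebra_simps)
  obtain s where s: "0 < s" "s < h"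
    "f (z + h *\<^sub>R v + h *\<^sub>R u) - f (z + h *\<^sub>R u) - (f (z + h *\<^sub>R v + 0 *\<^sub>R u) - f (z + 0 *\<^sub>R u))
      = (h - 0) * (dd u f (z + h *\<^sub>R v + s *\<^sub>R u) - dd u f (z + s *\<^sub>R u))"
    using MVT2[OF h d1] by (metis (no_types, lifting))
  have d2: "((\<lambda>t. dd u f (z + s *\<^sub>R u + t *\<^sub>R v)) has_real_derivative
      dd v (dd u f) (z + s *\<^sub>R u + t *\<^sub>R v)) (at t)" if "0 \<le> t" "t \<le> h" for t
    using S[of s t] that s
    by (intro has_real_derivative_along_line smooth_on_differentiable[OF smooth_on_dd[OF f]]) auto
  obtain t where t: "0 < t" "t < h"
    "dd u f (z + s *\<^sub>R u + h *\<^sub>R v) - dd u f (z + s *\<^sub>R u + 0 *\<^sub>R v) =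
      (h - 0) * dd v (dd u f) (z + s *\<^sub>R u + t *\<^sub>R v)"
    using MVT2[OF h d2] by (metis (no_types, lifting))
  show ?thesis using s t
    by (intro exI[of _ s] exI[of _ t]) (auto simp: algebra_simps)
qed

text \<open>The second difference over a small parallelogram is symmetric in its two sides, and it approximates both mixed
derivatives.\<close>

lemma dd_commute:
  fixes f :: "'a::euclidean_space \<Rightarrow> real"
  assumes S: "open S" and f: "smooth_on S f" and z: "z \<in> S"
  shows "dd u (dd v f) z = dd v (dd u f) z"
proof (rule ccontr)
  let ?P = "dd v (dd u f)" and ?Q = "dd u (dd v f)"
  assume ne: "?Q z \<noteq> ?P z"
  define e where "e = \<bar>?Q z - ?P z\<bar> / 2"
  have e: "e > 0" using ne by (simp add: e_def)
  have "continuous (at z) ?P" "continuous (at z) ?Q"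
    using smooth_on_continuous[OF smooth_on_dd[OF smooth_on_dd[OF f]]] S z
      continuous_on_eq_continuous_at by blast+
  then obtain d1 d2 where d: "d1 > 0" "\<And>w. dist w z < d1 \<Longrightarrow> dist (?P w) (?P z) < e"
    "d2 > 0" "\<And>w. dist w z < d2 \<Longrightarrow> dist (?Q w) (?Q z) < e"
    using e unfolding continuous_at_eps_delta by metis
  obtain d3 where d3: "d3 > 0" "ball z d3 \<subseteq> S" using S z open_contains_ball by blast
  define d where "d = min d1 (min d2 d3)"
  define h where "h = d / (2 * (norm u + norm v + 1))"
  have h: "h > 0" using d(1,3) d3(1) by (auto simp: h_def d_def intro!: divide_pos_pos add_nonneg_pos)
  have close: "dist (z + s *\<^sub>R u + t *\<^sub>R v) z < d" if "0 \<le> s" "s \<le> h" "0 \<le> t" "t \<le> h" for s t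
  proof -
    have "dist (z + s *\<^sub>R u + t *\<^sub>R v) z \<le> s * norm u + t * norm v"
      using norm_triangle_ineq[of "s *\<^sub>R u" "t *\<^sub>R v"] that by (simp add: dist_norm add.assoc)
    also have "\<dots> \<le> h * norm u + h * norm v"
      using that by (intro add_mono mult_right_mono) auto
    also have "\<dots> \<le> h * (norm u + norm v + 1)" using h by (simp add: algebra_simps)
    also have "\<dots> = d / 2"
    proof -
      have "norm u + norm v + 1 \<noteq> 0" using norm_ge_zero[of u] norm_ge_zero[of v] by linarith
      then show ?thesis by (simp add: h_def field_simps)
    qed
    also have "\<dots> < d" using d(1,3) d3(1) unfolding d_def by linarith
    finally show ?thesis .
  qed
  have inS: "z + s *\<^sub>R u + t *\<^sub>R v \<in> S" if "0 \<le> s" "s \<le> h" "0 \<le> t" "t \<le> h" for s t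
    using close[OF that] d3 by (auto simp: d_def dist_commute subset_eq)
  obtain s t where st: "0 \<le> s" "s \<le> h" "0 \<le> t" "t \<le> h"
    "f (z + h *\<^sub>R u + h *\<^sub>R v) - f (z + h *\<^sub>R u) - f (z + h *\<^sub>R v) + f z =
      h * (h * ?P (z + s *\<^sub>R u + t *\<^sub>R v))"
    using second_difference[OF f h inS] by blast
  have inS': "z + s *\<^sub>R v + t *\<^sub>R u \<in> S" if "0 \<le> s" "s \<le> h" "0 \<le> t" "t \<le> h" for s t
    using inS[of t s] that by (simp add: algebra_simps)
  obtain s' t' where st': "0 \<le> s'" "s' \<le> h" "0 \<le> t'" "t' \<le> h"
    "f (z + h *\<^sub>R v + h *\<^sub>R u) - f (z + h *\<^sub>R v) - f (z + h *\<^sub>R u) + f z =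
      h * (h * ?Q (z + s' *\<^sub>R v + t' *\<^sub>R u))"
    using second_difference[OF f h inS'] by blast
  have "h * (h * ?P (z + s *\<^sub>R u + t *\<^sub>R v)) = h * (h * ?Q (z + t' *\<^sub>R u + s' *\<^sub>R v))"
    using st(5) st'(5) by (simp add: algebra_simps)
  then have eq: "?P (z + s *\<^sub>R u + t *\<^sub>R v) = ?Q (z + t' *\<^sub>R u + s' *\<^sub>R v)"
    using h by simp
  have "dist (?P (z + s *\<^sub>R u + t *\<^sub>R v)) (?P z) < e"
    using close[OF st(1-4)] d by (simp add: d_def)
  moreover have "dist (?Q (z + t' *\<^sub>R u + s' *\<^sub>R v)) (?Q z) < e"
    using close[OF st'(3,4,1,2)] d by (simp add: d_def)
  moreover have "dist (?Q z) (?P z) \<le> dist (?P (z + s *\<^sub>R u + t *\<^sub>R v)) (?P z)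
      + dist (?Q (z + t' *\<^sub>R u + s' *\<^sub>R v)) (?Q z)"
    using dist_triangle2[of "?Q z" "?P z" "?P (z + s *\<^sub>R u + t *\<^sub>R v)"] eq by (simp add: dist_commute)
  ultimately show False unfolding e_def by (simp add: dist_real_def)
qed

lemma delta_sum [simp]:
  fixes f :: "'n::finite \<Rightarrow> real"
  shows "(\<Sum>i\<in>UNIV. (if a = i then 1 else 0) * f i) = f a"
    and "(\<Sum>i\<in>UNIV. (if i = a then 1 else 0) * f i) = f a"
    and "(\<Sum>i\<in>UNIV. f i * (if a = i then 1 else 0)) = f a"
    and "(\<Sum>i\<in>UNIV. f i * (if i = a then 1 else 0)) = f a"
  by (simp_all add: if_distrib[where f = "\<lambda>x. x * _"] if_distrib[where f = "\<lambda>x. _ * x"] cong: if_cong)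

section \<open>Derivatives in base and fibre directions\<close>

lemma axis_one_nth: "axis i (1::real) $ j = (if j = i then 1 else 0)"
  by (simp add: axis_def)

lemma sum_swap_pairs:
  "(\<Sum>a\<in>A. \<Sum>e\<in>B. \<Sum>p\<in>C. \<Sum>q\<in>D. f a e p q) = (\<Sum>p\<in>C. \<Sum>q\<in>D. \<Sum>a\<in>A. \<Sum>e\<in>B. f a e p q)"
proof -
  have "(\<Sum>a\<in>A. \<Sum>e\<in>B. \<Sum>p\<in>C. \<Sum>q\<in>D. f a e p q) = (\<Sum>a\<in>A. \<Sum>p\<in>C. \<Sum>e\<in>B. \<Sum>q\<in>D. f a e p q)"
    by (intro sum.cong refl sum.swap)
  also have "\<dots> = (\<Sum>p\<in>C. \<Sum>a\<in>A. \<Sum>e\<in>B. \<Sum>q\<in>D. f a e p q)" by (rule sum.swap)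
  also have "\<dots> = (\<Sum>p\<in>C. \<Sum>a\<in>A. \<Sum>q\<in>D. \<Sum>e\<in>B. f a e p q)"
    by (intro sum.cong refl sum.swap)
  also have "\<dots> = (\<Sum>p\<in>C. \<Sum>q\<in>D. \<Sum>a\<in>A. \<Sum>e\<in>B. f a e p q)"
    by (intro sum.cong refl sum.swap)
  finally show ?thesis .
qed

lemma smooth_on_det:
  fixes M :: "'a::euclidean_space \<Rightarrow> real^'n::finite^'n"
  assumes "open S" "\<And>i j. smooth_on S (\<lambda>z. M z $ i $ j)"
  shows "smooth_on S (\<lambda>z. det (M z))"
  unfolding det_def by (intro smooth_on_sum smooth_on_mult smooth_on_const smooth_on_prod assms)

lemma
  fixes A :: "real^'n::finite^'n"
  assumes "invertible A"
  shows matrix_inv_right: "A ** matrix_inv A = mat 1"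
    and matrix_inv_left: "matrix_inv A ** A = mat 1"
  using someI_ex[OF assms[unfolded invertible_def]] unfolding matrix_inv_def by blast+

text \<open>Cramer's rule exhibits the entries of the inverse as quotients of polynomials in the entries, so they are as smooth
as the matrix itself.\<close>

lemma matrix_inv_cramer:
  fixes A :: "real^'n::finite^'n"
  assumes "invertible A"
  shows "matrix_inv A $ i $ j = det (\<chi> p q. if q = i then axis j 1 $ p else A $ p $ q) / det A"
proof -
  have "A *v (matrix_inv A *v axis j 1) = axis j 1"
    by (simp add: matrix_vector_mul_assoc matrix_inv_right[OF assms])
  then have "matrix_inv A *v axis j 1 =
      (\<chi> k. det (\<chi> p q. if q = k then axis j 1 $ p else A $ p $ q) / det A)"
    using cramer[of A] assms invertible_det_nz by blast
  then have "(matrix_inv A *v axis j 1) $ i =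
      det (\<chi> p q. if q = i then axis j 1 $ p else A $ p $ q) / det A" by simp
  moreover have "(matrix_inv A *v axis j 1) $ i = matrix_inv A $ i $ j"
    by (simp add: matrix_vector_mult_basis column_def)
  ultimately show ?thesis by simp
qed

lemma smooth_on_matrix_inv:
  fixes M :: "'a::euclidean_space \<Rightarrow> real^'n::finite^'n"
  assumes S: "open S" and M: "\<And>i j. smooth_on S (\<lambda>z. M z $ i $ j)"
    and inv: "\<And>z. z \<in> S \<Longrightarrow> invertible (M z)"
  shows "smooth_on S (\<lambda>z. matrix_inv (M z) $ i $ j)"
proof -
  have "smooth_on S (\<lambda>z. (\<chi> p q. if q = i then axis j 1 $ p else M z $ p $ q) $ p $ q)" for p q
    by (cases "q = i") (simp_all add: M smooth_on_const)
  then have "smooth_on S (\<lambda>z. det (\<chi> p q. if q = i then axis j 1 $ p else M z $ p $ q) / det (M z))"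
    using inv by (intro smooth_on_divide smooth_on_det S M) (auto simp: invertible_det_nz)
  then show ?thesis
    by (rule iffD2[OF smooth_on_cong[OF S matrix_inv_cramer[OF inv]], rotated])
qed

lemma dx_dd: "dx i f = dd (axis i 1, 0) f" and dy_dd: "dy i f = dd (0, axis i 1) f"
  by (auto simp: dx_def dy_def dd_def)

lemma dd_const [simp]: "dd v (\<lambda>w. c) z = 0"
  by (simp add: dd_def)

lemma smooth_on_snd_component: "open U \<Longrightarrow> smooth_on U (\<lambda>z. snd z $ i)"
  by (intro smooth_on_linear bounded_linear_compose[OF bounded_linear_vec_nth bounded_linear_snd])

lemma dd_snd_component [simp]: "dd v (\<lambda>z. snd z $ i) z = snd v $ i"
  by (rule dd_eqI) (intro bounded_linear_imp_has_derivative
      bounded_linear_compose[OF bounded_linear_vec_nth bounded_linear_snd])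

locale open_domain =
  fixes U :: "((real^'n::finite) \<times> (real^'n)) set"
  assumes open_domain: "open U"
begin

lemma smooth_on_cdiv:
  fixes f :: "(real^'n) \<times> (real^'n) \<Rightarrow> real"
  shows "smooth_on U f \<Longrightarrow> smooth_on U (\<lambda>w. f w / r)"
  using smooth_on_mult[OF open_domain _ smooth_on_const[of U "1 / r"]] by simp

lemmas smooth_rules = smooth_on_const smooth_on_cdiv smooth_on_add[OF open_domain] smooth_on_diff[OF open_domain]
  smooth_on_mult[OF open_domain] smooth_on_sum[OF open_domain] smooth_on_dd
  smooth_on_snd_component[OF open_domain]

lemma dd_smooth_rules:
  fixes f h :: "(real^'n) \<times> (real^'n) \<Rightarrow> real"
  assumes "z \<in> U" "smooth_on U f" "smooth_on U h"
  shows dd_add: "dd v (\<lambda>w. f w + h w) z = dd v f z + dd v h z"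
    and dd_diff: "dd v (\<lambda>w. f w - h w) z = dd v f z - dd v h z"
    and dd_mult: "dd v (\<lambda>w. f w * h w) z = dd v f z * h z + f z * dd v h z"
proof -
  have d: "(f has_derivative (\<lambda>v. dd v f z)) (at z)" "(h has_derivative (\<lambda>v. dd v h z)) (at z)"
    using has_derivative_dd smooth_on_differentiable assms by blast+
  show "dd v (\<lambda>w. f w + h w) z = dd v f z + dd v h z"
    by (rule dd_eqI[OF has_derivative_add[OF d]])
  show "dd v (\<lambda>w. f w - h w) z = dd v f z - dd v h z"
    by (rule dd_eqI[OF has_derivative_diff[OF d]])
  show "dd v (\<lambda>w. f w * h w) z = dd v f z * h z + f z * dd v h z"
    using dd_eqI[OF has_derivative_mult[OF d]] by simp
qed

lemma dd_sum:
  fixes f :: "'i \<Rightarrow> (real^'n) \<times> (real^'n) \<Rightarrow> real"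
  assumes "z \<in> U" "\<And>i. i \<in> I \<Longrightarrow> smooth_on U (f i)"
  shows "dd v (\<lambda>w. \<Sum>i\<in>I. f i w) z = (\<Sum>i\<in>I. dd v (f i) z)"
  using assms(2)
  by (induction I rule: infinite_finite_induct) (auto simp: dd_add[OF assms(1)] smooth_rules)

lemma dd_cdiv:
  assumes "z \<in> U" "smooth_on U f"
  shows "dd v (\<lambda>w. f w / r) z = dd v f z / (r::real)"
  using dd_mult[OF assms(1) assms(2) smooth_on_const[of U "1 / r"]] by simp

lemmas dd_rules = dd_add dd_diff dd_mult dd_cdiv dd_sum

lemma dd_eq_on:
  "z \<in> U \<Longrightarrow> (\<And>w. w \<in> U \<Longrightarrow> f w = h w) \<Longrightarrow> dd v f z = dd v h z"
  using dd_cong[OF open_domain] by blast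

lemma dd_swap:
  fixes f :: "(real^'n) \<times> (real^'n) \<Rightarrow> real"
  shows "smooth_on U f \<Longrightarrow> z \<in> U \<Longrightarrow> dd u (dd v f) z = dd v (dd u f) z"
  using dd_commute[OF open_domain] by blast

lemma dd_vertical:
  fixes f :: "(real^'n) \<times> (real^'n) \<Rightarrow> real"
  assumes "smooth_on U f" "z \<in> U"
  shows "dd (0, v) f z = (\<Sum>i\<in>UNIV. v $ i * dy i f z)"
proof -
  have "(0, v) = (\<Sum>i\<in>UNIV. v $ i *\<^sub>R (0::real^'n, axis i (1::real)))"
    by (simp add: prod_eq_iff fst_sum snd_sum vec_eq_iff axis_def if_distrib cong: if_cong)
  then show ?thesis
    using dd_sum_direction[OF smooth_on_differentiable[OF assms], of "\<lambda>i. v $ i" "\<lambda>i. (0, axis i 1)" UNIV]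
    by (simp only: dy_dd real_scaleR_def)
qed

end

definition homog :: "real \<Rightarrow> ((real^'n::finite) \<times> (real^'n)) set \<Rightarrow> ((real^'n) \<times> (real^'n) \<Rightarrow> real) \<Rightarrow> bool"
  where "homog \<alpha> U f \<longleftrightarrow>
    (\<forall>x y. \<forall>t>0. (x, y) \<in> U \<longrightarrow> f (x, t *\<^sub>R y) = t powr \<alpha> * f (x, y))"

locale conic_open_domain = open_domain U for U :: "((real^'n::finite) \<times> (real^'n)) set" +
  assumes conic: "(x, y) \<in> U \<Longrightarrow> t > 0 \<Longrightarrow> (x, t *\<^sub>R y) \<in> U"
begin

text \<open>The chain rule for the dilation \<open>(x, y) \<mapsto> (x, t y)\<close>.\<close>

lemma dd_homog:
  assumes f: "smooth_on U f" "homog \<alpha> U f" and z: "(x, y) \<in> U" and t: "t > 0"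
  shows "dd (u, t *\<^sub>R v) f (x, t *\<^sub>R y) = t powr \<alpha> * dd (u, v) f (x, y)"
proof -
  let ?s = "\<lambda>w::(real^'n) \<times> (real^'n). (fst w, t *\<^sub>R snd w)"
  have s: "(?s has_derivative ?s) (at w)" for w
    by (intro bounded_linear_imp_has_derivative bounded_linear_Pair bounded_linear_fst
        bounded_linear_compose[OF bounded_linear_scaleR_right bounded_linear_snd])
  have "dd (u, v) (\<lambda>w. f (?s w)) (x, y) = dd (u, t *\<^sub>R v) f (x, t *\<^sub>R y)"
  proof -
    have "f differentiable (at (?s (x, y)))"
      using smooth_on_differentiable[OF f(1) conic[OF z t]] by simp
    then show ?thesis
      using dd_compose[of ?s "(x, y)" f "(u, v)"] s dd_eqI[OF s, of "(u, v)" "(x, y)"]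
      by (auto simp: differentiable_def)
  qed
  moreover have "dd (u, v) (\<lambda>w. f (?s w)) (x, y) = dd (u, v) (\<lambda>w. t powr \<alpha> * f w) (x, y)"
    by (rule dd_eq_on[OF z]) (use f(2) t in \<open>auto simp: homog_def\<close>)
  ultimately show ?thesis using z f(1) by (simp add: dd_mult smooth_rules)
qed

lemma homog_dx: "smooth_on U f \<Longrightarrow> homog \<alpha> U f \<Longrightarrow> homog \<alpha> U (dx i f)"
  unfolding dx_dd homog_def[of _ _ "dd _ f"] using dd_homog[of f \<alpha> _ _ _ _ 0] by simp

lemma homog_dy:
  assumes "smooth_on U f" "homog \<alpha> U f"
  shows "homog (\<alpha> - 1) U (dy i f)"
  unfolding homog_def
proof (intro allI impI)
  fix x y and t :: real
  assume *: "0 < t" "(x, y) \<in> U"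
  have "(0::real^'n, t *\<^sub>R axis i 1) = t *\<^sub>R (0, axis i 1)" by simp
  moreover have "dd (t *\<^sub>R v) f (x, t *\<^sub>R y) = t * dd v f (x, t *\<^sub>R y)" for v
    using dd_sum_direction[OF smooth_on_differentiable[OF assms(1) conic[OF *(2,1)]],
        of "\<lambda>_. t" "\<lambda>_. v" "{()}"] by simp
  ultimately have "t * dy i f (x, t *\<^sub>R y) = t powr \<alpha> * dy i f (x, y)"
    unfolding dy_dd using dd_homog[OF assms *(2,1), of 0 "axis i 1"] by metis
  then show "dy i f (x, t *\<^sub>R y) = t powr (\<alpha> - 1) * dy i f (x, y)"
    using * by (simp add: powr_diff field_simps)
qed

lemma homog_mult: "homog \<alpha> U f \<Longrightarrow> homog \<beta> U h \<Longrightarrow> homog (\<alpha> + \<beta>) U (\<lambda>z. f z * h z)"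
  by (simp add: homog_def powr_add algebra_simps)

lemma homog_diff: "homog \<alpha> U f \<Longrightarrow> homog \<alpha> U h \<Longrightarrow> homog \<alpha> U (\<lambda>z. f z - h z)"
  by (simp add: homog_def algebra_simps)

lemma homog_cmult: "homog \<alpha> U f \<Longrightarrow> homog \<alpha> U (\<lambda>z. c * f z)"
  by (simp add: homog_def)

lemma homog_sum: "(\<And>i. i \<in> I \<Longrightarrow> homog \<alpha> U (f i)) \<Longrightarrow> homog \<alpha> U (\<lambda>z. \<Sum>i\<in>I. f i z)"
  by (simp add: homog_def sum_distrib_left)

lemma homog_snd: "homog 1 U (\<lambda>z. snd z $ i)"
  by (simp add: homog_def)

text \<open>Differentiate \<open>f (x, (1 + s) y) = (1 + s) powr \<alpha> * f (x, y)\<close> at \<open>s = 0\<close>.\<close>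

lemma euler:
  assumes f: "smooth_on U f" "homog \<alpha> U f" and z: "z \<in> U"
  shows "(\<Sum>i\<in>UNIV. snd z $ i * dy i f z) = \<alpha> * f z"
proof -
  obtain x y where xy: "z = (x, y)" by (cases z)
  have 1: "((\<lambda>s. f ((x, y) + s *\<^sub>R (0, y))) has_real_derivative dd (0, y) f (x, y)) (at 0)"
    using has_real_derivative_along_line[of f "(x, y)" 0 "(0, y)"] smooth_on_differentiable[OF f(1) z]
    by (simp add: xy)
  have "((\<lambda>s. (1 + s) powr \<alpha> * f (x, y)) has_real_derivative \<alpha> * f (x, y)) (at 0)"
    by (auto intro!: derivative_eq_intros)
  moreover have "(1 + s) powr \<alpha> * f (x, y) = f ((x, y) + s *\<^sub>R (0, y))" if "s \<in> {-1<..}" for s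
    using f(2)[unfolded homog_def, rule_format, of "1 + s" x y] z that
    by (simp add: xy scaleR_add_left)
  ultimately have "((\<lambda>s. f ((x, y) + s *\<^sub>R (0, y))) has_real_derivative \<alpha> * f (x, y)) (at 0)"
    using has_field_derivative_transform_within_open[of _ _ 0 "{-1<..}"]
    by (metis (no_types, lifting) greaterThan_iff neg_less_0_iff_less open_greaterThan zero_less_one)
  with 1 have "dd (0, y) f (x, y) = \<alpha> * f (x, y)" using DERIV_unique by blast
  then show ?thesis using dd_vertical[OF f(1) z] by (simp add: xy)
qed

end

section \<open>The fundamental tensor and its traces\<close>

text \<open>The chart expression of a pseudo-Finsler metric. Homogeneity is added only in a later locale, because an extension of
the metric beyond the closure of \<open>A\<close> need not be homogeneous.\<close>

locale pseudo_finsler_domain = open_domain U for U :: "((real^'n::finite) \<times> (real^'n)) set" +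
  fixes L :: "(real^'n) \<times> (real^'n) \<Rightarrow> real"
  assumes smooth_L: "smooth_on U L"
    and nondegenerate: "z \<in> U \<Longrightarrow> invertible (g_matrix L z)"
begin

abbreviation "g \<equiv> fundamental_tensor L"
abbreviation "h \<equiv> g_inv L"
abbreviation "G \<equiv> spray L"
abbreviation "N \<equiv> NL L"

lemma g_dd: "g i j = (\<lambda>z. 1/2 * dy j (dy i L) z)"
  by (auto simp: fundamental_tensor_def)

lemma smooth_g: "smooth_on U (g i j)"
  unfolding g_dd dy_dd by (intro smooth_rules smooth_L)

lemma g_sym: "z \<in> U \<Longrightarrow> g i j z = g j i z"
  unfolding g_dd dy_dd using dd_swap[OF smooth_L] by simp

lemma g_matrix_inverse:
  assumes "z \<in> U"
  shows "(\<Sum>b\<in>UNIV. g a b z * h b e z) = (if a = e then 1 else 0)"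
    and "(\<Sum>b\<in>UNIV. h a b z * g b e z) = (if a = e then 1 else 0)"
proof -
  have "(g_matrix L z ** matrix_inv (g_matrix L z)) $ a $ e = mat 1 $ a $ e"
    "(matrix_inv (g_matrix L z) ** g_matrix L z) $ a $ e = mat 1 $ a $ e"
    using matrix_inv_right[OF nondegenerate[OF assms]] matrix_inv_left[OF nondegenerate[OF assms]] by simp_all
  then show "(\<Sum>b\<in>UNIV. g a b z * h b e z) = (if a = e then 1 else 0)"
    "(\<Sum>b\<in>UNIV. h a b z * g b e z) = (if a = e then 1 else 0)"
    by (simp_all add: matrix_matrix_mult_def mat_def g_inv_def g_matrix_def)
qed

lemma smooth_h: "smooth_on U (h i j)"
proof -
  have "smooth_on U (\<lambda>z. matrix_inv (g_matrix L z) $ i $ j)"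
    by (rule smooth_on_matrix_inv[OF open_domain])
       (use smooth_g in \<open>auto simp: g_matrix_def nondegenerate[unfolded g_matrix_def]\<close>)
  then show ?thesis by (simp add: g_inv_def[abs_def])
qed

lemma raise_index:
  assumes "z \<in> U" "\<And>a. (\<Sum>b\<in>UNIV. g a b z * X b) = Y a"
  shows "X e = (\<Sum>a\<in>UNIV. h e a z * Y a)"
proof -
  have "(\<Sum>a\<in>UNIV. h e a z * Y a) = (\<Sum>a\<in>UNIV. \<Sum>b\<in>UNIV. h e a z * g a b z * X b)"
    by (simp add: assms(2)[symmetric] sum_distrib_left mult.assoc)
  also have "\<dots> = (\<Sum>b\<in>UNIV. (\<Sum>a\<in>UNIV. h e a z * g a b z) * X b)"
    by (subst sum.swap) (simp add: sum_distrib_right)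
  finally show ?thesis by (simp add: g_matrix_inverse[OF assms(1)])
qed

lemma lower_index:
  assumes "z \<in> U" "\<And>a. X a = (\<Sum>b\<in>UNIV. h a b z * Y b)"
  shows "(\<Sum>a\<in>UNIV. g e a z * X a) = Y e"
proof -
  have "(\<Sum>a\<in>UNIV. g e a z * X a) = (\<Sum>a\<in>UNIV. \<Sum>b\<in>UNIV. g e a z * h a b z * Y b)"
    by (simp add: assms(2) sum_distrib_left mult.assoc)
  also have "\<dots> = (\<Sum>b\<in>UNIV. (\<Sum>a\<in>UNIV. g e a z * h a b z) * Y b)"
    by (subst sum.swap) (simp add: sum_distrib_right)
  finally show ?thesis by (simp add: g_matrix_inverse[OF assms(1)])
qed

lemma h_sym:
  assumes "z \<in> U"
  shows "h i j z = h j i z"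
proof -
  have "(\<Sum>b\<in>UNIV. g a b z * h i b z) = (if i = a then 1 else 0)" for a
    using g_matrix_inverse(2)[OF assms, of i a] g_sym[OF assms, of a] by (simp add: mult.commute)
  from raise_index[OF assms this, of j] show ?thesis by simp
qed

lemma smooth_G: "smooth_on U (G i)"
  unfolding spray_def[abs_def] dx_dd by (intro smooth_rules smooth_g smooth_h)

lemma smooth_N: "smooth_on U (N k i)"
  unfolding NL_def[abs_def] dy_dd using smooth_on_dd[OF smooth_G] by simp

lemma N_eq: "N k i = dy i (G k)"
  by (auto simp: NL_def)

lemma N_sym: "z \<in> U \<Longrightarrow> dy j (N k i) z = dy i (N k j) z"
  unfolding N_eq dy_dd using dd_swap[OF smooth_G] by simp

text \<open>Differentiate \<open>g h = 1\<close>.\<close>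

lemma dd_h:
  assumes z: "z \<in> U"
  shows "dd v (h a e) z = - (\<Sum>p\<in>UNIV. \<Sum>q\<in>UNIV. h a p z * dd v (g p q) z * h q e z)"
proof -
  have eq: "(\<Sum>q\<in>UNIV. g p q z * dd v (h q e) z) = - (\<Sum>q\<in>UNIV. dd v (g p q) z * h q e z)" for p
  proof -
    have "dd v (\<lambda>w. \<Sum>q\<in>UNIV. g p q w * h q e w) z = dd v (\<lambda>w. if p = e then 1 else 0) z"
      by (rule dd_eq_on[OF z]) (rule g_matrix_inverse(1))
    then show ?thesis
      by (simp add: dd_rules z smooth_rules smooth_g smooth_h sum.distrib del: dd_const)
         (simp add: eq_neg_iff_add_eq_0 add.commute)
  qed
  show ?thesis using raise_index[OF z eq, of a]
    by (simp add: sum_negf sum_distrib_left mult.assoc)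
qed

text \<open>The metric trace \<open>g\<^sup>a\<^sup>e X\<^sub>a\<^sub>e\<close>.\<close>

definition tr :: "(real^'n) \<times> (real^'n) \<Rightarrow> ('n \<Rightarrow> 'n \<Rightarrow> real) \<Rightarrow> real" where
  "tr z X = (\<Sum>a\<in>UNIV. \<Sum>e\<in>UNIV. h a e z * X a e)"

lemma tr_add: "tr z (\<lambda>a e. X a e + Y a e) = tr z X + tr z Y"
  by (simp add: tr_def distrib_left sum.distrib)

lemma tr_diff: "tr z (\<lambda>a e. X a e - Y a e) = tr z X - tr z Y"
  by (simp add: tr_def right_diff_distrib sum_subtractf)

lemma tr_cmult: "tr z (\<lambda>a e. r * X a e) = r * tr z X"
  by (simp add: tr_def sum_distrib_left mult_ac)

lemma tr_sum:
  fixes X :: "'i \<Rightarrow> 'n \<Rightarrow> 'n \<Rightarrow> real"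
  shows "tr z (\<lambda>a e. \<Sum>i\<in>I. X i a e) = (\<Sum>i\<in>I. tr z (X i))"
  unfolding tr_def sum_distrib_left
  by (subst (2) sum.swap, subst sum.swap) (rule refl)

lemma tr_transpose:
  assumes "z \<in> U"
  shows "tr z (\<lambda>a e. X e a) = tr z X"
  unfolding tr_def by (subst sum.swap) (simp add: h_sym[OF assms])

lemma tr_lower:
  assumes z: "z \<in> U"
  shows "tr z (\<lambda>a e. \<Sum>b\<in>UNIV. g a b z * X b e) = (\<Sum>a\<in>UNIV. X a a)"
proof -
  have "tr z (\<lambda>a e. \<Sum>b\<in>UNIV. g a b z * X b e) =
      (\<Sum>e\<in>UNIV. \<Sum>a\<in>UNIV. h e a z * (\<Sum>b\<in>UNIV. g a b z * X b e))"
    unfolding tr_def by (subst sum.swap) (simp add: h_sym[OF z])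
  also have "\<dots> = (\<Sum>e\<in>UNIV. X e e)"
    by (intro sum.cong refl raise_index[OF z, symmetric])
  finally show ?thesis .
qed

lemma mean_cartan_eq: "mean_cartan L k z = 1/2 * tr z (\<lambda>a e. dy k (g a e) z)"
  unfolding mean_cartan_def cartan_def tr_def by (simp add: sum_distrib_left mult_ac)

lemma dy_g_sym: "z \<in> U \<Longrightarrow> dy k (g i j) z = dy j (g i k) z"
  unfolding g_dd dy_dd
  using dd_swap[OF smooth_on_dd[OF smooth_L], of z "(0, axis k 1)" "(0, axis j 1)" "(0, axis i 1)"]
  by (simp add: dd_rules smooth_rules smooth_L)

text \<open>The \<open>y\<close>-derivative of \<open>g\<close> is totally symmetric, so this trace is a contraction of the mean Cartan tensor.\<close>

lemma tr_cartan:
  assumes z: "z \<in> U" and C: "\<And>k. mean_cartan L k z = 0"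
  shows "tr z (\<lambda>a e. \<Sum>b\<in>UNIV. dy e (g a b) z * X b) = 0"
proof -
  have "tr z (\<lambda>a e. \<Sum>b\<in>UNIV. dy e (g a b) z * X b) = (\<Sum>b\<in>UNIV. X b * tr z (\<lambda>a e. dy b (g a e) z))"
    by (simp add: tr_sum tr_cmult[symmetric] dy_g_sym[OF z, of _ _ _] mult.commute)
  also have "\<dots> = 0" using C unfolding mean_cartan_eq by simp
  finally show ?thesis .
qed

text \<open>The trace of \<open>dd v g\<close> is the derivative of \<open>log \<bar>det g\<bar>\<close> along \<open>v\<close>, and second derivatives commute.
The proof avoids determinants: by the formula for the derivative of the inverse, the part of the derivative that is not
manifestly symmetric in \<open>u\<close> and \<open>v\<close> is a contraction of \<open>dd u g\<close> with \<open>dd v g\<close>.\<close>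

lemma trace_dd_g_closed:
  assumes z: "z \<in> U"
  shows "dd u (\<lambda>w. tr w (\<lambda>a e. dd v (g a e) w)) z = dd v (\<lambda>w. tr w (\<lambda>a e. dd u (g a e) w)) z"
proof -
  define S where "S u v = (\<Sum>a\<in>UNIV. \<Sum>e\<in>UNIV. \<Sum>p\<in>UNIV. \<Sum>q\<in>UNIV.
    h a p z * dd u (g p q) z * h q e z * dd v (g a e) z)" for u v
  have *: "dd u (\<lambda>w. \<Sum>a\<in>UNIV. \<Sum>e\<in>UNIV. h a e w * dd v (g a e) w) z =
      (\<Sum>a\<in>UNIV. \<Sum>e\<in>UNIV. h a e z * dd u (dd v (g a e)) z) - S u v" for u v
    by (simp add: dd_rules z smooth_rules smooth_g smooth_h sum.distrib sum_subtractf S_def dd_h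
        sum_distrib_left sum_distrib_right)
  have "S u v = (\<Sum>p\<in>UNIV. \<Sum>q\<in>UNIV. \<Sum>a\<in>UNIV. \<Sum>e\<in>UNIV.
    h a p z * dd u (g p q) z * h q e z * dd v (g a e) z)"
    unfolding S_def by (rule sum_swap_pairs)
  also have "\<dots> = S v u"
    unfolding S_def by (intro sum.cong refl) (simp add: h_sym[OF z] mult.commute mult.left_commute)
  finally have "S u v = S v u" .
  then show ?thesis using * dd_swap[OF smooth_g z] unfolding tr_def by simp
qed

end

section \<open>The spray and the mean Landsberg tensor\<close>

locale homogeneous_pseudo_finsler_domain =
  conic_open_domain U + pseudo_finsler_domain U L
  for U :: "((real^'n::finite) \<times> (real^'n)) set" and L +
  assumes homog_L: "homog 2 U L"
begin

lemma smooth_dy_L: "smooth_on U (dy a L)"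
  unfolding dy_dd by (intro smooth_rules smooth_L)

lemma homog_dy_L: "homog 1 U (dy a L)"
  using homog_dy[OF smooth_L homog_L] by simp

lemma homog_g: "homog 0 U (g i j)"
  unfolding g_dd using homog_cmult[OF homog_dy[OF smooth_dy_L homog_dy_L], of "1/2"] by simp

lemma homog_h: "homog 0 U (h i j)"
proof -
  have "g_matrix L (x, t *\<^sub>R y) = g_matrix L (x, y)" if "(x, y) \<in> U" "t > 0" for x y t
    using homog_g that unfolding homog_def by (simp add: g_matrix_def)
  then show ?thesis by (simp add: homog_def g_inv_def)
qed

lemma homog_G: "homog 2 U (G i)"
proof -
  have "homog (0 + 0 + 1 + 1) U (\<lambda>z. h i a z * (2 * dx c (g a b) z - dx a (g b c) z) * snd z $ b * snd z $ c)"
    for a b c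
    by (intro homog_mult homog_diff homog_cmult homog_snd homog_h homog_dx smooth_g homog_g)
  then show ?thesis unfolding spray_def[abs_def]
    by (intro homog_cmult homog_sum) simp
qed

lemma homog_N: "homog 1 U (N k i)"
  unfolding N_eq using homog_dy[OF smooth_G homog_G] by simp

lemma g_y:
  assumes "z \<in> U"
  shows "(\<Sum>b\<in>UNIV. g a b z * snd z $ b) = 1/2 * dy a L z"
proof -
  have "(\<Sum>b\<in>UNIV. g a b z * snd z $ b) = 1/2 * (\<Sum>b\<in>UNIV. snd z $ b * dy b (dy a L) z)"
    unfolding g_dd sum_distrib_left by (intro sum.cong refl) simp
  then show ?thesis using euler[OF smooth_dy_L homog_dy_L assms, of a] by simp
qed

lemma y_low_eq: "z \<in> U \<Longrightarrow> y_low L i z = 1/2 * dy i L z"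
  unfolding y_low_def by (rule g_y)

lemma g_y_y:
  assumes "z \<in> U"
  shows "(\<Sum>a\<in>UNIV. \<Sum>b\<in>UNIV. g a b z * snd z $ a * snd z $ b) = L z"
proof -
  have "(\<Sum>a\<in>UNIV. \<Sum>b\<in>UNIV. g a b z * snd z $ a * snd z $ b) =
      (\<Sum>a\<in>UNIV. snd z $ a * (\<Sum>b\<in>UNIV. g a b z * snd z $ b))"
    by (simp add: sum_distrib_left mult_ac)
  also have "\<dots> = (\<Sum>a\<in>UNIV. 1/2 * (snd z $ a * dy a L z))"
    by (simp add: g_y[OF assms])
  also have "\<dots> = L z"
    using euler[OF smooth_L homog_L assms] by (simp only: sum_distrib_left[symmetric])
  finally show ?thesis .
qed

text \<open>Homogeneity of \<open>L\<close> gives \<open>2 g\<^sub>a\<^sub>b y\<^sup>b = L\<^sub>.\<^sub>a\<close> and \<open>g\<^sub>a\<^sub>b y\<^sup>a y\<^sup>b = L\<close>. These turn the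
lowered spray into first and second derivatives of \<open>L\<close>, free of the inverse matrix. Both the trace of the
connection and the change of charts are computed from this form.\<close>

lemma lowered_spray:
  assumes z: "z \<in> U"
  shows "(\<Sum>b\<in>UNIV. g a b z * G b z) =
    1/4 * ((\<Sum>c\<in>UNIV. snd z $ c * dx c (dy a L) z) - dx a L z)"
proof -
  define E where "E a = 1/4 * (\<Sum>b\<in>UNIV. \<Sum>c\<in>UNIV.
    (2 * dx c (g a b) z - dx a (g b c) z) * snd z $ b * snd z $ c)" for a
  have "G b z = (\<Sum>a\<in>UNIV. h b a z * E a)" for b
    unfolding spray_def E_def by (simp add: sum_distrib_left mult_ac)
  from lower_index[OF z this] have "(\<Sum>b\<in>UNIV. g a b z * G b z) = E a" .
  also have "\<dots> = 1/4 * ((\<Sum>c\<in>UNIV. snd z $ c * dx c (dy a L) z) - dx a L z)"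
  proof -
    have 1: "(\<Sum>b\<in>UNIV. dx c (g a b) z * snd z $ b) = 1/2 * dx c (dy a L) z" for c
    proof -
      have "dx c (\<lambda>w. \<Sum>b\<in>UNIV. g a b w * snd w $ b) z = dx c (\<lambda>w. 1/2 * dy a L w) z"
        unfolding dx_dd by (rule dd_eq_on[OF z g_y])
      then show ?thesis
        by (simp add: dx_dd dd_rules z smooth_rules smooth_g smooth_dy_L)
    qed
    have 2: "(\<Sum>b\<in>UNIV. \<Sum>c\<in>UNIV. dx a (g b c) z * snd z $ b * snd z $ c) = dx a L z"
    proof -
      have "dx a (\<lambda>w. \<Sum>b\<in>UNIV. \<Sum>c\<in>UNIV. g b c w * snd w $ b * snd w $ c) z = dx a L z"
        unfolding dx_dd by (rule dd_eq_on[OF z g_y_y])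
      then show ?thesis
        by (simp add: dx_dd dd_rules z smooth_rules smooth_g)
    qed
    have "(\<Sum>b\<in>UNIV. \<Sum>c\<in>UNIV. 2 * (dx c (g a b) z * snd z $ b * snd z $ c)) =
        (\<Sum>c\<in>UNIV. snd z $ c * (2 * (\<Sum>b\<in>UNIV. dx c (g a b) z * snd z $ b)))"
      by (subst sum.swap) (simp add: sum_distrib_left mult_ac)
    also have "\<dots> = (\<Sum>c\<in>UNIV. snd z $ c * dx c (dy a L) z)" by (simp add: 1)
    finally show ?thesis using 2 unfolding E_def
      by (simp add: left_diff_distrib sum_subtractf mult.assoc)
  qed
  finally show ?thesis .
qed

text \<open>The derivative of \<open>log (sqrt \<bar>det g\<bar>)\<close> along the coordinate \<open>x\<^sup>c\<close>.\<close>

definition dx_log_vol :: "'n \<Rightarrow> (real^'n) \<times> (real^'n) \<Rightarrow> real" where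
  "dx_log_vol c z = 1/2 * tr z (\<lambda>a e. dx c (g a e) z)"

lemma smooth_dx_log_vol: "smooth_on U (dx_log_vol c)"
  unfolding dx_log_vol_def[abs_def] tr_def dx_dd by (intro smooth_rules smooth_g smooth_h)

text \<open>Differentiate the lowered spray in \<open>y\<^sup>e\<close> and take the trace. On the left, the derivative of \<open>g\<close> contributes
only the mean Cartan tensor. On the right, the terms \<open>\<partial>\<^sub>e L\<^sub>.\<^sub>a - \<partial>\<^sub>a L\<^sub>.\<^sub>e\<close> are antisymmetric and drop out.\<close>

lemma trace_N:
  assumes z: "z \<in> U" and C: "\<And>k. mean_cartan L k z = 0"
  shows "(\<Sum>a\<in>UNIV. N a a z) = (\<Sum>c\<in>UNIV. snd z $ c * dx_log_vol c z)"
proof -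
  have eq: "(\<Sum>b\<in>UNIV. dy e (g a b) z * G b z) + (\<Sum>b\<in>UNIV. g a b z * N b e z) =
      1/4 * (dx e (dy a L) z - dx a (dy e L) z) + 1/2 * (\<Sum>c\<in>UNIV. snd z $ c * dx c (g a e) z)" for a e
  proof -
    have "dy e (\<lambda>w. \<Sum>b\<in>UNIV. g a b w * G b w) z =
        dy e (\<lambda>w. 1/4 * ((\<Sum>c\<in>UNIV. snd w $ c * dx c (dy a L) w) - dx a L w)) z"
      unfolding dy_dd by (rule dd_eq_on[OF z lowered_spray[unfolded dy_dd]])
    moreover have "dd (0, axis e 1) (dd (axis c 1, 0) (dd (0, axis a 1) L)) z = 2 * dx c (g a e) z" for c
      by (subst dd_swap) (auto simp: smooth_rules smooth_L z g_dd dx_dd dy_dd dd_rules)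
    moreover have "dd (0, axis e 1) (dd (axis a 1, 0) L) z = dx a (dy e L) z"
      by (subst dd_swap) (auto simp: smooth_L z dx_dd dy_dd)
    ultimately show ?thesis
      by (simp add: dx_dd dy_dd N_eq dd_rules z smooth_rules smooth_g smooth_G smooth_L sum.distrib axis_one_nth
          diff_divide_distrib add_divide_distrib mult.left_commute[of _ 2] flip: sum_distrib_left)
  qed
  have 3: "tr z (\<lambda>a e. 1/4 * (dx e (dy a L) z - dx a (dy e L) z)) = 0"
    unfolding tr_cmult tr_diff tr_transpose[OF z, of "\<lambda>a e. dx a (dy e L) z"] by simp
  have 4: "tr z (\<lambda>a e. 1/2 * (\<Sum>c\<in>UNIV. snd z $ c * dx c (g a e) z)) = (\<Sum>c\<in>UNIV. snd z $ c * dx_log_vol c z)"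
  proof -
    have "tr z (\<lambda>a e. 1/2 * (\<Sum>c\<in>UNIV. snd z $ c * dx c (g a e) z)) =
        1/2 * (\<Sum>c\<in>UNIV. snd z $ c * tr z (\<lambda>a e. dx c (g a e) z))"
      by (simp only: tr_cmult tr_sum)
    then show ?thesis by (simp add: dx_log_vol_def sum_divide_distrib)
  qed
  have "tr z (\<lambda>a e. (\<Sum>b\<in>UNIV. dy e (g a b) z * G b z) + (\<Sum>b\<in>UNIV. g a b z * N b e z)) =
      tr z (\<lambda>a e. 1/4 * (dx e (dy a L) z - dx a (dy e L) z) + 1/2 * (\<Sum>c\<in>UNIV. snd z $ c * dx c (g a e) z))"
    by (simp only: eq)
  then show ?thesis unfolding tr_add tr_cartan[OF z C] tr_lower[OF z] 3 4 by simp
qed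

text \<open>By closedness, this is the \<open>x\<^sup>c\<close>-derivative of the mean Cartan tensor: the volume density depends on \<open>x\<close> alone.\<close>

lemma dy_dx_log_vol:
  assumes z: "z \<in> U" and C: "\<And>w. w \<in> U \<Longrightarrow> mean_cartan L k w = 0"
  shows "dy k (dx_log_vol c) z = 0"
proof -
  have "dd (0, axis k 1) (\<lambda>w. tr w (\<lambda>a e. dx c (g a e) w)) z =
      dx c (\<lambda>w. tr w (\<lambda>a e. dy k (g a e) w)) z"
    unfolding dx_dd dy_dd by (rule trace_dd_g_closed[OF z])
  also have "\<dots> = dx c (\<lambda>w. 0) z"
    unfolding dx_dd by (rule dd_eq_on[OF z]) (use C in \<open>simp add: mean_cartan_eq\<close>)
  finally show ?thesis
    unfolding dx_log_vol_def[abs_def] dy_dd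
    by (subst dd_mult[OF z]) (auto simp: dx_dd tr_def intro!: smooth_rules smooth_g smooth_h)
qed

lemma dy_trace_N:
  assumes z: "z \<in> U" and C: "\<And>k w. w \<in> U \<Longrightarrow> mean_cartan L k w = 0"
  shows "(\<Sum>c\<in>UNIV. dy c (N c i) z) = dx_log_vol i z"
proof -
  have "(\<Sum>c\<in>UNIV. dy c (N c i) z) = dy i (\<lambda>w. \<Sum>c\<in>UNIV. N c c w) z"
    using N_sym[OF z, of _ _ i] by (simp add: dy_dd dd_rules z smooth_N)
  also have "\<dots> = dy i (\<lambda>w. \<Sum>c\<in>UNIV. snd w $ c * dx_log_vol c w) z"
    unfolding dy_dd by (rule dd_eq_on[OF z trace_N[OF _ C]])
  also have "\<dots> = dx_log_vol i z"
    using dy_dx_log_vol[OF z C] by (simp add: dy_dd dd_rules z smooth_rules smooth_dx_log_vol axis_one_nth)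
  finally show ?thesis .
qed

text \<open>The mean Landsberg tensor is the covariant derivative of the volume density along the connection:
\<open>\<partial>\<^sub>i log (sqrt \<bar>det g\<bar>)\<close>, minus a contraction of the mean Cartan tensor, minus the divergence \<open>N\<^sup>c\<^sub>i\<^sub>.\<^sub>c\<close>. The
first and the last term cancel, since the trace of \<open>N\<close> is linear in \<open>y\<close> with \<open>dx_log_vol\<close> as coefficients.\<close>

lemma mean_landsberg_0:
  assumes z: "z \<in> U" and C: "\<And>k w. w \<in> U \<Longrightarrow> mean_cartan L k w = 0"
  shows "mean_landsberg L i z = 0"
proof -
  have a: "tr z (\<lambda>a b. dx i (g a b) z) = 2 * dx_log_vol i z"
    by (simp add: dx_log_vol_def)
  have b: "tr z (\<lambda>a b. \<Sum>c\<in>UNIV. N c i z * dy c (g a b) z) = 0"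
    using C[OF z] unfolding mean_cartan_eq tr_sum tr_cmult by simp
  have c: "tr z (\<lambda>a b. \<Sum>c\<in>UNIV. dy b (N c i) z * g a c z) = dx_log_vol i z"
    using tr_lower[OF z, of "\<lambda>c b. dy b (N c i) z"] by (simp add: dy_trace_N[OF z C] mult.commute)
  have d: "tr z (\<lambda>a b. \<Sum>c\<in>UNIV. dy a (N c i) z * g c b z) = dx_log_vol i z"
    using tr_transpose[OF z, of "\<lambda>a b. \<Sum>c\<in>UNIV. dy b (N c i) z * g a c z"]
    by (simp add: c g_sym[OF z, of _ _])
  have "mean_landsberg L i z = 1/2 * tr z (\<lambda>a b. nabla_g L i a b z)"
    unfolding mean_landsberg_def landsberg_def tr_def by (simp add: sum_distrib_left mult_ac)
  then show ?thesis unfolding nabla_g_def tr_diff a b c d by simp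
qed

end

section \<open>Traces against a Lorentzian form\<close>

text \<open>Column \<open>k\<close> of \<open>S\<close> is determined by the others through \<open>S c = 0\<close>, which rewrites \<open>(c k)\<^sup>2 S\<^sub>k\<^sub>k\<close> as the
quadratic form of \<open>S\<close> at the remaining part of \<open>c\<close>. A semidefinite form is bounded by its trace times the squared
length of its argument.\<close>

lemma semidefinite_trace_bound:
  fixes S :: "'n::finite \<Rightarrow> 'n \<Rightarrow> real" and c :: "'n \<Rightarrow> real"
  assumes sym: "\<And>i j. S i j = S j i"
    and neg: "\<And>v. (\<Sum>i\<in>UNIV. \<Sum>j\<in>UNIV. v i * v j * S i j) \<le> 0"
    and null: "\<And>i. (\<Sum>j\<in>UNIV. S i j * c j) = 0"
    and timelike: "(\<Sum>i\<in>UNIV - {k}. (c i)\<^sup>2) < (c k)\<^sup>2"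
  shows "(\<Sum>i\<in>UNIV - {k}. S i i) \<le> S k k"
proof -
  let ?I = "UNIV - {k}"
  have pair: "(c j)\<^sup>2 * S i i + (c i)\<^sup>2 * S j j \<le> 2 * (c i * c j * S i j)" for i j
  proof -
    \<comment> \<open>Semidefiniteness at \<open>c\<^sub>j e\<^sub>i - c\<^sub>i e\<^sub>j\<close>.\<close>
    define v where "v m = (if m = i then 1 else 0) * c j - (if m = j then 1 else 0) * c i" for m
    have v: "(\<Sum>n\<in>UNIV. v n * F n) = c j * F i - c i * F j" for F
      by (simp add: v_def left_diff_distrib sum_subtractf mult.assoc)
    have "(\<Sum>m\<in>UNIV. \<Sum>n\<in>UNIV. v m * v n * S m n) = (\<Sum>m\<in>UNIV. v m * (\<Sum>n\<in>UNIV. v n * S m n))"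
      by (simp add: sum_distrib_left mult.assoc)
    also have "\<dots> = c j * (c j * S i i - c i * S i j) - c i * (c j * S j i - c i * S j j)"
      unfolding v ..
    finally show ?thesis using neg[of v] sym[of i j]
      by (simp add: algebra_simps power2_eq_square)
  qed
  have split: "(\<Sum>j\<in>UNIV. f j) = f k + (\<Sum>j\<in>?I. f j)" for f :: "'n \<Rightarrow> real"
    by (simp add: sum.remove)
  have row: "S i k * c k = - (\<Sum>j\<in>?I. S i j * c j)" for i
    using null[of i] split[of "\<lambda>j. S i j * c j"] by simp
  have "(c k)\<^sup>2 * S k k = c k * (S k k * c k)" by (simp add: power2_eq_square)
  also have "\<dots> = - (\<Sum>i\<in>?I. c i * (S i k * c k))"
    unfolding row[of k] by (simp add: sum_distrib_left mult_ac sym[of k])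
  also have "\<dots> = (\<Sum>i\<in>?I. \<Sum>j\<in>?I. c i * c j * S i j)"
    unfolding row by (simp add: sum_distrib_left sum_negf mult_ac)
  finally have quad: "(c k)\<^sup>2 * S k k = (\<Sum>i\<in>?I. \<Sum>j\<in>?I. c i * c j * S i j)" .
  have "(\<Sum>j\<in>?I. (c j)\<^sup>2) * (\<Sum>i\<in>?I. S i i) = (\<Sum>i\<in>?I. \<Sum>j\<in>?I. (c j)\<^sup>2 * S i i)"
    by (subst sum.swap) (rule sum_product)
  moreover have "(\<Sum>j\<in>?I. (c j)\<^sup>2) * (\<Sum>i\<in>?I. S i i) = (\<Sum>i\<in>?I. \<Sum>j\<in>?I. (c i)\<^sup>2 * S j j)"
    by (rule sum_product)
  ultimately have "2 * ((\<Sum>j\<in>?I. (c j)\<^sup>2) * (\<Sum>i\<in>?I. S i i)) =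
      (\<Sum>i\<in>?I. \<Sum>j\<in>?I. (c j)\<^sup>2 * S i i + (c i)\<^sup>2 * S j j)"
    by (simp add: sum.distrib)
  also have "\<dots> \<le> 2 * (\<Sum>i\<in>?I. \<Sum>j\<in>?I. c i * c j * S i j)"
    unfolding sum_distrib_left by (intro sum_mono pair)
  finally have "(\<Sum>j\<in>?I. (c j)\<^sup>2) * (\<Sum>i\<in>?I. S i i) \<le> (c k)\<^sup>2 * S k k"
    unfolding quad by simp
  moreover have "S i i \<le> 0" for i
    using neg[of "\<lambda>m. if m = i then 1 else 0"] by (simp add: mult.assoc flip: sum_distrib_left)
  then have "(c k)\<^sup>2 * (\<Sum>i\<in>?I. S i i) \<le> (\<Sum>j\<in>?I. (c j)\<^sup>2) * (\<Sum>i\<in>?I. S i i)"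
    using timelike by (intro mult_right_mono_neg sum_nonpos) auto
  ultimately have "(c k)\<^sup>2 * (\<Sum>i\<in>?I. S i i) \<le> (c k)\<^sup>2 * S k k" by linarith
  moreover have "(c k)\<^sup>2 > 0" using timelike sum_nonneg[of ?I "\<lambda>i. (c i)\<^sup>2"] by auto
  ultimately show ?thesis by simp
qed

lemma matrix_inv_unique_right:
  fixes A B :: "real^'n::finite^'n"
  assumes "A ** B = mat 1"
  shows "matrix_inv A = B"
proof -
  have "invertible A" using assms matrix_left_right_inverse[of A B] by (auto simp: invertible_def)
  then have "matrix_inv A ** (A ** B) = B"
    by (simp add: matrix_mul_assoc matrix_inv_left)
  then show ?thesis using assms by simp
qed

text \<open>The algebra behind the maximum principle. In an orthonormal basis adapted to \<open>M\<close> the trace is one diagonal entry of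
\<open>H\<close> minus the sum of the others. A negative semidefinite \<open>H\<close> that annihilates a timelike vector is effectively a form on
a negative definite complement, where the trace against \<open>M\<close> reverses its sign.\<close>

lemma lorentzian_trace_nonneg:
  fixes M H :: "real^'n::finite^'n"
  assumes sig: "lorentzian_signature M"
    and pos: "y \<bullet> (M *v y) > 0"
    and sym: "transpose H = H"
    and neg: "\<And>v. v \<bullet> (H *v v) \<le> 0"
    and null: "H *v y = 0"
  shows "(\<Sum>a\<in>UNIV. \<Sum>b\<in>UNIV. matrix_inv M $ a $ b * H $ a $ b) \<ge> 0"
proof -
  obtain P :: "real^'n^'n" and k where P: "invertible P"
    and PMP: "transpose P ** M ** P = (\<chi> i j. if i = j then (if i = k then 1 else -1) else 0)"
    using sig unfolding lorentzian_signature_def by blast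
  define \<epsilon> :: "'n \<Rightarrow> real" where "\<epsilon> i = (if i = k then 1 else -1)" for i
  define E :: "real^'n^'n" where "E = (\<chi> i j. if i = j then \<epsilon> i else 0)"
  have PMP: "transpose P ** M ** P = E" using PMP unfolding E_def \<epsilon>_def .
  have EE: "E ** E = mat 1"
    by (simp add: E_def matrix_matrix_mult_def mat_def vec_eq_iff \<epsilon>_def if_distrib[where f = "\<lambda>x. x * _"] cong: if_cong)
  have "transpose P ** (M ** (P ** E ** transpose P)) = transpose P"
  proof -
    have "transpose P ** (M ** (P ** E ** transpose P)) = (transpose P ** M ** P) ** E ** transpose P"
      by (simp add: matrix_mul_assoc)
    then show ?thesis by (simp add: PMP EE)
  qed
  moreover have "invertible (transpose P)" using P by (simp add: invertible_det_nz det_transpose)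
  ultimately have "M ** (P ** E ** transpose P) = mat 1"
    using matrix_inv_left[of "transpose P"] by (metis matrix_mul_assoc matrix_mul_lid)
  then have inv: "matrix_inv M = P ** E ** transpose P" by (rule matrix_inv_unique_right)
  define S where "S = transpose P ** H ** P"
  define c where "c = matrix_inv P *v y"
  have Pc: "P *v c = y"
    by (simp add: c_def matrix_vector_mul_assoc matrix_inv_right[OF P])
  have form: "v \<bullet> ((transpose P ** X ** P) *v v) = (P *v v) \<bullet> (X *v (P *v v))" for v and X :: "real^'n^'n"
  proof -
    have "v \<bullet> ((transpose P ** X ** P) *v v) = v \<bullet> (transpose P *v (X *v (P *v v)))"
      by (simp add: matrix_vector_mul_assoc matrix_mul_assoc)
    also have "\<dots> = (v v* transpose P) \<bullet> (X *v (P *v v))"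
      by (rule dot_lmul_matrix[symmetric])
    finally show ?thesis by (simp only: vector_transpose_matrix)
  qed
  have expand: "v \<bullet> (X *v v) = (\<Sum>i\<in>UNIV. \<Sum>j\<in>UNIV. v $ i * v $ j * X $ i $ j)" for v and X :: "real^'n^'n"
    by (simp add: inner_vec_def matrix_vector_mult_def sum_distrib_left mult_ac)
  have E_form: "v \<bullet> (E *v v) = (\<Sum>i\<in>UNIV. \<epsilon> i * (v $ i)\<^sup>2)" for v
    by (simp add: expand E_def power2_eq_square if_distrib[where f = "\<lambda>x. _ * x"] mult_ac cong: if_cong)
  have split: "(\<Sum>i\<in>UNIV. \<epsilon> i * f i) = f k - (\<Sum>i\<in>UNIV - {k}. f i)" for f :: "'n \<Rightarrow> real"
    by (subst sum.remove[of _ k]) (auto simp: \<epsilon>_def sum_negf intro!: sum.cong)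
  have "(\<Sum>i\<in>UNIV - {k}. S $ i $ i) \<le> S $ k $ k"
  proof (rule semidefinite_trace_bound[where S = "\<lambda>i j. S $ i $ j" and c = "\<lambda>i. c $ i"])
    have "transpose S = S"
      by (simp add: S_def matrix_transpose_mul sym matrix_mul_assoc)
    then show "S $ i $ j = S $ j $ i" for i j
      by (metis transpose_def vec_lambda_beta)
    show "(\<Sum>i\<in>UNIV. \<Sum>j\<in>UNIV. v i * v j * S $ i $ j) \<le> 0" for v
      using neg[of "P *v vec_lambda v"] expand[of "vec_lambda v" S] unfolding S_def form by simp
    have "S *v c = 0"
      by (simp add: S_def matrix_vector_mul_assoc[symmetric] Pc null)
    then have "(S *v c) $ i = 0" for i by simp
    then show "(\<Sum>j\<in>UNIV. S $ i $ j * c $ j) = 0" for i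
      by (simp add: matrix_vector_mult_def)
    have "c \<bullet> (E *v c) > 0" using pos unfolding PMP[symmetric] form Pc .
    then show "(\<Sum>i\<in>UNIV - {k}. (c $ i)\<^sup>2) < (c $ k)\<^sup>2"
      unfolding E_form split by simp
  qed
  moreover have "(\<Sum>a\<in>UNIV. \<Sum>b\<in>UNIV. matrix_inv M $ a $ b * H $ a $ b) = (\<Sum>i\<in>UNIV. \<epsilon> i * S $ i $ i)"
  proof -
    have "matrix_inv M $ a $ b = (\<Sum>i\<in>UNIV. \<epsilon> i * (P $ a $ i * P $ b $ i))" for a b
      by (simp add: inv matrix_matrix_mult_def transpose_def E_def if_distrib[where f = "\<lambda>x. _ * x"] mult_ac cong: if_cong)
    then have "(\<Sum>a\<in>UNIV. \<Sum>b\<in>UNIV. matrix_inv M $ a $ b * H $ a $ b) =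
        (\<Sum>a\<in>UNIV. \<Sum>b\<in>UNIV. \<Sum>i\<in>UNIV. \<epsilon> i * (P $ a $ i * P $ b $ i * H $ a $ b))"
      by (simp add: sum_distrib_left mult_ac)
    also have "\<dots> = (\<Sum>i\<in>UNIV. \<Sum>a\<in>UNIV. \<Sum>b\<in>UNIV. \<epsilon> i * (P $ a $ i * P $ b $ i * H $ a $ b))"
      by (subst (2) sum.swap, subst sum.swap) (rule refl)
    also have "\<dots> = (\<Sum>i\<in>UNIV. \<epsilon> i * S $ i $ i)"
      unfolding sum_distrib_left[symmetric]
      by (intro sum.cong refl arg_cong2[where f = "(*)"])
         (simp add: S_def matrix_matrix_mult_def transpose_def sum_distrib_right, subst sum.swap, simp add: mult_ac)
    finally show ?thesis .
  qed
  ultimately show ?thesis unfolding split by simp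
qed

section \<open>Maxima along a fibre\<close>

context open_domain
begin

lemma dd_vertical_vertical:
  fixes f :: "(real^'n) \<times> (real^'n) \<Rightarrow> real"
  assumes f: "smooth_on U f" and z: "z \<in> U"
  shows "dd (0, v) (dd (0, v) f) z = (\<Sum>a\<in>UNIV. \<Sum>b\<in>UNIV. v $ a * v $ b * dy b (dy a f) z)"
proof -
  have s: "smooth_on U (dy a f)" for a unfolding dy_dd using f by (rule smooth_on_dd)
  have "dd (0, v) (dd (0, v) f) z = (\<Sum>b\<in>UNIV. v $ b * dy b (dd (0, v) f) z)"
    by (rule dd_vertical[OF smooth_on_dd[OF f] z])
  also have "\<dots> = (\<Sum>b\<in>UNIV. v $ b * dy b (\<lambda>w. \<Sum>a\<in>UNIV. v $ a * dy a f w) z)"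
    unfolding dy_dd by (intro sum.cong refl arg_cong2[where f = "(*)"]
        dd_eq_on[OF z dd_vertical[OF f, unfolded dy_dd]])
  also have "\<dots> = (\<Sum>b\<in>UNIV. \<Sum>a\<in>UNIV. v $ a * v $ b * dy b (dy a f) z)"
    using s by (simp add: dy_dd dd_rules z smooth_rules sum_distrib_left mult_ac)
  also have "\<dots> = (\<Sum>a\<in>UNIV. \<Sum>b\<in>UNIV. v $ a * v $ b * dy b (dy a f) z)" by (rule sum.swap)
  finally show ?thesis .
qed

lemma vertical_maximum:
  fixes f :: "(real^'n) \<times> (real^'n) \<Rightarrow> real"
  assumes f: "smooth_on U f" and z: "z \<in> U" and max: "\<And>y. (fst z, y) \<in> U \<Longrightarrow> f (fst z, y) \<le> f z"
  shows "dd (0, v) f z = 0" and "dd (0, v) (dd (0, v) f) z \<le> 0"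
proof -
  let ?\<gamma> = "\<lambda>s::real. z + s *\<^sub>R (0, v)"
  have "open (?\<gamma> -` U)" by (intro open_vimage open_domain continuous_intros)
  moreover have "0 \<in> ?\<gamma> -` U" using z by (simp flip: zero_prod_def)
  ultimately obtain \<epsilon> where "\<epsilon> > 0" "ball 0 \<epsilon> \<subseteq> ?\<gamma> -` U"
    using open_contains_ball by meson
  then have \<epsilon>: "\<epsilon> > 0" "\<And>s. \<bar>s\<bar> < \<epsilon> \<Longrightarrow> ?\<gamma> s \<in> U"
    by (auto simp: subset_eq)
  have le: "f (?\<gamma> s) \<le> f z" if "\<bar>s\<bar> < \<epsilon>" for s
    using max[of "snd z + s *\<^sub>R v"] \<epsilon>(2)[OF that] by (cases z) simp
  have d: "((\<lambda>s. F (?\<gamma> s)) has_real_derivative dd (0, v) F (?\<gamma> s)) (at s)"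
    if "\<bar>s\<bar> < \<epsilon>" "smooth_on U F" for s and F :: "(real^'n) \<times> (real^'n) \<Rightarrow> real"
    using has_real_derivative_along_line smooth_on_differentiable[OF that(2) \<epsilon>(2)[OF that(1)]] by blast
  show 0: "dd (0, v) f z = 0"
    using DERIV_local_max[OF d[of 0, OF _ f] \<epsilon>(1)] le \<epsilon>(1) by (simp flip: zero_prod_def)
  show "dd (0, v) (dd (0, v) f) z \<le> 0"
  proof (rule ccontr)
    assume "\<not> ?thesis"
    then obtain \<delta> where \<delta>: "\<delta> > 0" "\<And>s. 0 < s \<Longrightarrow> s < \<delta> \<Longrightarrow> 0 < dd (0, v) f (?\<gamma> s)"
      using DERIV_pos_inc_right[OF d[of 0, OF _ smooth_on_dd[OF f, of "(0, v)"]]] \<epsilon>(1) 0 by (auto simp flip: zero_prod_def)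
    define s where "s = min \<delta> \<epsilon> / 2"
    have s: "s > 0" "s < \<delta>" "s < \<epsilon>" using \<delta>(1) \<epsilon>(1) by (auto simp: s_def)
    obtain r where r: "0 < r" "r < s" "f (?\<gamma> s) - f (?\<gamma> 0) = (s - 0) * dd (0, v) f (?\<gamma> r)"
      using MVT2[OF s(1), of "\<lambda>s. f (?\<gamma> s)" "\<lambda>s. dd (0, v) f (?\<gamma> s)"] d[OF _ f] s by auto
    have "0 < s * dd (0, v) f (?\<gamma> r)" using \<delta>(2)[of r] r s by simp
    then show False using r(3) le[of s] s by (simp flip: zero_prod_def)
  qed
qed

end

section \<open>Symmetric solutions of the affine equation\<close>

context homogeneous_pseudo_finsler_domain
begin

text \<open>For symmetric \<open>J\<close> the equation reads \<open>B\<^sub>i y\<^sup>j = (B\<^sub>b y\<^sup>b) \<delta>\<^sup>j\<^sub>i\<close>. Its trace forces \<open>B\<^sub>b y\<^sup>b = 0\<close> when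
the dimension exceeds one, and then \<open>B = 0\<close>.\<close>

lemma affine_equation_trace:
  assumes z: "z \<in> U" and y: "snd z \<noteq> 0" and n: "CARD('n) \<ge> 2"
    and C: "\<And>k w. w \<in> U \<Longrightarrow> mean_cartan L k w = 0"
    and sym: "\<And>k i j. dy j (J k i) z = dy i (J k j) z"
    and eq: "affine_equation L J z"
  shows "(real CARD('n) + 2) * (\<Sum>a\<in>UNIV. y_low L a z / L z * J a b z) = 2 * (\<Sum>a\<in>UNIV. dy b (J a a) z)"
proof -
  define B where "B b = (real CARD('n) + 2) * (\<Sum>a\<in>UNIV. y_low L a z / L z * J a b z)
    - 2 * (\<Sum>a\<in>UNIV. dy b (J a a) z)" for b
  define s where "s = (\<Sum>b\<in>UNIV. B b * snd z $ b)"
  have B: "B i * snd z $ j = s * (if j = i then 1 else 0)" for i j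
  proof -
    have "0 = (\<Sum>b\<in>UNIV. B b * ((if b = i then 1 else 0) * snd z $ j - snd z $ b * (if j = i then 1 else 0)))
        - (\<Sum>a\<in>UNIV. (dy a (J j i) z - dy i (J j a) z) * snd z $ a)"
      using eq[unfolded affine_equation_def, rule_format, of i j]
      by (simp add: B_def mean_landsberg_0[OF z C] C[OF z] sym[of _ _ _] flip: sum_distrib_left)
    also have "\<dots> = (\<Sum>b\<in>UNIV. B b * ((if b = i then 1 else 0) * snd z $ j - snd z $ b * (if j = i then 1 else 0)))"
      using sym[of _ j i] by simp
    also have "\<dots> = (\<Sum>b\<in>UNIV. (B b * (if b = i then 1 else 0)) * snd z $ j) - s * (if j = i then 1 else 0)"
      unfolding s_def by (simp add: algebra_simps sum_subtractf sum_distrib_left)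
    also have "\<dots> = B i * snd z $ j - s * (if j = i then 1 else 0)"
      by (simp flip: sum_distrib_right)
    finally show ?thesis by simp
  qed
  have "B i * snd z $ i = s" for i using B[of i i] by simp
  then have "s = (\<Sum>i::'n\<in>UNIV. s)" unfolding s_def[symmetric] by (subst s_def) (rule sum.cong[OF refl])
  then have "s * (real CARD('n) - 1) = 0" by (simp only: sum_constant) (simp add: algebra_simps)
  then have "s = 0" using n by simp
  then have "B b * snd z $ j = 0" for j using B by simp
  moreover obtain j where "snd z $ j \<noteq> 0" using y by (auto simp: vec_eq_iff)
  ultimately have "B b = 0" by (metis mult_eq_0_iff)
  then show ?thesis by (simp add: B_def)
qed

lemma dy_y_low:
  assumes z: "z \<in> U"
  shows "dy b (y_low L a) z = g a b z"
proof -
  have "dy b (y_low L a) z = dy b (\<lambda>w. 1/2 * dy a L w) z"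
    unfolding dy_dd by (rule dd_eq_on[OF z]) (simp add: y_low_eq dy_dd)
  then show ?thesis
    by (simp add: dy_dd g_dd dd_rules z smooth_rules smooth_L)
qed

lemma smooth_y_low: "smooth_on U (y_low L a)"
  unfolding y_low_def[abs_def] by (intro smooth_rules smooth_g)

lemma tr_g:
  assumes "z \<in> U"
  shows "tr z (\<lambda>a e. g a e z) = real CARD('n)"
proof -
  have "tr z (\<lambda>a e. \<Sum>b\<in>UNIV. g a b z * (if b = e then 1 else 0)) = (\<Sum>a::'n\<in>UNIV. 1)"
    using tr_lower[OF assms, of "\<lambda>b e. if b = e then 1 else 0"] by simp
  then show ?thesis by simp
qed

lemma tr_commutator:
  assumes "z \<in> U"
  shows "tr z (\<lambda>a e. u a * w e - u e * w a) = 0"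
  unfolding tr_diff using tr_transpose[OF assms, of "\<lambda>a e. u a * w e"] by simp

end

locale symmetric_affine_solution = homogeneous_pseudo_finsler_domain U L
  for U :: "((real^'n::finite) \<times> (real^'n)) set" and L +
  fixes J :: "'n \<Rightarrow> 'n \<Rightarrow> (real^'n) \<times> (real^'n) \<Rightarrow> real"
  assumes L_nonzero: "z \<in> U \<Longrightarrow> L z \<noteq> 0"
    and slit: "z \<in> U \<Longrightarrow> snd z \<noteq> 0"
    and dimension: "CARD('n) \<ge> 2"
    and mean_cartan_0: "z \<in> U \<Longrightarrow> mean_cartan L k z = 0"
    and smooth_J: "smooth_on U (J k i)"
    and homog_J: "homog 1 U (J k i)"
    and J_sym: "z \<in> U \<Longrightarrow> dy j (J k i) z = dy i (J k j) z"
    and affine: "z \<in> U \<Longrightarrow> affine_equation L J z"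
begin

definition D :: "(real^'n) \<times> (real^'n) \<Rightarrow> real" where
  "D z = (\<Sum>a\<in>UNIV. J a a z)"

text \<open>The potential of \<open>J\<close>: symmetry and homogeneity make \<open>J\<close> its fibre derivative.\<close>

definition Q :: "'n \<Rightarrow> (real^'n) \<times> (real^'n) \<Rightarrow> real" where
  "Q k z = 1/2 * (\<Sum>i\<in>UNIV. J k i z * snd z $ i)"

lemma smooth_D: "smooth_on U D"
  unfolding D_def[abs_def] by (intro smooth_rules smooth_J)

lemma homog_D: "homog 1 U D"
  unfolding D_def[abs_def] by (intro homog_sum homog_J)

lemma smooth_Q: "smooth_on U (Q k)"
  unfolding Q_def[abs_def] by (intro smooth_rules smooth_J)

lemma dy_Q:
  assumes z: "z \<in> U"
  shows "dy i (Q k) z = J k i z"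
proof -
  have "dy i (Q k) z = 1/2 * ((\<Sum>a\<in>UNIV. snd z $ a * dy i (J k a) z) + J k i z)"
    unfolding Q_def[abs_def]
    by (simp add: dy_dd dd_rules z smooth_rules smooth_J sum.distrib axis_one_nth mult.commute)
  also have "(\<Sum>a\<in>UNIV. snd z $ a * dy i (J k a) z) = J k i z"
    using euler[OF smooth_J homog_J z, of k i] J_sym[OF z, of _ k i] by simp
  finally show ?thesis by simp
qed

lemma y_J:
  assumes z: "z \<in> U"
  shows "(\<Sum>a\<in>UNIV. y_low L a z * J a b z) = 2 / (real CARD('n) + 2) * (L z * dy b D z)"
proof -
  have "(real CARD('n) + 2) * (\<Sum>a\<in>UNIV. y_low L a z / L z * J a b z) = 2 * dy b D z"
    using affine_equation_trace[OF z slit[OF z] dimension mean_cartan_0 J_sym[OF z] affine[OF z], of b]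
    unfolding D_def[abs_def] by (simp add: dy_dd dd_rules z smooth_J)
  moreover have "(\<Sum>a\<in>UNIV. y_low L a z / L z * J a b z) = (\<Sum>a\<in>UNIV. y_low L a z * J a b z) / L z"
    by (simp add: sum_divide_distrib)
  ultimately have "(real CARD('n) + 2) * ((\<Sum>a\<in>UNIV. y_low L a z * J a b z) / L z) = 2 * dy b D z"
    by (simp only:)
  then show ?thesis
    using L_nonzero[OF z] by (simp add: field_simps add_nonneg_eq_0_iff)
qed

lemma y_Q:
  assumes z: "z \<in> U"
  shows "(\<Sum>a\<in>UNIV. y_low L a z * Q a z) = 1 / (real CARD('n) + 2) * (L z * D z)"
proof -
  have "(\<Sum>a\<in>UNIV. y_low L a z * Q a z) = 1/2 * (\<Sum>a\<in>UNIV. \<Sum>b\<in>UNIV. snd z $ b * (y_low L a z * J a b z))"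
    unfolding Q_def by (simp add: sum_distrib_left sum_divide_distrib mult_ac)
  also have "\<dots> = 1/2 * (\<Sum>b\<in>UNIV. snd z $ b * (\<Sum>a\<in>UNIV. y_low L a z * J a b z))"
    by (subst sum.swap) (simp add: sum_distrib_left)
  also have "\<dots> = 1/2 * (2 / (real CARD('n) + 2) * L z * (\<Sum>b\<in>UNIV. snd z $ b * dy b D z))"
    unfolding y_J[OF z] sum_distrib_left by (simp add: mult_ac)
  also have "\<dots> = 1 / (real CARD('n) + 2) * (L z * D z)"
    using euler[OF smooth_D homog_D z] by simp
  finally show ?thesis .
qed

text \<open>Differentiate the preceding identity in \<open>y\<^sup>b\<close>, and eliminate \<open>y\<^sub>a J\<^sup>a\<^sub>b\<close> by the affine equation.\<close>

lemma lowered_Q: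
  assumes z: "z \<in> U"
  shows "(\<Sum>a\<in>UNIV. g b a z * Q a z) = 1 / (real CARD('n) + 2) * (dy b L z * D z - L z * dy b D z)"
proof -
  have "dy b (\<lambda>w. \<Sum>a\<in>UNIV. y_low L a w * Q a w) z = dy b (\<lambda>w. 1 / (real CARD('n) + 2) * (L w * D w)) z"
    unfolding dy_dd by (rule dd_eq_on[OF z y_Q])
  moreover have "dy b (\<lambda>w. \<Sum>a\<in>UNIV. y_low L a w * Q a w) z =
      (\<Sum>a\<in>UNIV. dy b (y_low L a) z * Q a z) + (\<Sum>a\<in>UNIV. y_low L a z * dy b (Q a) z)"
    by (simp add: dy_dd dd_rules z smooth_rules smooth_y_low smooth_Q sum.distrib)
  moreover have "dy b (\<lambda>w. 1 / (real CARD('n) + 2) * (L w * D w)) z =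
      1 / (real CARD('n) + 2) * (dy b L z * D z + L z * dy b D z)"
    unfolding dy_dd by (subst dd_mult[OF z]) (auto simp: dd_mult z smooth_rules smooth_L smooth_D)
  ultimately have "(\<Sum>a\<in>UNIV. g b a z * Q a z) + 2 / (real CARD('n) + 2) * (L z * dy b D z) =
      1 / (real CARD('n) + 2) * (dy b L z * D z + L z * dy b D z)"
    unfolding dy_y_low[OF z] dy_Q[OF z] y_J[OF z] g_sym[OF z, of b] by metis
  moreover have "u = 1 / k * (v - w)" if "u + 2 / k * w = 1 / k * (v + w)" for u v w k :: real
    using that by (cases "k = 0") (simp_all add: field_simps)
  ultimately show ?thesis by blast
qed

lemma J_eq_0_if_D_eq_0:
  assumes D: "\<And>z. z \<in> U \<Longrightarrow> D z = 0" and z: "z \<in> U"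
  shows "J k i z = 0"
proof -
  have Q: "Q k w = 0" if w: "w \<in> U" for w
  proof -
    have "dy b D w = dy b (\<lambda>_. 0) w" for b
      unfolding dy_dd by (rule dd_eq_on[OF w D])
    then have "(\<Sum>a\<in>UNIV. g b a w * Q a w) = 0" for b
      by (simp add: lowered_Q[OF w] D[OF w] dy_dd)
    from raise_index[OF w this, of k] show ?thesis by simp
  qed
  have "dy i (Q k) z = dy i (\<lambda>_. 0) z"
    unfolding dy_dd by (rule dd_eq_on[OF z Q])
  then show ?thesis using dy_Q[OF z, of i k] by (simp add: dy_dd)
qed

text \<open>The divergence of \<open>Q\<close> is \<open>D\<close>. Taking it in the formula for the lowered \<open>Q\<close> therefore leaves an equation for
\<open>D\<close> alone, in which the antisymmetric first-order terms cancel.\<close>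

lemma eigenvalue_equation:
  assumes z: "z \<in> U"
  shows "L z * tr z (\<lambda>a e. dy e (dy a D) z) = (real CARD('n) - 2) * D z"
proof -
  let ?c = "1 / (real CARD('n) + 2)"
  have eq: "(\<Sum>a\<in>UNIV. dy e (g b a) z * Q a z) + (\<Sum>a\<in>UNIV. g b a z * J a e z) =
      ?c * ((2 * D z) * g b e z + (dy b L z * dy e D z - dy e L z * dy b D z) - L z * dy e (dy b D) z)" for b e
  proof -
    have 1: "dy e (\<lambda>w. \<Sum>a\<in>UNIV. g b a w * Q a w) z = dy e (\<lambda>w. ?c * (dy b L w * D w - L w * dy b D w)) z"
      unfolding dy_dd by (rule dd_eq_on[OF z lowered_Q[unfolded dy_dd]])
    have 2: "dy e (\<lambda>w. \<Sum>a\<in>UNIV. g b a w * Q a w) z =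
        (\<Sum>a\<in>UNIV. dy e (g b a) z * Q a z) + (\<Sum>a\<in>UNIV. g b a z * dy e (Q a) z)"
      by (simp add: dy_dd dd_rules z smooth_rules smooth_g smooth_Q sum.distrib)
    have 3: "dy e (\<lambda>w. ?c * (dy b L w * D w - L w * dy b D w)) z =
        ?c * dy e (\<lambda>w. dy b L w * D w - L w * dy b D w) z"
      unfolding dy_dd by (subst dd_mult[OF z]) (auto intro!: smooth_rules smooth_L smooth_D)
    have 4: "dy e (\<lambda>w. dy b L w * D w - L w * dy b D w) z =
        dy e (dy b L) z * D z + dy b L z * dy e D z - (dy e L z * dy b D z + L z * dy e (dy b D) z)"
      by (simp add: dy_dd dd_rules z smooth_rules smooth_L smooth_D)
    have 5: "dy e (dy b L) z = 2 * g b e z" by (simp add: g_dd)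
    have "(\<Sum>a\<in>UNIV. dy e (g b a) z * Q a z) + (\<Sum>a\<in>UNIV. g b a z * J a e z) =
        ?c * dy e (\<lambda>w. dy b L w * D w - L w * dy b D w) z"
      using 1 unfolding 2 3 dy_Q[OF z] .
    also have "dy e (\<lambda>w. dy b L w * D w - L w * dy b D w) z =
        (2 * D z) * g b e z + (dy b L z * dy e D z - dy e L z * dy b D z) - L z * dy e (dy b D) z"
      unfolding 4 5 by (simp add: algebra_simps)
    finally show ?thesis .
  qed
  have "D z = tr z (\<lambda>b e. (\<Sum>a\<in>UNIV. dy e (g b a) z * Q a z) + (\<Sum>a\<in>UNIV. g b a z * J a e z))"
    unfolding tr_add tr_cartan[OF z mean_cartan_0[OF z]] tr_lower[OF z] D_def by simp
  also have "\<dots> = ?c * ((2 * D z) * real CARD('n) + 0 - L z * tr z (\<lambda>b e. dy e (dy b D) z))"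
    unfolding eq tr_cmult tr_diff[of z "\<lambda>b e. (2 * D z) * g b e z + (dy b L z * dy e D z - dy e L z * dy b D z)"]
      tr_add tr_g[OF z] tr_commutator[OF z, of "\<lambda>b. dy b L z" "\<lambda>b. dy b D z"] ..
  finally have "(real CARD('n) + 2) * D z = 2 * D z * real CARD('n) - L z * tr z (\<lambda>b e. dy e (dy b D) z)"
    by (simp add: field_simps add_nonneg_eq_0_iff)
  then show ?thesis by (simp add: algebra_simps)
qed

end

section \<open>The maximum principle on a fibre\<close>

lemma (in open_domain) continuous_at_smooth:
  assumes "smooth_on U f" "z \<in> U"
  shows "isCont f z"
  using smooth_on_continuous[OF assms(1)] assms(2) open_domain continuous_on_eq_continuous_at by blast

text \<open>Here \<open>L'\<close> extends \<open>L\<close> over the closure of each fibre of \<open>U\<close>, away from the origin, and vanishes on the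
boundary of the fibre.\<close>

locale lightlike_boundary =
  homogeneous_pseudo_finsler_domain U L + ext: pseudo_finsler_domain B L'
  for U :: "((real^'n::finite) \<times> (real^'n)) set" and L and B :: "((real^'n) \<times> (real^'n)) set" and L' +
  assumes U_subset: "U \<subseteq> B"
    and L'_eq: "z \<in> U \<Longrightarrow> L' z = L z"
    and L_pos: "z \<in> U \<Longrightarrow> L z > 0"
    and lorentzian: "z \<in> U \<Longrightarrow> lorentzian_signature (g_matrix L z)"
    and slit: "z \<in> U \<Longrightarrow> snd z \<noteq> 0"
    and closure_in_B: "y \<in> closure {y. (x, y) \<in> U} \<Longrightarrow> y \<noteq> 0 \<Longrightarrow> (x, y) \<in> B"
    and L'_boundary: "y \<in> closure {y. (x, y) \<in> U} \<Longrightarrow> y \<noteq> 0 \<Longrightarrow> (x, y) \<notin> U \<Longrightarrow> L' (x, y) = 0"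
begin

definition fibre :: "real^'n \<Rightarrow> (real^'n) set" where
  "fibre x = {y. (x, y) \<in> U}"

lemma open_fibre: "open (fibre x)"
proof -
  have "fibre x = Pair x -` U" by (auto simp: fibre_def)
  then show ?thesis using open_vimage[OF open_domain, of "Pair x"] by (simp add: continuous_on_Pair)
qed

lemma fibre_boundary:
  assumes "y \<in> closure (fibre x)" "y \<noteq> 0"
  shows "(x, y) \<in> B" and "y \<notin> fibre x \<Longrightarrow> L' (x, y) = 0"
  using closure_in_B L'_boundary assms by (auto simp: fibre_def)

text \<open>Identities between smooth functions extend to the boundary by continuity.\<close>

lemma vanish_on_closure:
  fixes f :: "(real^'n) \<times> (real^'n) \<Rightarrow> real"
  assumes f: "smooth_on B f" and 0: "\<And>z. z \<in> U \<Longrightarrow> f z = 0"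
    and y: "y \<in> closure (fibre x)" "y \<noteq> 0"
  shows "f (x, y) = 0"
proof -
  obtain s where s: "\<And>n. s n \<in> fibre x" "s \<longlonglongrightarrow> y"
    using y(1) closure_sequential by blast
  have "(\<lambda>n. (x, s n)) \<longlonglongrightarrow> (x, y)" by (intro tendsto_intros s)
  then have "(\<lambda>n. f (x, s n)) \<longlonglongrightarrow> f (x, y)"
    by (rule isCont_tendsto_compose[OF ext.continuous_at_smooth[OF f fibre_boundary(1)[OF y]]])
  moreover have "f (x, s n) = 0" for n using s(1) 0 by (simp add: fibre_def)
  ultimately show ?thesis by (simp add: LIMSEQ_const_iff)
qed

lemma ext_dy_dy:
  assumes "z \<in> U" "\<And>w. w \<in> U \<Longrightarrow> f' w = f w"
  shows "dy i f' z = dy i f z" and "dy j (dy i f') z = dy j (dy i f) z"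
  unfolding dy_dd using assms by (auto intro!: dd_eq_on)

lemma ext_g: "z \<in> U \<Longrightarrow> ext.g i j z = g i j z"
  using ext_dy_dy(2)[OF _ L'_eq] by (simp add: fundamental_tensor_def)

lemma ext_h: "z \<in> U \<Longrightarrow> ext.h i j z = h i j z"
  by (simp add: g_inv_def g_matrix_def ext_g)

lemma ext_tr: "z \<in> U \<Longrightarrow> ext.tr z X = tr z X"
  by (simp add: ext.tr_def tr_def ext_h)

text \<open>The identity \<open>2 g\<^sub>a\<^sub>b y\<^sup>b = L\<^sub>.\<^sub>a\<close> persists on the boundary, where \<open>g\<close> is still nondegenerate.\<close>

lemma boundary_gradient_nonzero:
  assumes y: "y \<in> closure (fibre x)" "y \<noteq> 0"
  shows "\<exists>a. dy a L' (x, y) \<noteq> 0"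
proof (rule ccontr)
  assume none: "\<not> ?thesis"
  have "(\<Sum>b\<in>UNIV. ext.g a b (x, y) * y $ b) = 0" for a
  proof -
    have "(\<lambda>z. (\<Sum>b\<in>UNIV. ext.g a b z * snd z $ b) - 1/2 * dy a L' z) (x, y) = 0"
    proof (rule vanish_on_closure[OF _ _ y])
      show "smooth_on B (\<lambda>z. (\<Sum>b\<in>UNIV. ext.g a b z * snd z $ b) - 1/2 * dy a L' z)"
        unfolding dy_dd by (intro ext.smooth_rules ext.smooth_g ext.smooth_L)
      show "(\<Sum>b\<in>UNIV. ext.g a b z * snd z $ b) - 1/2 * dy a L' z = 0" if "z \<in> U" for z
        using g_y[OF that] ext_dy_dy(1)[OF that L'_eq] that by (simp add: ext_g)
    qed
    then show ?thesis using none by simp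
  qed
  from ext.raise_index[OF fibre_boundary(1)[OF y] this] have "y $ e = 0" for e by simp
  then show False using y(2) by (simp add: vec_eq_iff)
qed

text \<open>Compare both functions with the distance \<open>r\<close> to the complement of the fibre. The nearest point \<open>z\<close> of the
complement lies on the boundary, where \<open>D'\<close> vanishes, so \<open>D'\<close> is at most a multiple of \<open>r\<close>. The ball of radius
\<open>r\<close> lies in the fibre, where \<open>L\<close> is positive, and \<open>L\<close> decreases at a definite rate against its gradient, so
\<open>L\<close> is at least a multiple of \<open>r\<close>.\<close>

lemma boundary_linear_bound:
  fixes D' :: "(real^'n) \<times> (real^'n) \<Rightarrow> real"
  assumes D': "smooth_on B D'"
    and D'0: "\<And>y. y \<in> closure (fibre x) \<Longrightarrow> y \<noteq> 0 \<Longrightarrow> y \<notin> fibre x \<Longrightarrow> D' (x, y) = 0"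
    and y0: "y0 \<in> closure (fibre x)" "y0 \<noteq> 0" "y0 \<notin> fibre x"
  obtains \<delta> K where "\<delta> > 0" "\<And>y. y \<in> fibre x \<Longrightarrow> dist y y0 < \<delta> \<Longrightarrow> \<bar>D' (x, y)\<bar> \<le> K * L (x, y)"
proof -
  have zB: "(x, y0) \<in> B" using fibre_boundary(1)[OF y0(1,2)] .
  define n where "n = (\<chi> a. dy a L' (x, y0))"
  define u where "u = sgn n"
  define c where "c = norm n / 2"
  have n: "n \<noteq> 0" using boundary_gradient_nonzero[OF y0(1,2)] by (auto simp: n_def vec_eq_iff)
  have c: "c > 0" using n by (simp add: c_def)
  have u: "norm u = 1" using n by (simp add: u_def norm_sgn)
  have "dd (0, u) L' (x, y0) = u \<bullet> n"
    using ext.dd_vertical[OF ext.smooth_L zB] by (simp add: inner_vec_def n_def)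
  also have "\<dots> = norm n"
    using n by (simp add: u_def sgn_div_norm power2_norm_eq_inner[symmetric] power2_eq_square)
  finally have P: "dd (0, u) L' (x, y0) > c" using c by (simp add: c_def)
  define R where "R w = (\<Sum>a\<in>UNIV. \<bar>dy a D' w\<bar>)" for w
  define k where "k = R (x, y0) + 1"
  have contR: "isCont R (x, y0)" unfolding R_def
    unfolding dy_dd by (intro continuous_intros ext.continuous_at_smooth smooth_on_dd[OF D'] zB)
  have "\<forall>\<^sub>F w in nhds (x, y0). w \<in> B \<and> dd (0, u) L' w > c \<and> R w < k"
  proof (intro eventually_conj)
    show "\<forall>\<^sub>F w in nhds (x, y0). w \<in> B" using ext.open_domain zB by (rule eventually_nhds_in_open)
    have "isCont (dd (0, u) L') (x, y0)" by (intro ext.continuous_at_smooth smooth_on_dd ext.smooth_L zB)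
    then show "\<forall>\<^sub>F w in nhds (x, y0). dd (0, u) L' w > c"
      using P by (intro order_tendstoD(1)[of _ "dd (0, u) L' (x, y0)"]) (auto simp: isCont_def tendsto_at_iff_tendsto_nhds)
    show "\<forall>\<^sub>F w in nhds (x, y0). R w < k"
      using contR by (intro order_tendstoD(2)[of _ "R (x, y0)"]) (auto simp: k_def isCont_def tendsto_at_iff_tendsto_nhds)
  qed
  then obtain r0 where r0: "r0 > 0"
    "\<And>w. dist w (x, y0) < r0 \<Longrightarrow> w \<in> B \<and> dd (0, u) L' w > c \<and> R w < k"
    unfolding eventually_nhds_metric by blast
  then have near: "(x, y) \<in> B" "dd (0, u) L' (x, y) > c" "R (x, y) < k" if "dist y y0 < r0" for y
    using that by (simp_all add: dist_Pair_Pair)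
  \<comment> \<open>The half keeps the nearest boundary point within \<open>r0\<close> of \<open>y0\<close> and away from the origin.\<close>
  define \<delta> where "\<delta> = min r0 (norm y0) / 2"
  show ?thesis
  proof (rule that[of \<delta> "k / c"])
    show "\<delta> > 0" using r0(1) y0(2) by (simp add: \<delta>_def)
    fix y assume y: "y \<in> fibre x" "dist y y0 < \<delta>"
    define r where "r = infdist y (- fibre x)"
    have "closed (- fibre x)" "- fibre x \<noteq> {}" using open_fibre y0(3) by auto
    then obtain z where z: "z \<notin> fibre x" "r = dist y z"
      using infdist_attains_inf[of "- fibre x" y] by (auto simp: r_def)
    have r: "r > 0" using z y(1) by auto
    have "r \<le> dist y y0" unfolding r_def using y0(3) by (intro infdist_le) simp
    then have r\<delta>: "r < \<delta>" using y(2) by simp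
    have ball: "ball y r \<subseteq> fibre x"
      using infdist_le[of _ "- fibre x" y] by (force simp: r_def)
    then have "closure (ball y r) \<subseteq> closure (fibre x)" by (rule closure_mono)
    then have z_cl: "z \<in> closure (fibre x)" using r z by (auto simp: closure_ball)
    have close: "dist w y0 < r0" "dist w y0 < norm y0" if "dist y w \<le> r" for w
      using dist_triangle[of w y0 y] that y(2) r\<delta> by (auto simp: \<delta>_def dist_commute)
    have "z \<noteq> 0" using close(2)[of z] z(2) by auto
    then have Dz: "D' (x, z) = 0" using D'0 z_cl z(1) by blast
    have along: "((\<lambda>s. f (x, w + s *\<^sub>R v)) has_real_derivative dd (0, v) f (x, w + s *\<^sub>R v)) (at s)"
      if "dist y (w + s *\<^sub>R v) \<le> r" "smooth_on B f" for f :: "(real^'n) \<times> (real^'n) \<Rightarrow> real" and w v s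
    proof -
      have "f differentiable (at ((x, w) + s *\<^sub>R (0, v)))"
        using smooth_on_differentiable[OF that(2)] near(1)[OF close(1)[OF that(1)]] by simp
      from has_real_derivative_along_line[OF this] show ?thesis by simp
    qed
    have D_le: "\<bar>D' (x, y)\<bar> \<le> k * r"
    proof -
      have seg: "dist y (z + s *\<^sub>R (y - z)) \<le> r" if "0 \<le> s" "s \<le> 1" for s
      proof -
        have "y - (z + s *\<^sub>R (y - z)) = (1 - s) *\<^sub>R (y - z)" by (simp add: algebra_simps)
        then have "dist y (z + s *\<^sub>R (y - z)) = (1 - s) * r"
          using that by (simp add: dist_norm z(2))
        then show ?thesis using that r by (simp add: mult_left_le_one_le)
      qed
      obtain s where s: "0 < s" "s < 1"
        "D' (x, z + 1 *\<^sub>R (y - z)) - D' (x, z + 0 *\<^sub>R (y - z)) = (1 - 0) * dd (0, y - z) D' (x, z + s *\<^sub>R (y - z))"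
        using MVT2[of 0 1 "\<lambda>s. D' (x, z + s *\<^sub>R (y - z))" "\<lambda>s. dd (0, y - z) D' (x, z + s *\<^sub>R (y - z))"]
          along[OF seg D'] by auto
      let ?w = "(x, z + s *\<^sub>R (y - z))"
      have w: "dist (z + s *\<^sub>R (y - z)) y0 < r0" using close(1) seg s by simp
      have "\<bar>D' (x, y)\<bar> = \<bar>dd (0, y - z) D' ?w\<bar>" using s(3) Dz by simp
      also have "\<dots> \<le> (\<Sum>a\<in>UNIV. \<bar>(y - z) $ a * dy a D' ?w\<bar>)"
        unfolding ext.dd_vertical[OF D' near(1)[OF w]] by (rule sum_abs)
      also have "\<dots> \<le> (\<Sum>a\<in>UNIV. r * \<bar>dy a D' ?w\<bar>)"
        using component_le_norm_cart[of "y - z"] z(2)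
        by (intro sum_mono) (auto simp: abs_mult dist_norm intro!: mult_right_mono)
      also have "\<dots> = r * R ?w" by (simp add: R_def sum_distrib_left)
      also have "\<dots> \<le> r * k" using near(3)[OF w] r by simp
      finally show ?thesis by (simp add: mult.commute)
    qed
    have Lpos: "L (x, y) > 0" using L_pos y(1) by (simp add: fibre_def)
    have "c * r \<le> L (x, y)"
    proof (rule ccontr)
      assume neg: "\<not> ?thesis"
      \<comment> \<open>At this distance from \<open>y\<close> against the gradient, \<open>L\<close> would already be negative.\<close>
      define s where "s = L (x, y) / c"
      have s: "0 < s" "s < r" using Lpos c neg by (auto simp: s_def field_simps)
      have seg: "dist y (y + t *\<^sub>R (- u)) = t" if "0 \<le> t" for t
        using that u by (simp add: dist_norm)
      obtain t where t: "0 < t" "t < s"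
        "L' (x, y + s *\<^sub>R (- u)) - L' (x, y + 0 *\<^sub>R (- u)) = (s - 0) * dd (0, - u) L' (x, y + t *\<^sub>R (- u))"
        using MVT2[OF s(1), of "\<lambda>t. L' (x, y + t *\<^sub>R (- u))" "\<lambda>t. dd (0, - u) L' (x, y + t *\<^sub>R (- u))"]
          along[OF _ ext.smooth_L, of y _ "- u"] seg s by force
      let ?w = "(x, y + t *\<^sub>R (- u))"
      have w: "dist (y + t *\<^sub>R (- u)) y0 < r0" by (rule close(1)) (subst seg, use t s in auto)
      have "dd (0, - u) L' ?w = - dd (0, u) L' ?w"
        unfolding ext.dd_vertical[OF ext.smooth_L near(1)[OF w]] by (simp add: sum_negf)
      then have "L' (x, y + s *\<^sub>R (- u)) = L' (x, y) - s * dd (0, u) L' ?w"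
        using t(3) by simp
      also have "\<dots> < L' (x, y) - s * c" using near(2)[OF w] s by simp
      also have "\<dots> = 0" using L'_eq[of "(x, y)"] y(1) c by (simp add: s_def fibre_def)
      finally have "L' (x, y + s *\<^sub>R (- u)) < 0" .
      moreover have "y + s *\<^sub>R (- u) \<in> fibre x" using ball seg[of s] s by auto
      then have "L' (x, y + s *\<^sub>R (- u)) > 0" using L_pos L'_eq by (simp add: fibre_def)
      ultimately show False by simp
    qed
    then have "r \<le> L (x, y) / c" using c by (simp add: field_simps)
    moreover have "k \<ge> 0" unfolding k_def R_def by (intro add_nonneg_nonneg sum_nonneg) auto
    ultimately have "k * r \<le> k * (L (x, y) / c)" by (rule mult_left_mono)
    then show "\<bar>D' (x, y)\<bar> \<le> k / c * L (x, y)" using D_le by simp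
  qed
qed

text \<open>At a maximum over the fibre the Hessian is negative semidefinite. By homogeneity it annihilates \<open>y\<close>, which is timelike
since \<open>g\<^sub>a\<^sub>b y\<^sup>a y\<^sup>b = L > 0\<close>.\<close>

lemma tr_max_nonneg:
  assumes f: "smooth_on U f" "homog 2 U f" and z: "z \<in> U"
    and max: "\<And>y. (fst z, y) \<in> U \<Longrightarrow> f (fst z, y) \<le> f z"
  shows "dy a f z = 0" and "tr z (\<lambda>a e. dy e (dy a f) z) \<ge> 0"
proof -
  note m = vertical_maximum[OF f(1) z max]
  show 0: "dy a f z = 0" for a unfolding dy_dd by (rule m(1))
  define H :: "real^'n^'n" where "H = (\<chi> a e. dy e (dy a f) z)"
  have smooth: "smooth_on U (dy a f)" for a unfolding dy_dd by (intro smooth_rules f)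
  have hom: "homog 1 U (dy a f)" for a using homog_dy[OF f] by simp
  have expand: "v \<bullet> (X *v v) = (\<Sum>i\<in>UNIV. \<Sum>j\<in>UNIV. v $ i * v $ j * X $ i $ j)" for v and X :: "real^'n^'n"
    by (simp add: inner_vec_def matrix_vector_mult_def sum_distrib_left mult_ac)
  have "(\<Sum>a\<in>UNIV. \<Sum>b\<in>UNIV. matrix_inv (g_matrix L z) $ a $ b * H $ a $ b) \<ge> 0"
  proof (rule lorentzian_trace_nonneg[OF lorentzian[OF z]])
    show "snd z \<bullet> (g_matrix L z *v snd z) > 0"
      unfolding expand using g_y_y[OF z] L_pos[OF z] by (simp add: g_matrix_def mult_ac)
    show "transpose H = H"
      unfolding H_def transpose_def dy_dd by (simp add: vec_eq_iff dd_swap[OF f(1) z])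
    show "v \<bullet> (H *v v) \<le> 0" for v
      unfolding expand using m(2)[of v] dd_vertical_vertical[OF f(1) z] by (simp add: H_def)
    show "H *v snd z = 0"
      using euler[OF smooth hom z] by (simp add: H_def matrix_vector_mult_def vec_eq_iff mult.commute 0)
  qed
  then show "tr z (\<lambda>a e. dy e (dy a f) z) \<ge> 0"
    by (simp add: tr_def g_inv_def H_def)
qed

lemma tr_dy_L_dy_L:
  assumes z: "z \<in> U"
  shows "tr z (\<lambda>a e. dy a L z * dy e L z) = 4 * L z"
proof -
  have "tr z (\<lambda>a e. dy a L z * dy e L z) = tr z (\<lambda>a e. \<Sum>b\<in>UNIV. g a b z * (2 * (snd z $ b * dy e L z)))"
  proof -
    have "(\<Sum>b\<in>UNIV. g a b z * (2 * (snd z $ b * dy e L z))) =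
        2 * dy e L z * (\<Sum>b\<in>UNIV. g a b z * snd z $ b)" for a e
      by (simp add: sum_distrib_left mult_ac)
    then show ?thesis unfolding g_y[OF z] by (simp add: mult.commute)
  qed
  also have "\<dots> = 2 * (\<Sum>a\<in>UNIV. snd z $ a * dy a L z)"
    unfolding tr_lower[OF z] sum_distrib_left ..
  also have "\<dots> = 4 * L z" using euler[OF smooth_L homog_L z] by simp
  finally show ?thesis .
qed

text \<open>If \<open>D\<^sup>2 / L\<close> has a positive maximum \<open>M\<close> at \<open>z\<close>, then \<open>D\<^sup>2 - M L\<close> has maximum \<open>0\<close> there. Criticality makes
the differential of \<open>D\<close> proportional to that of \<open>L\<close>, and the eigenvalue equation gives
\<open>L tr (Hess (D\<^sup>2 - M L)) = 2 M L + 2 (n - 2) M L - 2 n M L = - 2 M L\<close>, which has the wrong sign. Squaring \<open>D\<close>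
treats maxima and minima together and avoids the root of \<open>L\<close>.\<close>

lemma eigenfunction_no_interior_maximum:
  assumes D: "smooth_on U D" "homog 1 U D"
    and eigen: "\<And>z. z \<in> U \<Longrightarrow> L z * tr z (\<lambda>a e. dy e (dy a D) z) = (real CARD('n) - 2) * D z"
    and z: "z \<in> U" and M: "M = (D z)\<^sup>2 / L z"
    and max: "\<And>y. (fst z, y) \<in> U \<Longrightarrow> (D (fst z, y))\<^sup>2 \<le> M * L (fst z, y)"
  shows "D z = 0"
proof (rule ccontr)
  assume Dz: "D z \<noteq> 0"
  have Lz: "L z > 0" by (rule L_pos[OF z])
  define f where "f w = D w * D w - M * L w" for w
  have f: "smooth_on U f" "homog 2 U f"
    unfolding f_def[abs_def] using homog_mult[OF D(2,2)]
    by (intro smooth_rules D smooth_L homog_diff homog_cmult homog_L | simp)+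
  have fz: "f z = 0" using Lz by (simp add: f_def M power2_eq_square)
  have "f (fst z, y) \<le> f z" if "(fst z, y) \<in> U" for y
    unfolding fz using max[OF that] by (simp add: f_def power2_eq_square)
  note m = tr_max_nonneg[OF f z this]
  have d: "dy a f w = 2 * (D w * dy a D w) - M * dy a L w" if "w \<in> U" for a w
    unfolding f_def[abs_def] dy_dd by (simp add: dd_rules that smooth_rules D smooth_L)
  have dd: "dy e (dy a f) z = 2 * (dy a D z * dy e D z) + 2 * D z * dy e (dy a D) z - (2 * M) * g a e z" for a e
  proof -
    have "dy e (dy a f) z = dy e (\<lambda>w. 2 * (D w * dy a D w) - M * dy a L w) z"
      unfolding dy_dd by (rule dd_eq_on[OF z d[unfolded dy_dd]])
    then show ?thesis
      by (simp add: dy_dd dd_rules z smooth_rules D smooth_L g_dd algebra_simps)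
  qed
  have "tr z (\<lambda>a e. dy a D z * dy e D z) = M"
  proof -
    have "dy a D z = M / (2 * D z) * dy a L z" for a
      using d[OF z, of a] m(1)[of a] Dz by (simp add: field_simps)
    then have "tr z (\<lambda>a e. dy a D z * dy e D z) = tr z (\<lambda>a e. (M / (2 * D z))\<^sup>2 * (dy a L z * dy e L z))"
      by (simp add: power2_eq_square mult_ac)
    also have "\<dots> = (M / (2 * D z))\<^sup>2 * (4 * L z)" unfolding tr_cmult tr_dy_L_dy_L[OF z] ..
    also have "\<dots> = M" using Dz Lz by (simp add: M field_simps power2_eq_square)
    finally show ?thesis .
  qed
  then have trf: "tr z (\<lambda>a e. dy e (dy a f) z) =
      2 * M + 2 * D z * tr z (\<lambda>a e. dy e (dy a D) z) - 2 * M * real CARD('n)"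
    unfolding dd tr_diff[of z "\<lambda>a e. 2 * (dy a D z * dy e D z) + 2 * D z * dy e (dy a D) z"]
      tr_add tr_cmult tr_g[OF z] by simp
  have "L z * tr z (\<lambda>a e. dy e (dy a f) z) =
      2 * M * L z + 2 * D z * (L z * tr z (\<lambda>a e. dy e (dy a D) z)) - 2 * M * L z * real CARD('n)"
    unfolding trf by (simp add: algebra_simps)
  also have "\<dots> = - 2 * (M * L z)"
    unfolding eigen[OF z] using Lz by (simp add: M algebra_simps power2_eq_square)
  also have "\<dots> < 0" using Dz Lz by (simp add: M)
  finally show False using m(2) Lz by (simp add: mult_less_0_iff)
qed

text \<open>The quotient \<open>D\<^sup>2 / L\<close> is constant along rays and tends to \<open>0\<close> at the boundary of the fibre, so it attains its
maximum on the compact set of directions in the closed fibre, at an interior direction unless it vanishes.\<close>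

lemma eigenfunction_vanishes:
  assumes D: "smooth_on U D" "homog 1 U D"
    and eigen: "\<And>z. z \<in> U \<Longrightarrow> L z * tr z (\<lambda>a e. dy e (dy a D) z) = (real CARD('n) - 2) * D z"
    and D': "smooth_on B D'" "\<And>z. z \<in> U \<Longrightarrow> D' z = D z"
    and dim: "CARD('n) \<ge> 3" and U: "(x, y) \<in> U"
  shows "D (x, y) = 0"
proof (rule ccontr)
  assume nz: "D (x, y) \<noteq> 0"
  have D'0: "D' (x, w) = 0" if w: "w \<in> closure (fibre x)" "w \<noteq> 0" "w \<notin> fibre x" for w
  proof -
    \<comment> \<open>On the boundary \<open>L' = 0\<close>, so the eigenvalue equation leaves \<open>(n - 2) D' = 0\<close>.\<close>
    have "(\<lambda>z. L' z * ext.tr z (\<lambda>a e. dy e (dy a D') z) - (real CARD('n) - 2) * D' z) (x, w) = 0"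
    proof (rule vanish_on_closure[OF _ _ w(1,2)])
      show "smooth_on B (\<lambda>z. L' z * ext.tr z (\<lambda>a e. dy e (dy a D') z) - (real CARD('n) - 2) * D' z)"
        unfolding ext.tr_def dy_dd by (intro ext.smooth_rules ext.smooth_L ext.smooth_h D'(1))
      show "L' z * ext.tr z (\<lambda>a e. dy e (dy a D') z) - (real CARD('n) - 2) * D' z = 0" if "z \<in> U" for z
        using eigen[OF that] by (simp add: ext_tr that L'_eq D'(2) ext_dy_dy(2)[OF that D'(2)])
    qed
    then show ?thesis using fibre_boundary(2)[OF w(1,2,3)] dim by simp
  qed
  define q where "q w = (if w \<in> fibre x then (D' (x, w))\<^sup>2 / L' (x, w) else 0)" for w
  define S where "S = sphere 0 1 \<inter> closure (fibre x)"
  have contD: "isCont (\<lambda>w. D' (x, w)) w" and contL: "isCont (\<lambda>w. L' (x, w)) w"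
    if "w \<in> closure (fibre x)" "w \<noteq> 0" for w
  proof -
    have "isCont (\<lambda>w. f (x, w)) w" if "smooth_on B f" for f :: "(real^'n) \<times> (real^'n) \<Rightarrow> real"
      using isCont_o2[of w "Pair x" f] ext.continuous_at_smooth[OF that fibre_boundary(1)[OF \<open>w \<in> _\<close> \<open>w \<noteq> 0\<close>]]
      by (simp add: isCont_Pair)
    then show "isCont (\<lambda>w. D' (x, w)) w" "isCont (\<lambda>w. L' (x, w)) w"
      using D'(1) ext.smooth_L by auto
  qed
  have scaled: "sgn w \<in> fibre x" "q (sgn w) = q w" "sgn w \<in> S" if w: "w \<in> fibre x" for w
  proof -
    have "w \<noteq> 0" using slit w by (force simp: fibre_def)
    then have t: "inverse (norm w) > 0" by simp
    have xw: "(x, w) \<in> U" "(x, sgn w) \<in> U" using w conic[OF _ t] by (auto simp: fibre_def sgn_div_norm)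
    then show f: "sgn w \<in> fibre x" by (simp add: fibre_def)
    then show "sgn w \<in> S" using \<open>w \<noteq> 0\<close> closure_subset by (auto simp: S_def norm_sgn)
    have "D (x, sgn w) = inverse (norm w) * D (x, w)" "L (x, sgn w) = (inverse (norm w))\<^sup>2 * L (x, w)"
      using D(2) homog_L xw t unfolding homog_def sgn_div_norm by (auto simp: powr_numeral)
    then show "q (sgn w) = q w"
      using w f xw \<open>w \<noteq> 0\<close> by (simp add: q_def D'(2) L'_eq power_mult_distrib)
  qed
  have "continuous_on S q"
    unfolding continuous_on_eq_continuous_within
  proof
    fix w assume "w \<in> S"
    then have w: "w \<in> closure (fibre x)" "w \<noteq> 0" by (auto simp: S_def)
    show "continuous (at w within S) q"
    proof (cases "w \<in> fibre x")
      case True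
      have "isCont (\<lambda>w. (D' (x, w))\<^sup>2 / L' (x, w)) w"
        using True L_pos L'_eq by (intro continuous_intros contD contL w) (force simp: fibre_def)
      moreover have "\<forall>\<^sub>F v in nhds w. (D' (x, v))\<^sup>2 / L' (x, v) = q v"
        using eventually_nhds_in_open[OF open_fibre True] by eventually_elim (simp add: q_def)
      ultimately have "isCont q w" by (simp cong: isCont_cong)
      then show ?thesis by (rule continuous_at_imp_continuous_at_within)
    next
      case False
      obtain \<delta> K where \<delta>: "\<delta> > 0"
        "\<And>v. v \<in> fibre x \<Longrightarrow> dist v w < \<delta> \<Longrightarrow> \<bar>D' (x, v)\<bar> \<le> K * L (x, v)"
        using boundary_linear_bound[OF D'(1) D'0 w False] by blast
      have "norm (q v) \<le> \<bar>K * D' (x, v)\<bar>" if "dist v w < \<delta>" for v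
      proof (cases "v \<in> fibre x")
        case True
        have L: "L (x, v) > 0" "L' (x, v) = L (x, v)" using True L_pos L'_eq by (auto simp: fibre_def)
        have "\<bar>D' (x, v)\<bar> * \<bar>D' (x, v)\<bar> \<le> \<bar>D' (x, v)\<bar> * (K * L (x, v))"
          using \<delta>(2)[OF True that] by (intro mult_left_mono) auto
        then have "(D' (x, v))\<^sup>2 / L (x, v) \<le> K * \<bar>D' (x, v)\<bar>"
          using L by (simp add: field_simps power2_eq_square)
        also have "\<dots> \<le> \<bar>K * D' (x, v)\<bar>" by (simp add: abs_mult mult_right_mono)
        finally show ?thesis using True L by (simp add: q_def)
      qed (simp add: q_def)
      then have "\<forall>\<^sub>F v in at w. norm (q v) \<le> \<bar>K * D' (x, v)\<bar>"
        unfolding eventually_at using \<delta>(1) by blast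
      moreover have "((\<lambda>v. \<bar>K * D' (x, v)\<bar>) \<longlongrightarrow> \<bar>K * D' (x, w)\<bar>) (at w)"
        using contD[OF w] unfolding isCont_def by (intro tendsto_intros)
      ultimately have "(q \<longlongrightarrow> 0) (at w)"
        using D'0[OF w False] by (intro Lim_null_comparison[of q]) simp_all
      then have "isCont q w" using False by (simp add: isCont_def q_def)
      then show ?thesis by (rule continuous_at_imp_continuous_at_within)
    qed
  qed
  moreover have "compact S" unfolding S_def by (intro compact_Int_closed) auto
  moreover have "S \<noteq> {}" using scaled(3) U by (auto simp: fibre_def)
  ultimately obtain m where m: "m \<in> S" "\<And>w. w \<in> S \<Longrightarrow> q w \<le> q m"
    using continuous_attains_sup[of S q] by blast
  have y: "y \<in> fibre x" using U by (simp add: fibre_def)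
  have le: "q w \<le> q m" if "w \<in> fibre x" for w
    using m(2)[of "sgn w"] scaled[OF that] by simp
  have "q y > 0" using U nz L_pos[OF U] by (simp add: q_def fibre_def D'(2) L'_eq)
  then have "q m > 0" using le[OF y] by simp
  then have "m \<in> fibre x" by (auto simp: q_def split: if_splits)
  then have mU: "(x, m) \<in> U" by (simp add: fibre_def)
  have qm: "q m = (D (x, m))\<^sup>2 / L (x, m)" using mU by (simp add: q_def fibre_def D'(2) L'_eq)
  have "D (x, m) = 0"
  proof (rule eigenfunction_no_interior_maximum[OF D eigen mU qm])
    fix w assume "(fst (x, m), w) \<in> U"
    then have w: "(x, w) \<in> U" by simp
    then have "(D (x, w))\<^sup>2 / L (x, w) \<le> q m"
      using le[of w] by (simp add: q_def[of w] fibre_def D'(2) L'_eq)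
    then show "(D (fst (x, m), w))\<^sup>2 \<le> q m * L (fst (x, m), w)"
      using L_pos[OF w] by (simp add: field_simps)
  qed
  then show False using \<open>q m > 0\<close> qm by simp
qed

end

section \<open>Change of coordinates\<close>

lemma pd_dd: "pd i f = dd (axis i 1) f"
  by (auto simp: pd_def dd_def)

lemma dd_nth:
  fixes f :: "'a::euclidean_space \<Rightarrow> real^'n::finite"
  assumes "f differentiable (at x)"
  shows "dd v (\<lambda>x. f x $ k) x = dd v f x $ k"
  by (rule dd_eqI[OF bounded_linear.has_derivative[OF bounded_linear_vec_nth has_derivative_dd[OF assms]]])

lemma smooth_on_nth:
  fixes f :: "'a::euclidean_space \<Rightarrow> real^'n::finite"
  assumes "open S" "smooth_on S f"
  shows "smooth_on S (\<lambda>x. f x $ k)"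
  by (rule smooth_on_linear_comp[OF bounded_linear_vec_nth assms])

lemma pd_commute:
  fixes f :: "real^'n::finite \<Rightarrow> real^'m::finite"
  assumes S: "open S" and f: "smooth_on S f" and x: "x \<in> S"
  shows "pd i (pd j f) x $ k = pd j (pd i f) x $ k"
proof -
  have *: "pd i (pd j f) x $ k = dd (axis i 1) (dd (axis j 1) (\<lambda>x. f x $ k)) x" for i j
  proof -
    have "dd (axis i 1) (dd (axis j 1) (\<lambda>x. f x $ k)) x = dd (axis i 1) (\<lambda>x. dd (axis j 1) f x $ k) x"
      by (rule dd_cong[OF S x]) (rule dd_nth[OF smooth_on_differentiable[OF f]])
    then show ?thesis
      using dd_nth[OF smooth_on_differentiable[OF smooth_on_dd[OF f] x]] by (simp add: pd_dd)
  qed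
  show ?thesis unfolding * by (rule dd_commute[OF S smooth_on_nth[OF S f] x])
qed

lemma dd_pd_sum:
  fixes f :: "real^'n::finite \<Rightarrow> 'b::real_normed_vector"
  assumes "f differentiable (at x)"
  shows "dd v f x = (\<Sum>i\<in>UNIV. v $ i *\<^sub>R pd i f x)"
proof -
  have "dd v f x = dd (\<Sum>i\<in>UNIV. v $ i *\<^sub>R axis i 1) f x"
    using basis_expansion[of v] by (simp add: scalar_mult_eq_scaleR)
  then show ?thesis by (simp only: dd_sum_direction[OF assms] pd_dd)
qed

definition tangent_map :: "(real^'n::finite \<Rightarrow> real^'n) \<Rightarrow> (real^'n) \<times> (real^'n) \<Rightarrow> (real^'n) \<times> (real^'n)" where
  "tangent_map f z = (f (fst z), frechet_derivative f (at (fst z)) (snd z))"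

lemma (in open_domain) dd_horizontal_vertical:
  fixes f :: "(real^'n) \<times> (real^'n) \<Rightarrow> real"
  assumes "smooth_on U f" "z \<in> U"
  shows "dd (u, v) f z = (\<Sum>i\<in>UNIV. u $ i * dx i f z) + (\<Sum>i\<in>UNIV. v $ i * dy i f z)"
proof -
  have d: "f differentiable (at z)" using smooth_on_differentiable[OF assms] .
  interpret l: linear "\<lambda>v. dd v f z" using has_derivative_dd[OF d] has_derivative_linear by blast
  have "(u, 0) = (\<Sum>i\<in>UNIV. u $ i *\<^sub>R (axis i (1::real), 0::real^'n))"
    by (simp add: prod_eq_iff fst_sum snd_sum vec_eq_iff axis_def if_distrib cong: if_cong)
  then have "dd (u, 0) f z = (\<Sum>i\<in>UNIV. u $ i * dx i f z)"
    using dd_sum_direction[OF d, of "\<lambda>i. u $ i" "\<lambda>i. (axis i 1, 0)" UNIV]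
    by (simp only: dx_dd real_scaleR_def)
  then show ?thesis
    using l.add[of "(u, 0)" "(0, v)"] dd_vertical[OF assms] by simp
qed

lemma smooth_on_fst_comp:
  fixes f :: "'a::euclidean_space \<Rightarrow> 'c::real_normed_vector" and U :: "('a \<times> 'b::euclidean_space) set"
  assumes "open U" "smooth_on V f" "\<And>z. z \<in> U \<Longrightarrow> fst z \<in> V"
  shows "smooth_on U (\<lambda>z. f (fst z))"
  by (rule smooth_on_compose[OF assms(1) smooth_on_linear[OF bounded_linear_fst assms(1)] assms(2,3)])

lemma dd_fst_comp:
  fixes f :: "'a::euclidean_space \<Rightarrow> 'c::real_normed_vector" and z :: "'a \<times> 'b::euclidean_space"
  assumes "f differentiable (at (fst z))"
  shows "dd v (\<lambda>z. f (fst z)) z = dd (fst v) f (fst z)"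
  using has_derivative_compose[OF bounded_linear_imp_has_derivative[OF bounded_linear_fst] has_derivative_dd[OF assms]]
  by (rule dd_eqI)

text \<open>A change of induced coordinates, which in the base coordinates is the transition map \<open>\<phi>\<close>.\<close>

locale tangent_chart_change =
  src: open_domain U + tgt: open_domain W
  for U W :: "((real^'n::finite) \<times> (real^'n)) set" +
  fixes V :: "(real^'n) set" and \<phi> :: "real^'n \<Rightarrow> real^'n"
  assumes open_V: "open V" and smooth_\<phi>: "smooth_on V \<phi>"
    and base: "z \<in> U \<Longrightarrow> fst z \<in> V"
    and maps: "z \<in> U \<Longrightarrow> tangent_map \<phi> z \<in> W"
begin

abbreviation \<Phi> where "\<Phi> \<equiv> tangent_map \<phi>"

text \<open>The Jacobian of \<open>\<phi>\<close> and its derivatives, regarded as functions on the tangent bundle.\<close>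

definition jac :: "'n \<Rightarrow> 'n \<Rightarrow> (real^'n) \<times> (real^'n) \<Rightarrow> real" where
  "jac k a z = pd a \<phi> (fst z) $ k"

definition jac2 :: "'n \<Rightarrow> 'n \<Rightarrow> 'n \<Rightarrow> (real^'n) \<times> (real^'n) \<Rightarrow> real" where
  "jac2 k a b z = pd b (pd a \<phi>) (fst z) $ k"

lemma smooth_pd: "smooth_on V (pd a \<phi>)"
  unfolding pd_dd by (rule smooth_on_dd[OF smooth_\<phi>])

lemma smooth_jac: "smooth_on U (jac k a)"
  unfolding jac_def[abs_def]
  by (rule smooth_on_fst_comp[OF src.open_domain smooth_on_nth[OF open_V smooth_pd] base])

lemma smooth_jac2: "smooth_on U (jac2 k a b)"
  unfolding jac2_def[abs_def] unfolding pd_dd[of b]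
  by (rule smooth_on_fst_comp[OF src.open_domain smooth_on_nth[OF open_V smooth_on_dd[OF smooth_pd]] base])

lemma dd_jac:
  assumes "z \<in> U"
  shows "dd (0, v) (jac k a) z = 0" and "dd (axis b 1, 0) (jac k a) z = jac2 k a b z"
proof -
  have "pd a \<phi> differentiable (at (fst z))" using smooth_on_differentiable[OF smooth_pd base[OF assms]] .
  then have "dd (u, v) (jac k a) z = dd u (pd a \<phi>) (fst z) $ k" for u v
    using dd_fst_comp[of "\<lambda>x. pd a \<phi> x $ k" z "(u, v)"] smooth_on_differentiable[OF smooth_on_nth[OF open_V smooth_pd] base[OF assms]]
    unfolding jac_def[abs_def] by (simp add: dd_nth)
  moreover have "dd 0 f x = 0" if "f differentiable (at x)" for f :: "real^'n \<Rightarrow> real^'n" and x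
    using has_derivative_linear[OF has_derivative_dd[OF that]] linear_0 by blast
  ultimately show "dd (0, v) (jac k a) z = 0" "dd (axis b 1, 0) (jac k a) z = jac2 k a b z"
    using \<open>pd a \<phi> differentiable _\<close> by (simp_all add: jac2_def pd_dd)
qed

lemma dd_jac2_vertical: "z \<in> U \<Longrightarrow> dd (0, v) (jac2 k a b) z = 0"
proof -
  assume z: "z \<in> U"
  have "smooth_on V (\<lambda>x. pd b (pd a \<phi>) x $ k)"
    unfolding pd_dd[of b] by (rule smooth_on_nth[OF open_V smooth_on_dd[OF smooth_pd]])
  then have d: "(\<lambda>x. pd b (pd a \<phi>) x $ k) differentiable (at (fst z))"
    using smooth_on_differentiable base[OF z] by blast
  have "dd (0, v) (jac2 k a b) z = dd 0 (\<lambda>x. pd b (pd a \<phi>) x $ k) (fst z)"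
    unfolding jac2_def[abs_def] using dd_fst_comp[OF d, of "(0, v)"] by simp
  also have "\<dots> = 0"
    using has_derivative_linear[OF has_derivative_dd[OF d]] linear_0 by blast
  finally show ?thesis .
qed

lemma jac2_sym: "z \<in> U \<Longrightarrow> jac2 k a b z = jac2 k b a z"
  unfolding jac2_def by (rule pd_commute[OF open_V smooth_\<phi> base])

lemma \<Phi>_eq: "z \<in> U \<Longrightarrow> \<Phi> z = (\<phi> (fst z), \<Sum>b\<in>UNIV. snd z $ b *\<^sub>R pd b \<phi> (fst z))"
  unfolding tangent_map_def dd_def[symmetric]
  using dd_pd_sum[OF smooth_on_differentiable[OF smooth_\<phi> base]] by simp

lemma snd_\<Phi>: "z \<in> U \<Longrightarrow> snd (\<Phi> z) $ k = (\<Sum>b\<in>UNIV. snd z $ b * jac k b z)"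
  by (simp add: \<Phi>_eq jac_def)

lemma smooth_\<Phi>: "smooth_on U \<Phi>"
proof -
  have "smooth_on U (\<lambda>z. (\<phi> (fst z), \<Sum>b\<in>UNIV. snd z $ b *\<^sub>R pd b \<phi> (fst z)))"
    using smooth_\<phi> smooth_pd base src.open_domain
    by (intro smooth_on_Pair smooth_on_sum smooth_on_scaleR smooth_on_snd_component
        smooth_on_fst_comp[OF src.open_domain]) auto
  then show ?thesis
    by (rule iffD2[OF smooth_on_cong[OF src.open_domain \<Phi>_eq], rotated])
qed

lemma dd_\<Phi>:
  assumes z: "z \<in> U"
  shows "dd (u, v) \<Phi> z = (dd u \<phi> (fst z),
    (\<Sum>b\<in>UNIV. v $ b *\<^sub>R pd b \<phi> (fst z)) + (\<Sum>b\<in>UNIV. snd z $ b *\<^sub>R dd u (pd b \<phi>) (fst z)))"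
proof -
  have f: "((\<lambda>z. f (fst z)) has_derivative (\<lambda>v. dd (fst v) f (fst z))) (at z)" if "smooth_on V f"
    for f :: "real^'n \<Rightarrow> real^'n"
    using has_derivative_compose[OF bounded_linear_imp_has_derivative[OF bounded_linear_fst]
        has_derivative_dd[OF smooth_on_differentiable[OF that base[OF z]]]] .
  have s: "((\<lambda>z. snd z $ b) has_derivative (\<lambda>v. snd v $ b)) (at z)" for b
    by (intro bounded_linear_imp_has_derivative bounded_linear_compose[OF bounded_linear_vec_nth bounded_linear_snd])
  have "((\<lambda>z. (\<phi> (fst z), \<Sum>b\<in>UNIV. snd z $ b *\<^sub>R pd b \<phi> (fst z))) has_derivative
     (\<lambda>v. (dd (fst v) \<phi> (fst z), \<Sum>b\<in>UNIV. snd z $ b *\<^sub>R dd (fst v) (pd b \<phi>) (fst z) + snd v $ b *\<^sub>R pd b \<phi> (fst z)))) (at z)"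
    by (intro has_derivative_Pair has_derivative_sum has_derivative_scaleR f s smooth_\<phi> smooth_pd)
  from dd_eqI[OF this, of "(u, v)"] show ?thesis
    using src.dd_eq_on[OF z \<Phi>_eq] by (simp add: sum.distrib add.commute)
qed

lemma pullback_smooth:
  fixes F :: "(real^'n) \<times> (real^'n) \<Rightarrow> real"
  shows "smooth_on W F \<Longrightarrow> smooth_on U (\<lambda>z. F (\<Phi> z))"
  by (rule smooth_on_compose[OF src.open_domain smooth_\<Phi> _ maps])

lemma dd_pullback:
  fixes F :: "(real^'n) \<times> (real^'n) \<Rightarrow> real"
  assumes F: "smooth_on W F" and z: "z \<in> U"
  shows "dd (0, axis i 1) (\<lambda>z. F (\<Phi> z)) z = (\<Sum>k\<in>UNIV. jac k i z * dy k F (\<Phi> z))"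
    and "dd (axis i 1, 0) (\<lambda>z. F (\<Phi> z)) z = (\<Sum>k\<in>UNIV. jac k i z * dx k F (\<Phi> z)) +
      (\<Sum>k\<in>UNIV. (\<Sum>b\<in>UNIV. snd z $ b * jac2 k b i z) * dy k F (\<Phi> z))"
proof -
  have d: "dd v (\<lambda>z. F (\<Phi> z)) z = dd (dd v \<Phi> z) F (\<Phi> z)" for v
    by (rule dd_compose[OF smooth_on_differentiable[OF smooth_\<Phi> z] smooth_on_differentiable[OF F maps[OF z]]])
  have 0: "dd 0 f (fst z) = 0" if "smooth_on V f" for f :: "real^'n \<Rightarrow> real^'n"
    using has_derivative_linear[OF has_derivative_dd[OF smooth_on_differentiable[OF that base[OF z]]]] linear_0 by blast
  have "dd (0, axis i 1) \<Phi> z = (0, pd i \<phi> (fst z))"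
    unfolding dd_\<Phi>[OF z] by (simp add: 0 smooth_\<phi> smooth_pd axis_one_nth if_distrib[where f = "\<lambda>s. s *\<^sub>R _"] cong: if_cong)
  then show "dd (0, axis i 1) (\<lambda>z. F (\<Phi> z)) z = (\<Sum>k\<in>UNIV. jac k i z * dy k F (\<Phi> z))"
    unfolding d by (simp add: tgt.dd_horizontal_vertical[OF F maps[OF z]] jac_def)
  have "dd (axis i 1, 0) \<Phi> z = (pd i \<phi> (fst z), \<Sum>b\<in>UNIV. snd z $ b *\<^sub>R pd i (pd b \<phi>) (fst z))"
    unfolding dd_\<Phi>[OF z] by (simp add: pd_dd)
  then show "dd (axis i 1, 0) (\<lambda>z. F (\<Phi> z)) z = (\<Sum>k\<in>UNIV. jac k i z * dx k F (\<Phi> z)) +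
      (\<Sum>k\<in>UNIV. (\<Sum>b\<in>UNIV. snd z $ b * jac2 k b i z) * dy k F (\<Phi> z))"
    unfolding d by (simp add: tgt.dd_horizontal_vertical[OF F maps[OF z]] jac_def jac2_def)
qed

context
  fixes L K :: "(real^'n) \<times> (real^'n) \<Rightarrow> real"
  assumes K: "smooth_on W K" and LK: "\<And>z. z \<in> U \<Longrightarrow> L z = K (\<Phi> z)"
begin

lemma dy_L_change:
  assumes z: "z \<in> U"
  shows "dy a L z = (\<Sum>k\<in>UNIV. jac k a z * dy k K (\<Phi> z))"
  using src.dd_eq_on[OF z LK] dd_pullback(1)[OF K z] by (simp add: dy_dd)

lemma fundamental_tensor_change:
  assumes z: "z \<in> U"
  shows "fundamental_tensor L a b z =
    (\<Sum>k\<in>UNIV. jac k a z * (\<Sum>l\<in>UNIV. jac l b z * fundamental_tensor K k l (\<Phi> z)))"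
proof -
  have "dy b (dy a L) z = dy b (\<lambda>w. \<Sum>k\<in>UNIV. jac k a w * dy k K (\<Phi> w)) z"
    unfolding dy_dd by (rule src.dd_eq_on[OF z dy_L_change[unfolded dy_dd]])
  also have "\<dots> = (\<Sum>k\<in>UNIV. jac k a z * dd (0, axis b 1) (\<lambda>w. dy k K (\<Phi> w)) z)"
    using K by (simp add: dy_dd src.dd_rules z src.smooth_rules smooth_jac pullback_smooth dd_jac)
  also have "\<dots> = (\<Sum>k\<in>UNIV. jac k a z * (\<Sum>l\<in>UNIV. jac l b z * dy l (dy k K) (\<Phi> z)))"
    using dd_pullback(1)[OF _ z] smooth_on_dd[OF K] by (simp add: dy_dd)
  finally show ?thesis
    by (simp add: fundamental_tensor_def flip: sum_divide_distrib)
qed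

text \<open>In \<open>y\<^sup>c \<partial>\<^sub>c L\<^sub>.\<^sub>a - \<partial>\<^sub>a L\<close> the second derivatives of \<open>\<phi>\<close> that multiply first derivatives of
\<open>K\<close> cancel. Those that multiply \<open>K\<^sub>.\<^sub>k\<^sub>.\<^sub>l\<close> survive; they produce the inhomogeneous term in the transformation law of the spray.\<close>

lemma lowered_spray_change:
  assumes z: "z \<in> U"
  shows "(\<Sum>c\<in>UNIV. snd z $ c * dx c (dy a L) z) - dx a L z =
    (\<Sum>k\<in>UNIV. jac k a z * ((\<Sum>l\<in>UNIV. snd (\<Phi> z) $ l * dx l (dy k K) (\<Phi> z)) - dx k K (\<Phi> z)
      + 2 * (\<Sum>l\<in>UNIV. fundamental_tensor K k l (\<Phi> z) * (\<Sum>c\<in>UNIV. \<Sum>b\<in>UNIV. snd z $ c * snd z $ b * jac2 l b c z))))"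
proof -
  have 1: "dx c (dy a L) z = (\<Sum>k\<in>UNIV. jac2 k a c z * dy k K (\<Phi> z)) + (\<Sum>k\<in>UNIV. jac k a z *
     ((\<Sum>l\<in>UNIV. jac l c z * dx l (dy k K) (\<Phi> z)) + (\<Sum>l\<in>UNIV. (\<Sum>b\<in>UNIV. snd z $ b * jac2 l b c z) * dy l (dy k K) (\<Phi> z))))" for c
  proof -
    have "dx c (dy a L) z = dx c (\<lambda>w. \<Sum>k\<in>UNIV. jac k a w * dy k K (\<Phi> w)) z"
      unfolding dx_dd dy_dd by (rule src.dd_eq_on[OF z dy_L_change[unfolded dy_dd]])
    also have "\<dots> = (\<Sum>k\<in>UNIV. jac2 k a c z * dy k K (\<Phi> z) + jac k a z * dd (axis c 1, 0) (\<lambda>w. dy k K (\<Phi> w)) z)"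
      using K by (simp add: dx_dd dy_dd src.dd_rules z src.smooth_rules smooth_jac pullback_smooth dd_jac)
    finally show ?thesis
      using dd_pullback(2)[OF _ z] smooth_on_dd[OF K] by (simp add: dy_dd dx_dd sum.distrib)
  qed
  have 2: "dx a L z = (\<Sum>k\<in>UNIV. jac k a z * dx k K (\<Phi> z)) +
      (\<Sum>k\<in>UNIV. (\<Sum>b\<in>UNIV. snd z $ b * jac2 k b a z) * dy k K (\<Phi> z))"
    using src.dd_eq_on[OF z LK] dd_pullback(2)[OF K z] by (simp add: dx_dd)
  have 3: "(\<Sum>c\<in>UNIV. snd z $ c * (\<Sum>k\<in>UNIV. jac2 k a c z * dy k K (\<Phi> z))) =
      (\<Sum>k\<in>UNIV. (\<Sum>b\<in>UNIV. snd z $ b * jac2 k b a z) * dy k K (\<Phi> z))"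
    unfolding sum_distrib_left sum_distrib_right
    by (subst sum.swap) (simp add: jac2_sym[OF z, of _ a] mult_ac)
  have 4: "(\<Sum>c\<in>UNIV. snd z $ c * (\<Sum>l\<in>UNIV. jac l c z * F l)) = (\<Sum>l\<in>UNIV. snd (\<Phi> z) $ l * F l)" for F
    unfolding snd_\<Phi>[OF z] sum_distrib_left sum_distrib_right
    by (subst sum.swap) (simp add: mult_ac)
  have 5: "(\<Sum>c\<in>UNIV. snd z $ c * (\<Sum>l\<in>UNIV. (\<Sum>b\<in>UNIV. snd z $ b * jac2 l b c z) * F l)) =
      (\<Sum>l\<in>UNIV. F l * (\<Sum>c\<in>UNIV. \<Sum>b\<in>UNIV. snd z $ c * snd z $ b * jac2 l b c z))" for F
    unfolding sum_distrib_left sum_distrib_right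
    by (subst sum.swap) (simp add: mult_ac)
  have 6: "(\<Sum>c\<in>UNIV. snd z $ c * (\<Sum>k\<in>UNIV. jac k a z * F k c)) =
      (\<Sum>k\<in>UNIV. jac k a z * (\<Sum>c\<in>UNIV. snd z $ c * F k c))" for F
    unfolding sum_distrib_left by (subst sum.swap) (simp add: mult_ac)
  have "(\<Sum>c\<in>UNIV. snd z $ c * dx c (dy a L) z) - dx a L z =
    (\<Sum>k\<in>UNIV. jac k a z * ((\<Sum>l\<in>UNIV. snd (\<Phi> z) $ l * dx l (dy k K) (\<Phi> z)) +
       (\<Sum>l\<in>UNIV. dy l (dy k K) (\<Phi> z) * (\<Sum>c\<in>UNIV. \<Sum>b\<in>UNIV. snd z $ c * snd z $ b * jac2 l b c z))))
     - (\<Sum>k\<in>UNIV. jac k a z * dx k K (\<Phi> z))"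
    unfolding 1 2 distrib_left[of "snd z $ _"] sum.distrib 3 6 4 5 by simp
  also have "\<dots> = (\<Sum>k\<in>UNIV. jac k a z * ((\<Sum>l\<in>UNIV. snd (\<Phi> z) $ l * dx l (dy k K) (\<Phi> z)) - dx k K (\<Phi> z)
      + 2 * (\<Sum>l\<in>UNIV. fundamental_tensor K k l (\<Phi> z) * (\<Sum>c\<in>UNIV. \<Sum>b\<in>UNIV. snd z $ c * snd z $ b * jac2 l b c z))))"
    by (simp add: fundamental_tensor_def algebra_simps sum_subtractf sum.distrib flip: sum_divide_distrib)
  finally show ?thesis .
qed

end

end

locale tangent_chart_iso = tangent_chart_change U W V \<phi>
  for U W :: "((real^'n::finite) \<times> (real^'n)) set" and V and \<phi> :: "real^'n \<Rightarrow> real^'n" +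
  fixes V' :: "(real^'n) set" and \<psi> :: "real^'n \<Rightarrow> real^'n"
  assumes open_V': "open V'" and smooth_\<psi>: "smooth_on V' \<psi>"
    and \<phi>_V: "x \<in> V \<Longrightarrow> \<phi> x \<in> V'" and \<psi>_V': "x' \<in> V' \<Longrightarrow> \<psi> x' \<in> V"
    and \<psi>_\<phi>: "x \<in> V \<Longrightarrow> \<psi> (\<phi> x) = x" and \<phi>_\<psi>: "x' \<in> V' \<Longrightarrow> \<phi> (\<psi> x') = x'"
begin

definition inv_jac :: "'n \<Rightarrow> 'n \<Rightarrow> (real^'n) \<times> (real^'n) \<Rightarrow> real" where
  "inv_jac a i z = pd i \<psi> (\<phi> (fst z)) $ a"

lemma pd_inverse:
  assumes x': "x' \<in> V'"
  shows "(\<Sum>e\<in>UNIV. pd e \<phi> (\<psi> x') $ k * pd j \<psi> x' $ e) = (if k = j then 1 else 0)"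
proof -
  have d: "\<psi> differentiable (at x')" "\<phi> differentiable (at (\<psi> x'))"
    using smooth_on_differentiable smooth_\<psi> smooth_\<phi> x' \<psi>_V' by blast+
  have "dd (axis j 1) (\<lambda>x. \<phi> (\<psi> x)) x' = dd (axis j 1) (\<lambda>x. x) x'"
    by (rule dd_cong[OF open_V' x' \<phi>_\<psi>])
  also have "\<dots> = axis j 1" by (simp add: dd_def)
  finally have "(\<Sum>e\<in>UNIV. pd j \<psi> x' $ e *\<^sub>R pd e \<phi> (\<psi> x')) = axis j 1"
    unfolding dd_compose[OF d] dd_pd_sum[OF d(2)] pd_dd[of j] .
  then have "(\<Sum>e\<in>UNIV. pd j \<psi> x' $ e *\<^sub>R pd e \<phi> (\<psi> x')) $ k = axis j 1 $ k" by simp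
  then show ?thesis by (simp add: axis_one_nth mult.commute)
qed

lemma jac_inv_jac: "z \<in> U \<Longrightarrow> (\<Sum>e\<in>UNIV. jac k e z * inv_jac e j z) = (if k = j then 1 else 0)"
  using pd_inverse[OF \<phi>_V[OF base]] by (simp add: jac_def inv_jac_def \<psi>_\<phi>[OF base])

lemma inv_jac_jac:
  assumes z: "z \<in> U"
  shows "(\<Sum>k\<in>UNIV. inv_jac a k z * jac k b z) = (if a = b then 1 else 0)"
proof -
  let ?P = "\<chi> k e. jac k e z" and ?R = "\<chi> e j. inv_jac e j z"
  have "?P ** ?R = mat 1"
    using jac_inv_jac[OF z] by (simp add: matrix_matrix_mult_def mat_def vec_eq_iff)
  then have "?R ** ?P = mat 1" using matrix_left_right_inverse by blast
  then have "(?R ** ?P) $ a $ b = mat 1 $ a $ b" by simp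
  then show ?thesis by (simp add: matrix_matrix_mult_def mat_def)
qed

lemma jac_injective:
  assumes z: "z \<in> U" and eq: "\<And>a. (\<Sum>k\<in>UNIV. jac k a z * X k) = (\<Sum>k\<in>UNIV. jac k a z * Y k)"
  shows "X j = Y j"
proof -
  have *: "(\<Sum>a\<in>UNIV. inv_jac a j z * (\<Sum>k\<in>UNIV. jac k a z * X k)) = X j" for X :: "'n \<Rightarrow> real"
  proof -
    have "(\<Sum>a\<in>UNIV. inv_jac a j z * (\<Sum>k\<in>UNIV. jac k a z * X k)) = (\<Sum>k\<in>UNIV. (\<Sum>a\<in>UNIV. jac k a z * inv_jac a j z) * X k)"
      unfolding sum_distrib_left sum_distrib_right by (subst sum.swap) (simp add: mult_ac)
    then show ?thesis by (simp add: jac_inv_jac[OF z])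
  qed
  show ?thesis using *[of X] *[of Y] eq by simp
qed

lemma invertible_change:
  assumes z: "z \<in> U" and K: "smooth_on W K" and LK: "\<And>z. z \<in> U \<Longrightarrow> L z = K (\<Phi> z)"
    and inv: "invertible (g_matrix K (\<Phi> z))"
  shows "invertible (g_matrix L z)"
proof -
  let ?P = "\<chi> k e. jac k e z" and ?R = "\<chi> e j. inv_jac e j z"
  have "?P ** ?R = mat 1"
    using jac_inv_jac[OF z] by (simp add: matrix_matrix_mult_def mat_def vec_eq_iff)
  then have P: "invertible ?P" using matrix_left_right_inverse unfolding invertible_def by blast
  have "g_matrix L z = transpose ?P ** (g_matrix K (\<Phi> z) ** ?P)"
    using fundamental_tensor_change[OF K LK z]
    by (simp add: g_matrix_def matrix_matrix_mult_def transpose_def vec_eq_iff mult.commute)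
  then show ?thesis
    using P inv by (simp add: invertible_det_nz det_mul det_transpose)
qed

text \<open>Differentiate the identity between the Jacobians of \<open>\<phi>\<close> and \<open>\<psi>\<close>. It converts the second derivatives of \<open>\<psi>\<close> in
the transformation law of a connection into those of \<open>\<phi>\<close>, which the change of the spray produces.\<close>

lemma second_derivatives_inverse:
  assumes z: "z \<in> U"
  shows "(\<Sum>e\<in>UNIV. \<Sum>b\<in>UNIV. jac k e z * pd i (pd b \<psi>) (\<phi> (fst z)) $ e * snd (\<Phi> z) $ b) =
    - (\<Sum>a\<in>UNIV. \<Sum>e\<in>UNIV. inv_jac a i z * (snd z $ e * jac2 k e a z))"
proof -
  define x' where "x' = \<phi> (fst z)"
  have x': "x' \<in> V'" "\<psi> x' = fst z" using base[OF z] by (auto simp: x'_def \<phi>_V \<psi>_\<phi>)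
  have s\<psi>: "smooth_on V' (pd b \<psi>)" for b unfolding pd_dd by (rule smooth_on_dd[OF smooth_\<psi>])
  have eq: "(\<Sum>e\<in>UNIV. (\<Sum>a\<in>UNIV. inv_jac a i z * jac2 k e a z) * inv_jac e b z + jac k e z * pd i (pd b \<psi>) x' $ e) = 0" for b
  proof -
    have d1: "((\<lambda>x. pd e \<phi> (\<psi> x) $ k) has_derivative (\<lambda>v. dd (dd v \<psi> x') (pd e \<phi>) (fst z) $ k)) (at x')" for e
      using has_derivative_compose[OF has_derivative_dd[OF smooth_on_differentiable[OF smooth_\<psi> x'(1)]]
          has_derivative_dd[OF smooth_on_differentiable[OF smooth_pd \<psi>_V'[OF x'(1)]]]]
      by (auto intro: bounded_linear.has_derivative[OF bounded_linear_vec_nth] simp: x'(2))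
    have d2: "((\<lambda>x. pd b \<psi> x $ e) has_derivative (\<lambda>v. dd v (pd b \<psi>) x' $ e)) (at x')" for e
      by (rule bounded_linear.has_derivative[OF bounded_linear_vec_nth
            has_derivative_dd[OF smooth_on_differentiable[OF s\<psi> x'(1)]]])
    have "((\<lambda>x. \<Sum>e\<in>UNIV. pd e \<phi> (\<psi> x) $ k * pd b \<psi> x $ e) has_derivative
        (\<lambda>v. \<Sum>e\<in>UNIV. pd e \<phi> (\<psi> x') $ k * dd v (pd b \<psi>) x' $ e
           + dd (dd v \<psi> x') (pd e \<phi>) (fst z) $ k * pd b \<psi> x' $ e)) (at x')"
      by (intro has_derivative_sum has_derivative_mult d1 d2)
    from dd_eqI[OF this, of "axis i 1"]
    have "dd (axis i 1) (\<lambda>x. \<Sum>e\<in>UNIV. pd e \<phi> (\<psi> x) $ k * pd b \<psi> x $ e) x' =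
       (\<Sum>e\<in>UNIV. jac k e z * pd i (pd b \<psi>) x' $ e + dd (pd i \<psi> x') (pd e \<phi>) (fst z) $ k * inv_jac e b z)"
      by (simp add: x'(2) jac_def inv_jac_def pd_dd flip: x'_def)
    moreover have "dd (axis i 1) (\<lambda>x. \<Sum>e\<in>UNIV. pd e \<phi> (\<psi> x) $ k * pd b \<psi> x $ e) x' =
       dd (axis i 1) (\<lambda>x. if k = b then 1 else 0) x'"
      by (rule dd_cong[OF open_V' x'(1) pd_inverse])
    moreover have "dd (pd i \<psi> x') (pd e \<phi>) (fst z) $ k = (\<Sum>a\<in>UNIV. inv_jac a i z * jac2 k e a z)" for e
      unfolding dd_pd_sum[OF smooth_on_differentiable[OF smooth_pd base[OF z]]] by (simp add: inv_jac_def jac2_def x'_def)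
    ultimately show ?thesis by (simp add: add.commute)
  qed
  have inv_jac_y: "(\<Sum>b\<in>UNIV. inv_jac e b z * snd (\<Phi> z) $ b) = snd z $ e" for e
  proof -
    have "(\<Sum>b\<in>UNIV. inv_jac e b z * snd (\<Phi> z) $ b) = (\<Sum>c\<in>UNIV. (\<Sum>b\<in>UNIV. inv_jac e b z * jac b c z) * snd z $ c)"
      unfolding snd_\<Phi>[OF z] sum_distrib_left sum_distrib_right by (subst sum.swap) (simp add: mult_ac)
    then show ?thesis by (simp add: inv_jac_jac[OF z])
  qed
  have "0 = (\<Sum>b\<in>UNIV. snd (\<Phi> z) $ b * (\<Sum>e\<in>UNIV. (\<Sum>a\<in>UNIV. inv_jac a i z * jac2 k e a z) * inv_jac e b z + jac k e z * pd i (pd b \<psi>) x' $ e))"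
    unfolding eq by simp
  also have "\<dots> = (\<Sum>e\<in>UNIV. (\<Sum>a\<in>UNIV. inv_jac a i z * jac2 k e a z) * (\<Sum>b\<in>UNIV. inv_jac e b z * snd (\<Phi> z) $ b)) +
      (\<Sum>e\<in>UNIV. \<Sum>b\<in>UNIV. jac k e z * pd i (pd b \<psi>) x' $ e * snd (\<Phi> z) $ b)"
    unfolding sum_distrib_left[of "snd (\<Phi> z) $ _"] sum_distrib_left[of "sum _ _" _ UNIV]
    by (subst sum.swap) (simp add: sum.distrib distrib_left mult_ac)
  also have "(\<Sum>e\<in>UNIV. (\<Sum>a\<in>UNIV. inv_jac a i z * jac2 k e a z) * (\<Sum>b\<in>UNIV. inv_jac e b z * snd (\<Phi> z) $ b)) =
      (\<Sum>a\<in>UNIV. \<Sum>e\<in>UNIV. inv_jac a i z * (snd z $ e * jac2 k e a z))"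
    unfolding inv_jac_y sum_distrib_right by (subst sum.swap) (simp add: mult_ac)
  finally show ?thesis unfolding x'_def by simp
qed

end

locale finsler_chart_change =
  src: homogeneous_pseudo_finsler_domain U L + tgt: homogeneous_pseudo_finsler_domain W K +
  tangent_chart_iso U W V \<phi> V' \<psi>
  for U W :: "((real^'n::finite) \<times> (real^'n)) set" and L K V \<phi> V' \<psi> +
  assumes LK: "z \<in> U \<Longrightarrow> L z = K (\<Phi> z)"
begin

definition jac2_y_y :: "'n \<Rightarrow> (real^'n) \<times> (real^'n) \<Rightarrow> real" where
  "jac2_y_y l z = (\<Sum>c\<in>UNIV. \<Sum>b\<in>UNIV. snd z $ c * snd z $ b * jac2 l b c z)"

text \<open>Both lowered sprays are known in terms of \<open>L\<close> and \<open>K\<close>. The law for the spray itself follows since \<open>g\<close> and the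
Jacobian are invertible.\<close>

lemma spray_change:
  assumes z: "z \<in> U"
  shows "tgt.G l (\<Phi> z) = (\<Sum>b\<in>UNIV. jac l b z * src.G b z) - 1/2 * jac2_y_y l z"
proof -
  let ?X = "\<lambda>l. \<Sum>b\<in>UNIV. jac l b z * src.G b z" and ?Y = "\<lambda>l. tgt.G l (\<Phi> z) + 1/2 * jac2_y_y l z"
  have "(\<Sum>k\<in>UNIV. jac k a z * (\<Sum>l\<in>UNIV. tgt.g k l (\<Phi> z) * ?X l)) =
      (\<Sum>k\<in>UNIV. jac k a z * (\<Sum>l\<in>UNIV. tgt.g k l (\<Phi> z) * ?Y l))" for a
  proof -
    have "(\<Sum>k\<in>UNIV. jac k a z * (\<Sum>l\<in>UNIV. tgt.g k l (\<Phi> z) * ?X l)) = (\<Sum>b\<in>UNIV. src.g a b z * src.G b z)"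
    proof -
      have "(\<Sum>b\<in>UNIV. src.g a b z * src.G b z) =
          (\<Sum>b\<in>UNIV. \<Sum>k\<in>UNIV. jac k a z * (\<Sum>l\<in>UNIV. tgt.g k l (\<Phi> z) * (jac l b z * src.G b z)))"
      proof (intro sum.cong refl)
        fix b
        show "src.g a b z * src.G b z = (\<Sum>k\<in>UNIV. jac k a z * (\<Sum>l\<in>UNIV. tgt.g k l (\<Phi> z) * (jac l b z * src.G b z)))"
          by (subst fundamental_tensor_change[OF tgt.smooth_L LK z])
             (simp_all add: sum_distrib_left sum_distrib_right mult_ac)
      qed
      also have "\<dots> = (\<Sum>k\<in>UNIV. jac k a z * (\<Sum>b\<in>UNIV. \<Sum>l\<in>UNIV. tgt.g k l (\<Phi> z) * (jac l b z * src.G b z)))"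
        by (subst sum.swap) (simp add: sum_distrib_left)
      also have "\<dots> = (\<Sum>k\<in>UNIV. jac k a z * (\<Sum>l\<in>UNIV. tgt.g k l (\<Phi> z) * ?X l))"
        unfolding sum_distrib_left[of "tgt.g _ _ _"] by (subst (2) sum.swap) (rule refl)
      finally show ?thesis by simp
    qed
    also have "\<dots> = 1/4 * (\<Sum>k\<in>UNIV. jac k a z * ((\<Sum>l\<in>UNIV. snd (\<Phi> z) $ l * dx l (dy k K) (\<Phi> z)) - dx k K (\<Phi> z)
      + 2 * (\<Sum>l\<in>UNIV. tgt.g k l (\<Phi> z) * jac2_y_y l z)))"
      unfolding src.lowered_spray[OF z] jac2_y_y_def
      by (rule arg_cong[where f = "(*) (1/4)", OF lowered_spray_change[OF tgt.smooth_L LK z]])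
    also have "\<dots> = (\<Sum>k\<in>UNIV. jac k a z * (\<Sum>l\<in>UNIV. tgt.g k l (\<Phi> z) * ?Y l))"
      unfolding sum_distrib_left[of "1/4"]
    proof (intro sum.cong refl)
      fix k
      have "(\<Sum>l\<in>UNIV. tgt.g k l (\<Phi> z) * ?Y l) =
         (\<Sum>l\<in>UNIV. tgt.g k l (\<Phi> z) * tgt.G l (\<Phi> z)) + 1/2 * (\<Sum>l\<in>UNIV. tgt.g k l (\<Phi> z) * jac2_y_y l z)"
        by (simp add: distrib_left sum.distrib sum_divide_distrib)
      also have "\<dots> = 1/4 * ((\<Sum>l\<in>UNIV. snd (\<Phi> z) $ l * dx l (dy k K) (\<Phi> z)) - dx k K (\<Phi> z)
          + 2 * (\<Sum>l\<in>UNIV. tgt.g k l (\<Phi> z) * jac2_y_y l z))"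
        unfolding tgt.lowered_spray[OF maps[OF z]] by (simp add: algebra_simps)
      finally show "1/4 * (jac k a z * ((\<Sum>l\<in>UNIV. snd (\<Phi> z) $ l * dx l (dy k K) (\<Phi> z)) - dx k K (\<Phi> z)
          + 2 * (\<Sum>l\<in>UNIV. tgt.g k l (\<Phi> z) * jac2_y_y l z))) = jac k a z * (\<Sum>l\<in>UNIV. tgt.g k l (\<Phi> z) * ?Y l)"
        by (simp only: mult.left_commute)
    qed
    finally show ?thesis .
  qed
  from jac_injective[OF z this]
  have "(\<Sum>l\<in>UNIV. tgt.g k l (\<Phi> z) * ?X l) = (\<Sum>l\<in>UNIV. tgt.g k l (\<Phi> z) * ?Y l)" for k .
  from tgt.raise_index[OF maps[OF z] this, of l] tgt.raise_index[OF maps[OF z] refl, of ?Y l]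
  show ?thesis by simp
qed

lemma dy_jac2_y_y:
  assumes z: "z \<in> U"
  shows "dy i (jac2_y_y l) z = 2 * (\<Sum>b\<in>UNIV. snd z $ b * jac2 l b i z)"
proof -
  have "dy i (jac2_y_y l) z = (\<Sum>c\<in>UNIV. \<Sum>b\<in>UNIV.
      ((if c = i then 1 else 0) * snd z $ b + snd z $ c * (if b = i then 1 else 0)) * jac2 l b c z)"
    unfolding jac2_y_y_def[abs_def] dy_dd
    by (simp add: src.dd_rules z src.smooth_rules smooth_jac2 dd_jac2_vertical axis_one_nth)
  also have "\<dots> = (\<Sum>c\<in>UNIV. (if c = i then 1 else 0) * (\<Sum>b\<in>UNIV. snd z $ b * jac2 l b c z)) +
      (\<Sum>c\<in>UNIV. \<Sum>b\<in>UNIV. (if b = i then 1 else 0) * (snd z $ c * jac2 l b c z))"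
    by (simp add: distrib_right distrib_left sum.distrib mult_ac sum_distrib_left)
  also have "\<dots> = 2 * (\<Sum>b\<in>UNIV. snd z $ b * jac2 l b i z)"
    using jac2_sym[OF z, of l i] by simp
  finally show ?thesis .
qed

lemma N_change_lowered:
  assumes z: "z \<in> U"
  shows "(\<Sum>m\<in>UNIV. jac m i z * tgt.N l m (\<Phi> z)) =
    (\<Sum>b\<in>UNIV. jac l b z * src.N b i z) - (\<Sum>b\<in>UNIV. snd z $ b * jac2 l b i z)"
proof -
  have "(\<Sum>m\<in>UNIV. jac m i z * tgt.N l m (\<Phi> z)) = dd (0, axis i 1) (\<lambda>w. tgt.G l (\<Phi> w)) z"
    using dd_pullback(1)[OF tgt.smooth_G z] by (simp add: tgt.N_eq)
  also have "\<dots> = dd (0, axis i 1) (\<lambda>w. (\<Sum>b\<in>UNIV. jac l b w * src.G b w) - 1/2 * jac2_y_y l w) z"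
    by (rule src.dd_eq_on[OF z spray_change])
  also have "\<dots> = (\<Sum>b\<in>UNIV. jac l b z * src.N b i z) - 1/2 * dy i (jac2_y_y l) z"
  proof -
    have "smooth_on U (jac2_y_y l)" unfolding jac2_y_y_def[abs_def] by (intro src.smooth_rules smooth_jac2)
    then show ?thesis
      by (simp add: src.dd_rules z src.smooth_rules smooth_jac src.smooth_G dd_jac src.N_eq dy_dd)
  qed
  finally show ?thesis by (simp add: dy_jac2_y_y[OF z])
qed

lemma N_change:
  assumes z: "z \<in> U"
  shows "tgt.N k i (\<Phi> z) =
    (\<Sum>e\<in>UNIV. \<Sum>b\<in>UNIV. jac k e z * pd i (pd b \<psi>) (\<phi> (fst z)) $ e * snd (\<Phi> z) $ b) +
    (\<Sum>e\<in>UNIV. \<Sum>a\<in>UNIV. jac k e z * inv_jac a i z * src.N e a z)"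
proof -
  have "tgt.N k i (\<Phi> z) = (\<Sum>m\<in>UNIV. (\<Sum>a\<in>UNIV. jac m a z * inv_jac a i z) * tgt.N k m (\<Phi> z))"
    by (simp add: jac_inv_jac[OF z])
  also have "\<dots> = (\<Sum>a\<in>UNIV. inv_jac a i z * (\<Sum>m\<in>UNIV. jac m a z * tgt.N k m (\<Phi> z)))"
    unfolding sum_distrib_left sum_distrib_right by (subst sum.swap) (simp add: mult_ac)
  also have "\<dots> = (\<Sum>a\<in>UNIV. inv_jac a i z * (\<Sum>b\<in>UNIV. jac k b z * src.N b a z))
      - (\<Sum>a\<in>UNIV. inv_jac a i z * (\<Sum>b\<in>UNIV. snd z $ b * jac2 k b a z))"
    unfolding N_change_lowered[OF z] by (simp add: right_diff_distrib sum_subtractf)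
  also have "(\<Sum>a\<in>UNIV. inv_jac a i z * (\<Sum>b\<in>UNIV. jac k b z * src.N b a z)) =
      (\<Sum>e\<in>UNIV. \<Sum>a\<in>UNIV. jac k e z * inv_jac a i z * src.N e a z)"
    unfolding sum_distrib_left by (subst sum.swap) (simp add: mult_ac)
  finally show ?thesis
    unfolding second_derivatives_inverse[OF z] by (simp add: sum_distrib_left)
qed

end

section \<open>Charts of the tangent bundle\<close>

locale manifold_atlas =
  fixes X :: "'a topology" and \<A> :: "('a, 'n::finite) chart set"
  assumes manifold: "smooth_manifold X \<A>"
begin

lemma chart:
  assumes "c \<in> \<A>"
  shows chart_openin: "openin X (fst c)" and chart_subset: "fst c \<subseteq> topspace X"
    and chart_inj: "inj_on (snd c) (fst c)"
proof -
  have c: "openin X (fst c)" "homeomorphic_map (subtopology X (fst c)) (top_of_set (snd c ` fst c)) (snd c)"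
    using manifold assms unfolding smooth_manifold_def by blast+
  show "openin X (fst c)" by (rule c(1))
  show "fst c \<subseteq> topspace X" using openin_subset[OF c(1)] .
  then have "topspace (subtopology X (fst c)) = fst c" by (simp add: topspace_subtopology Int_absorb1)
  then show "inj_on (snd c) (fst c)" using homeomorphic_imp_injective_map[OF c(2)] by simp
qed

lemma open_chart_image:
  assumes "c \<in> \<A>" "openin X S" "S \<subseteq> fst c"
  shows "open (snd c ` S)"
proof -
  have c: "open (snd c ` fst c)" "homeomorphic_map (subtopology X (fst c)) (top_of_set (snd c ` fst c)) (snd c)"
    using manifold assms(1) unfolding smooth_manifold_def by blast+
  have "openin (subtopology X (fst c)) S" using assms(2,3) by (auto simp: openin_subtopology)
  then have "openin (top_of_set (snd c ` fst c)) (snd c ` S)"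
    using homeomorphic_imp_open_map[OF c(2)] by (simp add: open_map_def)
  then show ?thesis using c(1) openin_open_trans by blast
qed

definition overlap :: "('a, 'n) chart \<Rightarrow> ('a, 'n) chart \<Rightarrow> (real^'n) set" where
  "overlap c d = snd c ` (fst c \<inter> fst d)"

lemma open_overlap: "c \<in> \<A> \<Longrightarrow> d \<in> \<A> \<Longrightarrow> open (overlap c d)"
  unfolding overlap_def by (rule open_chart_image[OF _ openin_Int[OF chart_openin chart_openin]]) simp_all

lemma smooth_transition: "c \<in> \<A> \<Longrightarrow> d \<in> \<A> \<Longrightarrow> smooth_on (overlap c d) (transition c d)"
  using manifold by (simp add: smooth_manifold_def overlap_def)

lemma transition_apply: "c \<in> \<A> \<Longrightarrow> q \<in> fst c \<Longrightarrow> transition c d (snd c q) = snd d q"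
  unfolding transition_def using inv_into_f_f[OF chart_inj] by simp

lemma transition_overlap: "c \<in> \<A> \<Longrightarrow> x \<in> overlap c d \<Longrightarrow> transition c d x \<in> overlap d c"
  by (auto simp: overlap_def transition_apply)

lemma transition_inverse:
  "c \<in> \<A> \<Longrightarrow> d \<in> \<A> \<Longrightarrow> x \<in> overlap c d \<Longrightarrow> transition d c (transition c d x) = x"
  by (auto simp: overlap_def transition_apply)

lemma tangent_vector:
  assumes "w \<in> tangent_bundle X \<A>"
  shows tangent_vector_change: "\<lbrakk>c \<in> \<A>; d \<in> \<A>; fst w \<in> fst c; fst w \<in> fst d\<rbrakk> \<Longrightarrow>
      snd w d = frechet_derivative (transition c d) (at (snd c (fst w))) (snd w c)"
    and tangent_vector_outside: "d \<notin> \<A> \<or> fst w \<notin> fst d \<Longrightarrow> snd w d = 0"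
proof -
  have "snd w \<in> tangent_space \<A> (fst w)" using assms by (cases w) (simp add: tangent_bundle_def)
  then have *: "\<forall>c\<in>\<A>. \<forall>d\<in>\<A>. fst w \<in> fst c \<inter> fst d \<longrightarrow>
      snd w d = frechet_derivative (transition c d) (at (snd c (fst w))) (snd w c)"
    "\<forall>c. c \<notin> \<A> \<or> fst w \<notin> fst c \<longrightarrow> snd w c = 0"
    unfolding tangent_space_def by (blast dest: CollectD)+
  show "\<lbrakk>c \<in> \<A>; d \<in> \<A>; fst w \<in> fst c; fst w \<in> fst d\<rbrakk> \<Longrightarrow>
      snd w d = frechet_derivative (transition c d) (at (snd c (fst w))) (snd w c)"
    by (rule *(1)[rule_format]) simp_all
  show "d \<notin> \<A> \<or> fst w \<notin> fst d \<Longrightarrow> snd w d = 0" by (rule *(2)[rule_format])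
qed

lemma tchart_change:
  assumes "c \<in> \<A>" "d \<in> \<A>" "w \<in> tangent_bundle X \<A>" "fst w \<in> fst c" "fst w \<in> fst d"
  shows "tchart d w = tangent_map (transition c d) (tchart c w)"
  using assms tangent_vector_change[of w c d] by (simp add: tchart_def tangent_map_def transition_apply)

lemma tchart_inj:
  assumes c: "c \<in> \<A>" and w: "w \<in> tangent_bundle X \<A>" "fst w \<in> fst c"
    and w': "w' \<in> tangent_bundle X \<A>" "fst w' \<in> fst c" and eq: "tchart c w = tchart c w'"
  shows "w = w'"
proof -
  have p: "fst w = fst w'" using eq w(2) w'(2) inj_onD[OF chart_inj[OF c]] by (simp add: tchart_def)
  have "snd w d = snd w' d" for d
  proof (cases "d \<in> \<A> \<and> fst w \<in> fst d")
    case True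
    then have "tchart d w = tchart d w'"
      using tchart_change[OF c _ w] tchart_change[OF c _ w'] p eq by simp
    then show ?thesis by (simp add: tchart_def)
  next
    case False
    then show ?thesis using tangent_vector_outside[OF w(1)] tangent_vector_outside[OF w'(1)] p by metis
  qed
  then show ?thesis using p by (auto simp: prod_eq_iff)
qed

text \<open>Push \<open>y\<close> forward to every other chart by the Jacobian of the transition map. The chain rule makes the resulting family
consistent.\<close>

lemma tchart_lift:
  assumes c: "c \<in> \<A>" and x: "x \<in> snd c ` fst c"
  obtains w where "w \<in> tangent_bundle X \<A>" "fst w \<in> fst c" "tchart c w = (x, y)"
proof -
  obtain q where q: "q \<in> fst c" "x = snd c q" using x by blast
  define v where "v d = (if d \<in> \<A> \<and> q \<in> fst d then dd y (transition c d) x else 0)" for d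
  have diff: "transition c d differentiable (at x)" if "d \<in> \<A>" "q \<in> fst d" for d
    using smooth_on_differentiable[OF smooth_transition[OF c that(1)]] q that by (auto simp: overlap_def)
  have "v e = frechet_derivative (transition d e) (at (snd d q)) (v d)"
    if d: "d \<in> \<A>" "q \<in> fst d" and e: "e \<in> \<A>" "q \<in> fst e" for d e
  proof -
    let ?S = "snd c ` (fst c \<inter> fst d \<inter> fst e)"
    have "dd y (\<lambda>x. transition d e (transition c d x)) x = dd y (transition c e) x"
    proof (rule dd_cong)
      show "open ?S" using c d(1) e(1)
        by (intro open_chart_image openin_Int chart_openin) auto
      show "x \<in> ?S" using q d e by blast
      show "transition d e (transition c d w) = transition c e w" if "w \<in> ?S" for w
        using that c d by (auto simp: transition_apply)
    qed
    moreover have tx: "transition c d x = snd d q" using c q by (simp add: transition_apply)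
    moreover have "transition d e differentiable (at (transition c d x))"
      using smooth_on_differentiable[OF smooth_transition[OF d(1) e(1)]] d e tx by (auto simp: overlap_def)
    ultimately show ?thesis
      using dd_compose[OF diff[OF d], of "transition d e" y] d e by (simp add: v_def dd_def)
  qed
  then have "v \<in> tangent_space \<A> q"
    unfolding tangent_space_def by (intro CollectI conjI ballI allI impI) (blast, simp add: v_def, blast)
  moreover have "v c = y"
  proof -
    have "dd y (transition c c) x = dd y (\<lambda>x. x) x"
      by (rule dd_cong[OF open_overlap[OF c c]]) (use q c in \<open>auto simp: overlap_def transition_apply\<close>)
    then show ?thesis using c q by (simp add: v_def dd_def)
  qed
  ultimately show ?thesis
    using that[of "(q, v)"] q chart_subset[OF c] by (auto simp: tangent_bundle_def tchart_def)
qed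

lemma local_rep_tchart:
  assumes "c \<in> \<A>" "w \<in> tangent_bundle X \<A>" "fst w \<in> fst c"
  shows "local_rep X \<A> c f (tchart c w) = f w"
proof -
  have "inj_on (tchart c) {w \<in> tangent_bundle X \<A>. fst w \<in> fst c}"
    using tchart_inj[OF assms(1)] by (auto intro!: inj_onI)
  then show ?thesis using assms by (simp add: local_rep_def inv_into_f_f)
qed

lemma zero_section:
  assumes c: "c \<in> \<A>" and w: "w \<in> tangent_bundle X \<A>" "fst w \<in> fst c"
  shows "snd w = (\<lambda>_. 0) \<longleftrightarrow> snd w c = 0"
proof
  assume 0: "snd w c = 0"
  have "snd w d = 0" for d
  proof (cases "d \<in> \<A> \<and> fst w \<in> fst d")
    case True
    then have "snd w d = dd 0 (transition c d) (snd c (fst w))"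
      using tangent_vector_change[OF w(1) c, of d] w(2) 0 by (simp add: dd_def)
    moreover have "transition c d differentiable (at (snd c (fst w)))"
      using smooth_on_differentiable[OF smooth_transition[OF c, of d]] True w by (auto simp: overlap_def)
    ultimately show ?thesis
      using linear_0[OF has_derivative_linear[OF has_derivative_dd]] by metis
  qed (use tangent_vector_outside[OF w(1)] in blast)
  then show "snd w = (\<lambda>_. 0)" by auto
qed simp

lemma topspace_tangent: "topspace (tangent_topology X \<A>) = tangent_bundle X \<A>"
proof -
  have "w \<in> \<Union> {{w \<in> tangent_bundle X \<A>. fst w \<in> fst c \<and> tchart c w \<in> W} |c W. c \<in> \<A> \<and> open W}"
    if w: "w \<in> tangent_bundle X \<A>" for w
  proof -
    have "fst w \<in> topspace X" using w by (auto simp: tangent_bundle_def)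
    moreover have "(\<Union>c\<in>\<A>. fst c) = topspace X" using manifold by (simp add: smooth_manifold_def)
    ultimately obtain c where "c \<in> \<A>" "fst w \<in> fst c" by blast
    then show ?thesis using w open_UNIV by blast
  qed
  then show ?thesis unfolding tangent_topology_def topology_generated_by_topspace by blast
qed

lemma topspace_slit: "topspace (slit_topology X \<A>) = tangent_bundle X \<A> - {w. snd w = (\<lambda>_. 0)}"
  unfolding slit_topology_def by (auto simp: topspace_tangent)

lemma slit_openin_subset: "openin (slit_topology X \<A>) B \<Longrightarrow> B \<subseteq> tangent_bundle X \<A>"
  using openin_subset topspace_slit by fastforce

lemma continuous_tangent_map:
  assumes "c \<in> \<A>" "d \<in> \<A>"
  shows "continuous_on (overlap c d \<times> UNIV) (tangent_map (transition c d))"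
proof -
  interpret tangent_chart_change "overlap c d \<times> UNIV" UNIV "overlap c d" "transition c d"
    using assms by unfold_locales (auto intro: open_Times open_overlap smooth_transition)
  show ?thesis by (rule smooth_on_continuous[OF smooth_\<Phi>])
qed

text \<open>The topology is generated by the sets described in some chart. In the coordinates of another chart \<open>c\<close> such a set is the
preimage of an open set under the continuous change of coordinates, so openness can be tested in \<open>c\<close>.\<close>

lemma tangent_openin_chart_nbhd:
  assumes S: "openin (tangent_topology X \<A>) S" and c: "c \<in> \<A>" and w: "w \<in> S" "fst w \<in> fst c"
  shows "\<exists>W. open W \<and> tchart c w \<in> W \<and>
    (\<forall>w'\<in>tangent_bundle X \<A>. fst w' \<in> fst c \<and> tchart c w' \<in> W \<longrightarrow> w' \<in> S)"
  using S w(1) unfolding tangent_topology_def openin_topology_generated_by_iff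
proof (induction rule: generate_topology_on.induct)
  case Empty
  then show ?case by simp
next
  case (Int S T)
  then obtain W1 W2 where "open W1 \<and> tchart c w \<in> W1 \<and>
      (\<forall>w'\<in>tangent_bundle X \<A>. fst w' \<in> fst c \<and> tchart c w' \<in> W1 \<longrightarrow> w' \<in> S)"
    "open W2 \<and> tchart c w \<in> W2 \<and>
      (\<forall>w'\<in>tangent_bundle X \<A>. fst w' \<in> fst c \<and> tchart c w' \<in> W2 \<longrightarrow> w' \<in> T)" by blast
  then show ?case by (intro exI[of _ "W1 \<inter> W2"]) auto
next
  case (UN K)
  then obtain k where "k \<in> K" "w \<in> k" by blast
  with UN.IH[OF this] show ?case by blast
next
  case (Basis S)
  then obtain d W where d: "d \<in> \<A>" "open W"
    "S = {w \<in> tangent_bundle X \<A>. fst w \<in> fst d \<and> tchart d w \<in> W}" by blast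
  let ?O = "overlap c d \<times> (UNIV :: (real^'n) set)" and ?f = "tangent_map (transition c d)"
  have open': "open (?O \<inter> ?f -` W)"
    using continuous_open_preimage[OF continuous_tangent_map[OF c d(1)] _ d(2)]
      open_Times[OF open_overlap[OF c d(1)] open_UNIV] by blast
  have over: "tchart c w' \<in> ?O \<longleftrightarrow> fst w' \<in> fst d" if "fst w' \<in> fst c" for w'
    using that inj_onD[OF chart_inj[OF c]] by (auto simp: overlap_def tchart_def)
  have iff: "tchart c w' \<in> ?O \<inter> ?f -` W \<longleftrightarrow> w' \<in> S" if "w' \<in> tangent_bundle X \<A>" "fst w' \<in> fst c" for w'
    using over[OF that(2)] that d(3) tchart_change[OF c d(1) that] by auto
  have "w \<in> tangent_bundle X \<A>" using Basis.prems d(3) by simp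
  then have "tchart c w \<in> ?O \<inter> ?f -` W" using iff w(2) Basis.prems by simp
  then show ?case using open' iff[THEN iffD1] by (intro exI[of _ "?O \<inter> ?f -` W"] conjI ballI impI) auto
qed

lemma slit_openin_chart_nbhd:
  assumes B: "openin (slit_topology X \<A>) B" and c: "c \<in> \<A>" and w: "w \<in> B" "fst w \<in> fst c"
  obtains W where "open W" "tchart c w \<in> W"
    "\<And>w'. w' \<in> tangent_bundle X \<A> \<Longrightarrow> fst w' \<in> fst c \<Longrightarrow> tchart c w' \<in> W \<Longrightarrow> w' \<in> B"
proof -
  obtain T where T: "openin (tangent_topology X \<A>) T" "B = T \<inter> (tangent_bundle X \<A> - {w. snd w = (\<lambda>_. 0)})"
    using B unfolding slit_topology_def openin_subtopology by blast
  obtain W where W: "open W" "tchart c w \<in> W"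
    "\<forall>w'\<in>tangent_bundle X \<A>. fst w' \<in> fst c \<and> tchart c w' \<in> W \<longrightarrow> w' \<in> T"
    using tangent_openin_chart_nbhd[OF T(1) c _ w(2)] w(1) T(2) by blast
  have "w \<in> tangent_bundle X \<A>" "snd w \<noteq> (\<lambda>_. 0)" using w(1) T(2) by auto
  then have "snd w c \<noteq> 0" using zero_section[OF c _ w(2)] by simp
  show ?thesis
  proof (rule that[of "W \<inter> UNIV \<times> (- {0})"])
    show "open (W \<inter> UNIV \<times> (- {0}))" using W(1) by (intro open_Int open_Times) auto
    show "tchart c w \<in> W \<inter> UNIV \<times> (- {0})" using W(2) \<open>snd w c \<noteq> 0\<close> by (simp add: tchart_def)
    show "w' \<in> B" if "w' \<in> tangent_bundle X \<A>" "fst w' \<in> fst c" "tchart c w' \<in> W \<inter> UNIV \<times> (- {0})" for w'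
      using that W(3) zero_section[OF c that(1,2)] unfolding T(2) by (auto simp: tchart_def)
  qed
qed

lemma open_coords:
  assumes B: "openin (slit_topology X \<A>) B" and c: "c \<in> \<A>"
  shows "open (coords c B)"
proof (subst open_subopen, intro ballI)
  fix z assume "z \<in> coords c B"
  then obtain w where w: "w \<in> B" "fst w \<in> fst c" "z = tchart c w" by (auto simp: coords_def)
  obtain W where W: "open W" "tchart c w \<in> W"
    "\<And>w'. w' \<in> tangent_bundle X \<A> \<Longrightarrow> fst w' \<in> fst c \<Longrightarrow> tchart c w' \<in> W \<Longrightarrow> w' \<in> B"
    using slit_openin_chart_nbhd[OF B c w(1,2)] by blast
  let ?T = "W \<inter> (snd c ` fst c) \<times> UNIV"
  have "open ?T"
    by (intro open_Int W(1) open_Times open_chart_image[OF c chart_openin[OF c]]) auto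
  moreover have "z \<in> ?T" using W(2) w by (auto simp: tchart_def)
  moreover have "?T \<subseteq> coords c B"
  proof
    fix z' assume z': "z' \<in> ?T"
    then have "fst z' \<in> snd c ` fst c" by (simp add: mem_Times_iff)
    then obtain w' where w': "w' \<in> tangent_bundle X \<A>" "fst w' \<in> fst c" "tchart c w' = (fst z', snd z')"
      using tchart_lift[OF c] by blast
    then have "w' \<in> B" using W(3)[OF w'(1,2)] z' by simp
    then show "z' \<in> coords c B" using w' unfolding coords_def by force
  qed
  ultimately show "\<exists>T. open T \<and> z \<in> T \<and> T \<subseteq> coords c B" by blast
qed

lemma slit_closure_coords:
  assumes B: "openin (slit_topology X \<A>) A" and c: "c \<in> \<A>"
    and y: "y \<in> closure {y. (x, y) \<in> coords c A}" "y \<noteq> 0"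
  obtains w where "w \<in> slit_topology X \<A> closure_of A" "fst w \<in> fst c" "tchart c w = (x, y)"
proof -
  have "{y. (x, y) \<in> coords c A} \<noteq> {}" using y(1) by (metis closure_empty empty_iff)
  then have "x \<in> snd c ` fst c" by (auto simp: coords_def tchart_def)
  then obtain w where w: "w \<in> tangent_bundle X \<A>" "fst w \<in> fst c" "tchart c w = (x, y)"
    using tchart_lift[OF c] by blast
  have "w \<in> topspace (slit_topology X \<A>)"
    using w y(2) zero_section[OF c w(1,2)] by (simp add: topspace_slit tchart_def)
  moreover have "\<exists>w'. w' \<in> A \<and> w' \<in> T" if T: "w \<in> T" "openin (slit_topology X \<A>) T" for T
  proof -
    obtain W where W: "open W" "tchart c w \<in> W"
      "\<And>w'. w' \<in> tangent_bundle X \<A> \<Longrightarrow> fst w' \<in> fst c \<Longrightarrow> tchart c w' \<in> W \<Longrightarrow> w' \<in> T"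
      using slit_openin_chart_nbhd[OF T(2) c T(1) w(2)] by blast
    have "open (Pair x -` W)" using W(1) by (intro open_vimage) (auto intro!: continuous_intros)
    moreover have "y \<in> Pair x -` W" using W(2) w(3) by simp
    ultimately obtain y' where "(x, y') \<in> W" "(x, y') \<in> coords c A"
      using y(1) by (auto simp: closure_iff_nhds_not_empty)
    then obtain w' where "w' \<in> A" "fst w' \<in> fst c" "tchart c w' \<in> W" by (force simp: coords_def)
    then show ?thesis using W(3) slit_openin_subset[OF B] by blast
  qed
  ultimately show ?thesis using that[of w] w by (auto simp: in_closure_of)
qed

end

lemma (in open_domain)
  assumes eq: "\<And>w. w \<in> U \<Longrightarrow> L' w = L w" and z: "z \<in> U"
  shows fundamental_tensor_local: "fundamental_tensor L' i j z = fundamental_tensor L i j z"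
    and NL_local: "NL L' k i z = NL L k i z"
proof -
  have dy: "dy i L' w = dy i L w" if "w \<in> U" for i w
    unfolding dy_dd by (rule dd_eq_on[OF that eq])
  have ft: "fundamental_tensor L' i j w = fundamental_tensor L i j w" if "w \<in> U" for i j w
    unfolding fundamental_tensor_def dy_dd using dd_eq_on[OF that dy[unfolded dy_dd]] by simp
  then show "fundamental_tensor L' i j z = fundamental_tensor L i j z" using z .
  have h: "g_inv L' i j w = g_inv L i j w" if "w \<in> U" for i j w
    unfolding g_inv_def g_matrix_def by (simp add: ft[OF that])
  have dx: "dx c (fundamental_tensor L' i j) w = dx c (fundamental_tensor L i j) w" if "w \<in> U" for c i j w
    unfolding dx_dd by (rule dd_eq_on[OF that ft])
  show "NL L' k i z = NL L k i z"
    unfolding NL_def dy_dd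
    by (rule dd_eq_on[OF z]) (simp add: spray_def h dx)
qed

context manifold_atlas
begin

lemma coords_transition:
  assumes c: "c \<in> \<A>" and d: "d \<in> \<A>" and A: "openin (slit_topology X \<A>) A"
  shows "tangent_chart_iso (coords c {w \<in> A. fst w \<in> fst d}) (coords d A)
    (overlap c d) (transition c d) (overlap d c) (transition d c)"
    and "w \<in> A \<Longrightarrow> fst w \<in> fst c \<Longrightarrow> fst w \<in> fst d \<Longrightarrow> tchart c w \<in> coords c {w \<in> A. fst w \<in> fst d}"
    and "z \<in> coords c {w \<in> A. fst w \<in> fst d} \<Longrightarrow>
      local_rep X \<A> c f z = local_rep X \<A> d f (tangent_map (transition c d) z)"
proof -
  have A_sub: "A \<subseteq> tangent_bundle X \<A>" by (rule slit_openin_subset[OF A])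
  let ?U = "coords c {w \<in> A. fst w \<in> fst d}"
  have U: "?U = coords c A \<inter> overlap c d \<times> UNIV"
  proof -
    have "z \<in> ?U \<longleftrightarrow> z \<in> coords c A \<and> fst z \<in> overlap c d" for z
    proof
      assume "z \<in> coords c A \<and> fst z \<in> overlap c d"
      then obtain w q where w: "w \<in> A" "fst w \<in> fst c" "z = tchart c w" "q \<in> fst c" "q \<in> fst d" "fst z = snd c q"
        unfolding coords_def overlap_def by blast
      then have "fst w = q" using inj_onD[OF chart_inj[OF c]] by (simp add: tchart_def)
      then show "z \<in> ?U" using w unfolding coords_def by blast
    next
      assume "z \<in> ?U"
      then obtain w where "w \<in> A" "fst w \<in> fst d" "fst w \<in> fst c" "z = tchart c w" unfolding coords_def by blast
      then show "z \<in> coords c A \<and> fst z \<in> overlap c d" unfolding coords_def overlap_def by (auto simp: tchart_def)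
    qed
    then show ?thesis by (auto simp: mem_Times_iff)
  qed
  have elim: "\<exists>w\<in>A. fst w \<in> fst c \<and> fst w \<in> fst d \<and> z = tchart c w \<and> tangent_map (transition c d) z = tchart d w"
    if z: "z \<in> ?U" for z
  proof -
    obtain w where w: "w \<in> A" "fst w \<in> fst d" "fst w \<in> fst c" "z = tchart c w" using z unfolding coords_def by blast
    moreover have "tchart d w = tangent_map (transition c d) (tchart c w)"
      using tchart_change[OF c d] w A_sub by blast
    ultimately show ?thesis by auto
  qed
  show "tangent_chart_iso ?U (coords d A) (overlap c d) (transition c d) (overlap d c) (transition d c)"
  proof unfold_locales
    show "open ?U" unfolding U by (intro open_Int open_coords[OF A c] open_Times open_overlap c d open_UNIV)
    show "open (coords d A)" by (rule open_coords[OF A d])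
    show "open (overlap c d)" "open (overlap d c)" using c d by (simp_all add: open_overlap)
    show "smooth_on (overlap c d) (transition c d)" "smooth_on (overlap d c) (transition d c)"
      using c d by (simp_all add: smooth_transition)
    show "fst z \<in> overlap c d" if "z \<in> ?U" for z using that unfolding U by (simp add: mem_Times_iff)
    show "tangent_map (transition c d) z \<in> coords d A" if "z \<in> ?U" for z
      using elim[OF that] unfolding coords_def by blast
  qed (use c d in \<open>simp_all add: transition_overlap transition_inverse\<close>)
  show "w \<in> A \<Longrightarrow> fst w \<in> fst c \<Longrightarrow> fst w \<in> fst d \<Longrightarrow> tchart c w \<in> ?U"
    unfolding coords_def by blast
  show "local_rep X \<A> c f z = local_rep X \<A> d f (tangent_map (transition c d) z)" if z: "z \<in> ?U"
  proof -
    obtain w where w: "w \<in> A" "fst w \<in> fst c" "fst w \<in> fst d" "z = tchart c w"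
      "tangent_map (transition c d) z = tchart d w" using elim[OF z] by blast
    then have "w \<in> tangent_bundle X \<A>" using A_sub by blast
    then show ?thesis using w(2,3) local_rep_tchart[OF c, of w f] local_rep_tchart[OF d, of w f] unfolding w(5) unfolding w(4) by simp
  qed
qed

lemma coords_mono: "S \<subseteq> T \<Longrightarrow> coords c S \<subseteq> coords c T"
  unfolding coords_def by blast

lemma openin_slit_chart_part:
  assumes B: "openin (slit_topology X \<A>) B" and c: "c \<in> \<A>" and W: "open W"
  shows "openin (slit_topology X \<A>) {w \<in> B. fst w \<in> fst c \<and> tchart c w \<in> W}"
proof -
  have "openin (tangent_topology X \<A>) {w \<in> tangent_bundle X \<A>. fst w \<in> fst c \<and> tchart c w \<in> W}"
    unfolding tangent_topology_def using c W by (intro topology_generated_by_Basis) blast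
  moreover obtain T where T: "openin (tangent_topology X \<A>) T" "B = T \<inter> (tangent_bundle X \<A> - {w. snd w = (\<lambda>_. 0)})"
    using B unfolding slit_topology_def openin_subtopology by blast
  moreover have "{w \<in> B. fst w \<in> fst c \<and> tchart c w \<in> W} =
      (T \<inter> {w \<in> tangent_bundle X \<A>. fst w \<in> fst c \<and> tchart c w \<in> W}) \<inter> (tangent_bundle X \<A> - {w. snd w = (\<lambda>_. 0)})"
    using T(2) by auto
  ultimately show ?thesis
    unfolding slit_topology_def openin_subtopology using openin_Int by blast
qed

text \<open>Nondegeneracy of \<open>g\<close> does not depend on the chart. The set is therefore a union of sets described in a single chart
each, although its definition is an intersection over all charts.\<close>

lemma openin_nondegenerate:
  fixes f :: "'a \<times> ('a, 'n) tvec \<Rightarrow> real"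
  assumes B: "openin (slit_topology X \<A>) B"
    and f: "\<And>c. c \<in> \<A> \<Longrightarrow> smooth_on (coords c B) (local_rep X \<A> c f)"
  defines "B' \<equiv> {w \<in> B. \<forall>c\<in>\<A>. fst w \<in> fst c \<longrightarrow> invertible (g_matrix (local_rep X \<A> c f) (tchart c w))}"
  shows "openin (slit_topology X \<A>) B'"
    and "c \<in> \<A> \<Longrightarrow> pseudo_finsler_domain (coords c B') (local_rep X \<A> c f)"
proof -
  let ?G = "\<lambda>c. g_matrix (local_rep X \<A> c f)"
  let ?W = "\<lambda>c. {z \<in> coords c B. det (?G c z) \<noteq> 0}"
  have B_sub: "B \<subseteq> tangent_bundle X \<A>" by (rule slit_openin_subset[OF B])
  have W: "open (?W c)" if c: "c \<in> \<A>" for c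
  proof -
    have s: "smooth_on (coords c B) (\<lambda>z. det (?G c z))"
    proof (rule smooth_on_det[OF open_coords[OF B c]])
      fix i j
      interpret open_domain "coords c B" by unfold_locales (rule open_coords[OF B c])
      show "smooth_on (coords c B) (\<lambda>z. ?G c z $ i $ j)"
        unfolding g_matrix_def fundamental_tensor_def dy_dd
        by (simp only: vec_lambda_beta) (intro smooth_rules f[OF c])
    qed
    have "open (coords c B \<inter> (\<lambda>z. det (?G c z)) -` (- {0}))"
      by (rule continuous_open_preimage[OF smooth_on_continuous[OF s] open_coords[OF B c]]) (rule open_Compl, simp)
    moreover have "?W c = coords c B \<inter> (\<lambda>z. det (?G c z)) -` (- {0})" by auto
    ultimately show ?thesis by simp
  qed
  have B'_eq: "B' = (\<Union>c\<in>\<A>. {w \<in> B. fst w \<in> fst c \<and> tchart c w \<in> ?W c})"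
  proof
    show "B' \<subseteq> (\<Union>c\<in>\<A>. {w \<in> B. fst w \<in> fst c \<and> tchart c w \<in> ?W c})"
    proof
      fix w assume w: "w \<in> B'"
      then have "w \<in> B" by (simp add: B'_def)
      then have "fst w \<in> topspace X" using B_sub by (auto simp: tangent_bundle_def)
      moreover have "(\<Union>c\<in>\<A>. fst c) = topspace X" using manifold by (simp add: smooth_manifold_def)
      ultimately obtain c where c: "c \<in> \<A>" "fst w \<in> fst c" by blast
      then have "tchart c w \<in> ?W c" using w by (auto simp: B'_def coords_def invertible_det_nz)
      then show "w \<in> (\<Union>c\<in>\<A>. {w \<in> B. fst w \<in> fst c \<and> tchart c w \<in> ?W c})" using c \<open>w \<in> B\<close> by blast
    qed
    show "(\<Union>c\<in>\<A>. {w \<in> B. fst w \<in> fst c \<and> tchart c w \<in> ?W c}) \<subseteq> B'"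
    proof
      fix w assume "w \<in> (\<Union>c\<in>\<A>. {w \<in> B. fst w \<in> fst c \<and> tchart c w \<in> ?W c})"
      then obtain d where d: "d \<in> \<A>" "w \<in> B" "fst w \<in> fst d" "invertible (?G d (tchart d w))"
        by (auto simp: invertible_det_nz)
      have "invertible (?G c (tchart c w))" if c: "c \<in> \<A>" "fst w \<in> fst c" for c
      proof -
        interpret tangent_chart_iso "coords c {w \<in> B. fst w \<in> fst d}" "coords d B"
            "overlap c d" "transition c d" "overlap d c" "transition d c"
          by (rule coords_transition(1)[OF c(1) d(1) B])
        have "tangent_map (transition c d) (tchart c w) = tchart d w"
          using tchart_change[OF c(1) d(1) subsetD[OF B_sub d(2)] c(2) d(3)] by simp
        then show ?thesis
          using invertible_change[OF coords_transition(2)[OF c(1) d(1) B d(2) c(2) d(3)] f[OF d(1)]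
              coords_transition(3)[OF c(1) d(1) B]] d(4) by simp
      qed
      then show "w \<in> B'" using d(2) by (simp add: B'_def)
    qed
  qed
  show openB': "openin (slit_topology X \<A>) B'"
    unfolding B'_eq using openin_slit_chart_part[OF B _ W] by (intro openin_Union) blast
  assume c: "c \<in> \<A>"
  show "pseudo_finsler_domain (coords c B') (local_rep X \<A> c f)"
  proof unfold_locales
    show "open (coords c B')" by (rule open_coords[OF openB' c])
    show "smooth_on (coords c B') (local_rep X \<A> c f)"
      by (rule smooth_on_subset[OF f[OF c] coords_mono]) (auto simp: B'_def)
    show "invertible (?G c z)" if "z \<in> coords c B'" for z
      using that c by (auto simp: coords_def B'_def)
  qed
qed

end

section \<open>Existence and uniqueness\<close>

locale lorentz_finsler_manifold = manifold_atlas X \<A>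
  for X :: "'a topology" and \<A> :: "('a, 'n::finite) chart set" +
  fixes A :: "('a \<times> ('a, 'n) tvec) set" and L :: "'a \<times> ('a, 'n) tvec \<Rightarrow> real"
  assumes dim3: "CARD('n) \<ge> 3"
    and conic_dom: "conic_domain X \<A> A"
    and finsler: "lorentz_finsler X \<A> A L"
    and mean_cartan: "vanishing_mean_cartan X \<A> A L"
begin

abbreviation Lc :: "('a, 'n) chart \<Rightarrow> (real^'n) \<times> (real^'n) \<Rightarrow> real" where
  "Lc c \<equiv> local_rep X \<A> c L"

lemma openin_A: "openin (slit_topology X \<A>) A"
  using conic_dom by (simp add: conic_domain_def)

lemma A_subset: "A \<subseteq> tangent_bundle X \<A>"
  by (rule slit_openin_subset[OF openin_A])

lemma proper: "proper_metric X \<A> A L" and pseudo: "pseudo_finsler X \<A> A L"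
  using finsler by (simp_all add: lorentz_finsler_def proper_metric_def)

lemma coords_A_slit:
  assumes "c \<in> \<A>" "z \<in> coords c A"
  shows "snd z \<noteq> 0"
proof -
  obtain w where w: "w \<in> A" "fst w \<in> fst c" "z = tchart c w" using assms(2) unfolding coords_def by blast
  then have "w \<in> topspace (slit_topology X \<A>)" using openin_subset[OF openin_A] by blast
  then show ?thesis using zero_section[OF assms(1) _ w(2)] w(3) by (simp add: topspace_slit tchart_def)
qed

lemma homogeneous_chart:
  assumes c: "c \<in> \<A>"
  shows "homogeneous_pseudo_finsler_domain (coords c A) (Lc c)"
proof -
  have scale: "\<exists>p v. (p, v) \<in> A \<and> p \<in> fst c \<and> (x, y) = tchart c (p, v) \<and>
      (p, \<lambda>c. t *\<^sub>R v c) \<in> A \<and> (x, t *\<^sub>R y) = tchart c (p, \<lambda>c. t *\<^sub>R v c)"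
    if xy: "(x, y) \<in> coords c A" and t: "t > 0" for x y t
  proof -
    obtain w where "w \<in> A" "fst w \<in> fst c" "(x, y) = tchart c w" using xy unfolding coords_def by blast
    then obtain p v where w: "(p, v) \<in> A" "p \<in> fst c" "(x, y) = tchart c (p, v)" by (cases w) simp
    moreover have "(p, \<lambda>c. t *\<^sub>R v c) \<in> A"
      using conic_dom w(1) t unfolding conic_domain_def by blast
    moreover have "(x, t *\<^sub>R y) = tchart c (p, \<lambda>c. t *\<^sub>R v c)" using w(3) by (simp add: tchart_def)
    ultimately show ?thesis by blast
  qed
  show ?thesis
  proof unfold_locales
    show "open (coords c A)" by (rule open_coords[OF openin_A c])
    show "(x, t *\<^sub>R y) \<in> coords c A" if "(x, y) \<in> coords c A" "t > 0" for x y t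
      using scale[OF that] by (auto simp: coords_def)
    show "smooth_on (coords c A) (Lc c)" "\<And>z. z \<in> coords c A \<Longrightarrow> invertible (g_matrix (Lc c) z)"
      using pseudo c by (simp_all add: pseudo_finsler_def)
    show "homog 2 (coords c A) (Lc c)"
      unfolding homog_def
    proof (intro allI impI)
      fix x y and t :: real assume t: "0 < t" and xy: "(x, y) \<in> coords c A"
      obtain p v where w: "(p, v) \<in> A" "p \<in> fst c" "(x, y) = tchart c (p, v)"
        "(p, \<lambda>c. t *\<^sub>R v c) \<in> A" "(x, t *\<^sub>R y) = tchart c (p, \<lambda>c. t *\<^sub>R v c)" using scale[OF xy t] by blast
      have "L (p, \<lambda>c. t *\<^sub>R v c) = t\<^sup>2 * L (p, v)"
        using pseudo w(1) t unfolding pseudo_finsler_def by blast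
      moreover have "Lc c (x, t *\<^sub>R y) = L (p, \<lambda>c. t *\<^sub>R v c)"
        unfolding w(5) using w A_subset by (intro local_rep_tchart[OF c]) auto
      moreover have "Lc c (x, y) = L (p, v)"
        unfolding w(3) using w A_subset by (intro local_rep_tchart[OF c]) auto
      ultimately show "Lc c (x, t *\<^sub>R y) = t powr 2 * Lc c (x, y)"
        using t by (simp add: powr_numeral)
    qed
  qed
qed

lemma mean_cartan_chart: "c \<in> \<A> \<Longrightarrow> z \<in> coords c A \<Longrightarrow> mean_cartan (Lc c) i z = 0"
  using mean_cartan by (simp add: vanishing_mean_cartan_def)

lemma canonical_symmetric: "symmetric_connection \<A> A (canonical_connection X \<A> L)"
  unfolding symmetric_connection_def canonical_connection_def
proof (intro ballI allI)
  fix c z and k i j assume c: "c \<in> \<A>" and z: "z \<in> coords c A"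
  interpret homogeneous_pseudo_finsler_domain "coords c A" "Lc c" by (rule homogeneous_chart[OF c])
  show "dy j (NL (Lc c) k i) z = dy i (NL (Lc c) k j) z" by (rule N_sym[OF z])
qed

text \<open>The transformation law is tested at a single vector, after restricting the first chart to the vectors over the second.\<close>

lemma canonical_connection: "homogeneous_nonlinear_connection \<A> A (canonical_connection X \<A> L)"
  unfolding homogeneous_nonlinear_connection_def smooth_homogeneous_components_def canonical_connection_def
proof (intro conjI ballI allI impI)
  fix c k i assume c: "c \<in> \<A>"
  interpret homogeneous_pseudo_finsler_domain "coords c A" "Lc c" by (rule homogeneous_chart[OF c])
  show "smooth_on (coords c A) (NL (Lc c) k i)" by (rule smooth_N)
  show "NL (Lc c) k i (x, t *\<^sub>R y) = t powr 1 * NL (Lc c) k i (x, y)"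
    if "0 < t" "(x, y) \<in> coords c A" for x y and t :: real
    using homog_N that unfolding homog_def by blast
next
  fix c d w k i
  assume c: "c \<in> \<A>" and d: "d \<in> \<A>" and w: "w \<in> A" and over: "fst w \<in> fst c \<inter> fst d"
  let ?U = "coords c {w \<in> A. fst w \<in> fst d}"
  note iso = coords_transition[OF c d openin_A]
  have zU: "tchart c w \<in> ?U" using iso(2) w over by blast
  interpret iso: tangent_chart_iso ?U "coords d A" "overlap c d" "transition c d" "overlap d c" "transition d c"
    by (rule iso(1))
  interpret C: homogeneous_pseudo_finsler_domain "coords c A" "Lc c" by (rule homogeneous_chart[OF c])
  interpret D: homogeneous_pseudo_finsler_domain "coords d A" "Lc d" by (rule homogeneous_chart[OF d])
  have sub: "?U \<subseteq> coords c A" by (rule coords_mono) blast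
  interpret finsler_chart_change ?U "coords d A" "Lc c" "Lc d" "overlap c d" "transition c d" "overlap d c" "transition d c"
  proof unfold_locales
    show "(x, t *\<^sub>R y) \<in> ?U" if xy: "(x, y) \<in> ?U" and t: "t > 0" for x y t
    proof -
      obtain w where w: "w \<in> A" "fst w \<in> fst d" "fst w \<in> fst c" "(x, y) = tchart c w" using xy unfolding coords_def by blast
      then have "(fst w, \<lambda>c. t *\<^sub>R snd w c) \<in> A"
        using conic_dom t unfolding conic_domain_def by (metis prod.collapse)
      moreover have "(x, t *\<^sub>R y) = tchart c (fst w, \<lambda>c. t *\<^sub>R snd w c)" using w by (simp add: tchart_def)
      ultimately show ?thesis using w unfolding coords_def by force
    qed
    show "smooth_on ?U (Lc c)" by (rule smooth_on_subset[OF C.smooth_L sub])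
    show "invertible (g_matrix (Lc c) z)" if "z \<in> ?U" for z using C.nondegenerate that sub by blast
    show "homog 2 ?U (Lc c)" using C.homog_L sub unfolding homog_def by blast
    show "Lc c z = Lc d (tangent_map (transition c d) z)" if "z \<in> ?U" for z by (rule iso(3)[OF that])
  qed
  have td: "tangent_map (transition c d) (tchart c w) = tchart d w"
    using tchart_change[OF c d subsetD[OF A_subset w]] over by simp
  have "transition c d (snd c (fst w)) = snd d (fst w)" using transition_apply[OF c] over by simp
  then show "NL (Lc d) k i (tchart d w) =
    (\<Sum>e\<in>UNIV. \<Sum>b\<in>UNIV. pd e (transition c d) (snd c (fst w)) $ k *
       pd i (pd b (transition d c)) (snd d (fst w)) $ e * snd w d $ b) +
    (\<Sum>e\<in>UNIV. \<Sum>a\<in>UNIV. pd e (transition c d) (snd c (fst w)) $ k *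
       pd i (transition d c) (snd d (fst w)) $ a * NL (Lc c) e a (tchart c w))"
    using N_change[OF zU, of k i] unfolding td iso.jac_def iso.inv_jac_def by (simp add: tchart_def)
qed

text \<open>For \<open>J = 0\<close> only the mean Landsberg tensor remains in the affine equation, and it vanishes.\<close>

lemma canonical_affine_solution: "affine_solution X \<A> A L (canonical_connection X \<A> L)"
  unfolding affine_solution_def
proof (intro conjI canonical_connection exI[of _ "\<lambda>_ _ _ _. 0"] ballI allI)
  show "homogeneous_tensor_1_1 1 \<A> A (\<lambda>_ _ _ _. 0)"
    by (simp add: homogeneous_tensor_1_1_def smooth_homogeneous_components_def smooth_on_const)
  fix c z assume c: "c \<in> \<A>" and z: "z \<in> coords c A"
  interpret homogeneous_pseudo_finsler_domain "coords c A" "Lc c" by (rule homogeneous_chart[OF c])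
  have "mean_landsberg (Lc c) b z = 0" for b
    by (rule mean_landsberg_0[OF z mean_cartan_chart[OF c]])
  then show "affine_equation (Lc c) (\<lambda>_ _ _. 0) z"
    by (simp add: affine_equation_def dy_dd)
qed simp

text \<open>The given extension is cut down to the set where its fundamental tensor is nondegenerate, so that its canonical
connection is smooth there.\<close>

lemma metric_extension:
  obtains B L' where "openin (slit_topology X \<A>) B" "slit_topology X \<A> closure_of A \<subseteq> B"
    "\<And>c. c \<in> \<A> \<Longrightarrow> pseudo_finsler_domain (coords c B) (local_rep X \<A> c L')"
    "\<And>c z. c \<in> \<A> \<Longrightarrow> z \<in> coords c A \<Longrightarrow> local_rep X \<A> c L' z = Lc c z"
    "\<And>w. w \<in> slit_topology X \<A> closure_of A \<Longrightarrow> w \<notin> A \<Longrightarrow> L' w = 0"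
proof -
  obtain B L' where B: "openin (slit_topology X \<A>) B" "slit_topology X \<A> closure_of A \<subseteq> B"
    "\<forall>c\<in>\<A>. smooth_on (coords c B) (local_rep X \<A> c L')" "\<forall>w\<in>A. L' w = L w"
    and bd: "\<forall>w \<in> slit_topology X \<A> closure_of A - A. L' w = 0 \<and>
           (\<forall>c\<in>\<A>. fst w \<in> fst c \<longrightarrow> invertible (g_matrix (local_rep X \<A> c L') (tchart c w)))"
    using proper unfolding proper_metric_def by blast
  define B' where "B' = {w \<in> B. \<forall>c\<in>\<A>. fst w \<in> fst c \<longrightarrow> invertible (g_matrix (local_rep X \<A> c L') (tchart c w))}"
  have eq: "local_rep X \<A> c L' z = Lc c z" if c: "c \<in> \<A>" and z: "z \<in> coords c A" for c z
  proof -
    obtain w where w: "w \<in> A" "fst w \<in> fst c" "z = tchart c w" using z unfolding coords_def by blast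
    then have "w \<in> tangent_bundle X \<A>" using A_subset by blast
    then show ?thesis using w(1,2) B(4) local_rep_tchart[OF c, of w] by (simp add: w(3))
  qed
  have "w \<in> B'" if w: "w \<in> slit_topology X \<A> closure_of A" for w
  proof -
    have "invertible (g_matrix (local_rep X \<A> c L') (tchart c w))" if c: "c \<in> \<A>" "fst w \<in> fst c" for c
    proof (cases "w \<in> A")
      case True
      then have z: "tchart c w \<in> coords c A" using c unfolding coords_def by blast
      interpret homogeneous_pseudo_finsler_domain "coords c A" "Lc c" by (rule homogeneous_chart[OF c(1)])
      have "g_matrix (local_rep X \<A> c L') (tchart c w) = g_matrix (Lc c) (tchart c w)"
        unfolding g_matrix_def by (simp add: fundamental_tensor_local[OF eq[OF c(1)] z])
      then show ?thesis using nondegenerate[OF z] by simp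
    qed (use bd w c in blast)
    then show ?thesis using B(2) w by (auto simp: B'_def)
  qed
  then show ?thesis
    using that[of B' L'] openin_nondegenerate[OF B(1), of L'] B(3) eq bd unfolding B'_def[symmetric] by blast
qed

lemma canonical_extends: "extends_smoothly_to_closure X \<A> A (canonical_connection X \<A> L)"
proof -
  obtain B L' where B: "openin (slit_topology X \<A>) B" "slit_topology X \<A> closure_of A \<subseteq> B"
    "\<And>c. c \<in> \<A> \<Longrightarrow> pseudo_finsler_domain (coords c B) (local_rep X \<A> c L')"
    "\<And>c z. c \<in> \<A> \<Longrightarrow> z \<in> coords c A \<Longrightarrow> local_rep X \<A> c L' z = Lc c z"
    using metric_extension by metis
  show ?thesis
    unfolding extends_smoothly_to_closure_def
  proof (intro exI[of _ B] exI[of _ "canonical_connection X \<A> L'"] conjI ballI allI B(1,2))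
    fix c k i assume c: "c \<in> \<A>"
    show "smooth_on (coords c B) (canonical_connection X \<A> L' c k i)"
      unfolding canonical_connection_def by (rule pseudo_finsler_domain.smooth_N[OF B(3)[OF c]])
    fix z assume z: "z \<in> coords c A"
    interpret homogeneous_pseudo_finsler_domain "coords c A" "Lc c" by (rule homogeneous_chart[OF c])
    show "canonical_connection X \<A> L' c k i z = canonical_connection X \<A> L c k i z"
      unfolding canonical_connection_def by (rule NL_local[OF B(4)[OF c] z])
  qed
qed

text \<open>In a chart, \<open>D\<close> is the trace of the difference of the two connections, and both connections extend smoothly over the
closure of \<open>A\<close>. So \<open>D\<close> is an eigenfunction of the kind excluded above, and \<open>J\<close> vanishes with it.\<close>

lemma canonical_unique:
  assumes sym: "symmetric_connection \<A> A N" and sol: "proper_affine_solution X \<A> A L N"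
    and c: "c \<in> \<A>" and z: "z \<in> coords c A"
  shows "N c k i z = canonical_connection X \<A> L c k i z"
proof -
  obtain J where J: "homogeneous_tensor_1_1 1 \<A> A J"
    and N: "\<And>z k i. z \<in> coords c A \<Longrightarrow> N c k i z = NL (Lc c) k i z + J c k i z"
    and affine: "\<And>z. z \<in> coords c A \<Longrightarrow> affine_equation (Lc c) (J c) z"
    using sol c unfolding proper_affine_solution_def affine_solution_def canonical_connection_def by blast
  obtain B1 N' where B1: "openin (slit_topology X \<A>) B1" "slit_topology X \<A> closure_of A \<subseteq> B1"
    "\<And>k i. smooth_on (coords c B1) (N' c k i)" "\<And>k i z. z \<in> coords c A \<Longrightarrow> N' c k i z = N c k i z"
    using sol c unfolding proper_affine_solution_def extends_smoothly_to_closure_def by metis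
  obtain B2 L' where B2: "openin (slit_topology X \<A>) B2" "slit_topology X \<A> closure_of A \<subseteq> B2"
    "pseudo_finsler_domain (coords c B2) (local_rep X \<A> c L')"
    "\<And>z. z \<in> coords c A \<Longrightarrow> local_rep X \<A> c L' z = Lc c z"
    "\<And>w. w \<in> slit_topology X \<A> closure_of A \<Longrightarrow> w \<notin> A \<Longrightarrow> L' w = 0"
    using metric_extension c by metis
  let ?B = "coords c (B1 \<inter> B2)" and ?L' = "local_rep X \<A> c L'"
  have openB: "open ?B" by (rule open_coords[OF openin_Int[OF B1(1) B2(1)] c])
  have subB: "?B \<subseteq> coords c B1" "?B \<subseteq> coords c B2" by (intro coords_mono, blast)+
  have cl: "A \<subseteq> slit_topology X \<A> closure_of A"
    by (rule closure_of_subset[OF openin_subset[OF openin_A]])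
  interpret P2: pseudo_finsler_domain "coords c B2" ?L' by (rule B2(3))
  interpret homogeneous_pseudo_finsler_domain "coords c A" "Lc c" by (rule homogeneous_chart[OF c])
  interpret lightlike_boundary "coords c A" "Lc c" ?B ?L'
  proof unfold_locales
    show "open ?B" by (rule openB)
    show "smooth_on ?B ?L'" by (rule smooth_on_subset[OF P2.smooth_L subB(2)])
    show "invertible (g_matrix ?L' z)" if "z \<in> ?B" for z using P2.nondegenerate that subB by blast
    show "coords c A \<subseteq> ?B" using cl B1(2) B2(2) by (intro coords_mono) blast
    show "?L' z = Lc c z" if "z \<in> coords c A" for z by (rule B2(4)[OF that])
    show "Lc c z > 0" if z: "z \<in> coords c A" for z
    proof -
      obtain w where w: "w \<in> A" "fst w \<in> fst c" "z = tchart c w" using z unfolding coords_def by blast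
      have "L w > 0" using proper w(1) unfolding proper_metric_def by blast
      moreover have "Lc c z = L w" unfolding w(3) using w A_subset by (intro local_rep_tchart[OF c]) blast+
      ultimately show ?thesis by simp
    qed
    show "lorentzian_signature (g_matrix (Lc c) z)" if "z \<in> coords c A" for z
      using finsler c that by (simp add: lorentz_finsler_def)
    show "snd z \<noteq> 0" if "z \<in> coords c A" for z by (rule coords_A_slit[OF c that])
    fix x y assume y: "y \<in> closure {y. (x, y) \<in> coords c A}" "y \<noteq> 0"
    obtain w where w: "w \<in> slit_topology X \<A> closure_of A" "fst w \<in> fst c" "tchart c w = (x, y)"
      by (rule slit_closure_coords[OF openin_A c y])
    then have wB: "w \<in> B1 \<inter> B2" using B1(2) B2(2) by blast
    then show "(x, y) \<in> ?B" using w unfolding coords_def by force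
    have "w \<in> tangent_bundle X \<A>" using wB slit_openin_subset[OF B1(1)] by blast
    then have "?L' (x, y) = L' w" using local_rep_tchart[OF c _ w(2)] w(3) by metis
    moreover assume "(x, y) \<notin> coords c A"
    then have "w \<notin> A" using w unfolding coords_def by force
    ultimately show "?L' (x, y) = 0" using B2(5)[OF w(1)] by simp
  qed
  interpret symmetric_affine_solution "coords c A" "Lc c" "J c"
  proof unfold_locales
    show "Lc c z \<noteq> 0" if "z \<in> coords c A" for z using L_pos[OF that] by simp
    show "snd z \<noteq> 0" if "z \<in> coords c A" for z by (rule slit[OF that])
    show "CARD('n) \<ge> 2" using dim3 by simp
    show "mean_cartan (Lc c) k z = 0" if "z \<in> coords c A" for k z by (rule mean_cartan_chart[OF c that])
    show "smooth_on (coords c A) (J c k i)" "homog 1 (coords c A) (J c k i)" for k i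
      using J c unfolding homogeneous_tensor_1_1_def smooth_homogeneous_components_def homog_def by blast+
    show "affine_equation (Lc c) (J c) z" if "z \<in> coords c A" for z by (rule affine[OF that])
    show "dy j (J c k i) z = dy i (J c k j) z" if z: "z \<in> coords c A" for z i j k
    proof -
      have *: "dy j (J c k i) z = dy j (N c k i) z - dy j (NL (Lc c) k i) z" for i j
      proof -
        have "dy j (N c k i) z = dy j (\<lambda>z. NL (Lc c) k i z + J c k i z) z"
          unfolding dy_dd by (rule dd_eq_on[OF z N])
        moreover have "smooth_on (coords c A) (J c k i)"
          using J c unfolding homogeneous_tensor_1_1_def smooth_homogeneous_components_def by blast
        ultimately show ?thesis by (simp add: dy_dd dd_rules z smooth_N)
      qed
      have "dy j (N c k i) z = dy i (N c k j) z"
        using sym c z unfolding symmetric_connection_def by blast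
      then show ?thesis unfolding * using N_sym[OF z, of j k i] by simp
    qed
  qed
  have "D z = 0" if z: "z \<in> coords c A" for z
  proof -
    let ?D' = "\<lambda>z. \<Sum>a\<in>UNIV. N' c a a z - NL ?L' a a z"
    have "smooth_on ?B ?D'"
      using smooth_on_subset[OF B1(3) subB(1)] ext.smooth_N
      by (intro ext.smooth_rules) auto
    moreover have "?D' z = D z" if z: "z \<in> coords c A" for z
      unfolding D_def by (simp add: B1(4)[OF z] N[OF z] NL_local[OF B2(4) z])
    moreover obtain x y where "z = (x, y)" by (cases z)
    ultimately show ?thesis
      using eigenfunction_vanishes[OF smooth_D homog_D eigenvalue_equation _ _ dim3, of ?D' x y] z by blast
  qed
  from J_eq_0_if_D_eq_0[OF this z] show ?thesis
    by (simp add: N[OF z] canonical_connection_def)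
qed

end

theorem corollary5p15:
  fixes X :: "'a topology"
    and \<A> :: "('a, 'n::finite) chart set"
    and A :: "('a \<times> ('a, 'n) tvec) set"
    and L :: "'a \<times> ('a, 'n) tvec \<Rightarrow> real"
  assumes "smooth_manifold X \<A>"
    and "connected_space X"
    and "CARD('n) \<ge> 3"
    and "conic_domain X \<A> A"
    and "lorentz_finsler X \<A> A L"
    and "vanishing_mean_cartan X \<A> A L"
  shows "symmetric_connection \<A> A (canonical_connection X \<A> L) \<and>
    proper_affine_solution X \<A> A L (canonical_connection X \<A> L) \<and>
    (\<forall>N. symmetric_connection \<A> A N \<and> proper_affine_solution X \<A> A L N \<longrightarrow>
      (\<forall>c\<in>\<A>. \<forall>z\<in>coords c A. \<forall>k i. N c k i z = canonical_connection X \<A> L c k i z))"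
proof -
  interpret lorentz_finsler_manifold X \<A> A L
    using assms by unfold_locales
  show ?thesis
    using canonical_symmetric canonical_affine_solution canonical_extends canonical_unique
    unfolding proper_affine_solution_def by blast
qed

end
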